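(* Let $n\ge1$ and let $(X_i)_{i\in\mathbb Z^n}$ be a translation-invariant spin model on $\mathbb Z^n$: the $X_i$ are random variables with values in a common space $\mathcal X$, and for all $z\in\mathbb Z^n$ the family $(X_{i+z})_{i\in\mathbb Z^n}$ has the same law as $(X_i)_{i\in\mathbb Z^n}$. For $z\in\mathbb Z^n$ let $\epsilon_z=\{X_i:X_{i+z}\}_*$ (which does not depend on $i$). Assume that $\sum_{z\in\mathbb Z^n}\epsilon_z<\infty$. Then for any $f:\mathcal X\to\mathbb R$ such that $f(X_0)$ is square-integrable and centered, there exists a constant $\sigma<\infty$ such that $$\frac1{\sqrt{\ell^n}}\sum_{\substack{i\in\mathbb Z^n\\0\le i_1,\dots,i_n<\ell}}f(X_i)\ \rightharpoonup\ \mathcal N(\sigma^2)\qquad(\ell\to\infty),$$ where $\rightharpoonup$ denotes convergence in law.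
   Context: $\mathcal N(\sigma^2)$ is the centered Gaussian law on $\mathbb R$ with variance $\sigma^2$ (the Dirac mass at $0$ if $\sigma=0$). Functions are measurable. Subjective correlation: for $\sigma$-algebras $\mathcal F,\mathcal G,\mathcal H$, $\{\mathcal F:\mathcal G\}_{\mathcal H}$ is the smallest $\epsilon\in[0,1]$ such that $|\mathbf E[fg]|\le\epsilon\operatorname{sd}(f)\operatorname{sd}(g)$ for all real square-integrable $f$ ($\mathcal F\vee\mathcal H$-measurable) and $g$ ($\mathcal G\vee\mathcal H$-measurable) with $\mathbf E[f|\mathcal H]=\mathbf E[g|\mathcal H]=0$ a.s. ($\operatorname{sd}$ is the standard deviation). For the system $(X_k)_{k\in\mathbb Z^n}$, $$\{X_i:X_j\}_*=\sup_{K\subset\mathbb Z^n}\{\sigma(X_i):\sigma(X_j)\}_{\sigma((X_k)_{k\in K})}.$$ *)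

theory Defs
  imports "HOL-Probability.Probability"
begin

text \<open>Sub-\<sigma>-algebras of \<open>M\<close> are measures \<open>F\<close> with \<open>subalgebra M F\<close>; only \<open>space F\<close> and
  \<open>sets F\<close> matter.\<close>

definition join_algebra :: "'a measure \<Rightarrow> 'a measure \<Rightarrow> 'a measure" where
  "join_algebra F G = sigma (space F) (sets F \<union> sets G)"

definition std_dev :: "'a measure \<Rightarrow> ('a \<Rightarrow> real) \<Rightarrow> real" where
  "std_dev M f = sqrt (prob_space.variance M f)"

definition cond_centered_L2 :: "'a measure \<Rightarrow> 'a measure \<Rightarrow> 'a measure \<Rightarrow> ('a \<Rightarrow> real) set" where
  "cond_centered_L2 M F H = {f \<in> borel_measurable (join_algebra F H).
     integrable M (\<lambda>\<omega>. (f \<omega>)\<^sup>2) \<and> (AE \<omega> in M. real_cond_exp M H f \<omega> = 0)}"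

definition subj_corr_bound :: "'a measure \<Rightarrow> 'a measure \<Rightarrow> 'a measure \<Rightarrow> 'a measure \<Rightarrow> real \<Rightarrow> bool" where
  "subj_corr_bound M F G H \<epsilon> \<longleftrightarrow> 0 \<le> \<epsilon> \<and> \<epsilon> \<le> 1 \<and>
     (\<forall>f \<in> cond_centered_L2 M F H. \<forall>g \<in> cond_centered_L2 M G H.
        \<bar>\<integral>\<omega>. f \<omega> * g \<omega> \<partial>M\<bar> \<le> \<epsilon> * std_dev M f * std_dev M g)"

definition subj_corr :: "'a measure \<Rightarrow> 'a measure \<Rightarrow> 'a measure \<Rightarrow> 'a measure \<Rightarrow> real" where
  "subj_corr M F G H = (LEAST \<epsilon>. subj_corr_bound M F G H \<epsilon>)"

definition family_algebra ::
    "'a measure \<Rightarrow> 'b measure \<Rightarrow> ('i \<Rightarrow> 'a \<Rightarrow> 'b) \<Rightarrow> 'i set \<Rightarrow> 'a measure" where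
  "family_algebra M S X K = vimage_algebra (space M) (\<lambda>\<omega>. \<lambda>k\<in>K. X k \<omega>) (\<Pi>\<^sub>M k\<in>K. S)"

definition subj_corr_star ::
    "'a measure \<Rightarrow> 'b measure \<Rightarrow> ('i \<Rightarrow> 'a \<Rightarrow> 'b) \<Rightarrow> 'i \<Rightarrow> 'i \<Rightarrow> real" where
  "subj_corr_star M S X i j =
     (SUP K. subj_corr M (vimage_algebra (space M) (X i) S) (vimage_algebra (space M) (X j) S)
                         (family_algebra M S X K))"

definition translation_invariant ::
    "'a measure \<Rightarrow> 'b measure \<Rightarrow> ('i::plus \<Rightarrow> 'a \<Rightarrow> 'b) \<Rightarrow> bool" where
  "translation_invariant M S X \<longleftrightarrow>
     (\<forall>z. distr M (\<Pi>\<^sub>M i\<in>UNIV. S) (\<lambda>\<omega> i. X (i + z) \<omega>) = distr M (\<Pi>\<^sub>M i\<in>UNIV. S) (\<lambda>\<omega> i. X i \<omega>))"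

text \<open>The argument is the variance.\<close>
definition gaussian_law :: "real \<Rightarrow> real measure" where
  "gaussian_law v = (if v = 0 then return borel 0 else density lborel (normal_density 0 (sqrt v)))"

text \<open>The least bound exists, and the supremum over \<open>K\<close> is that of a nonempty bounded set:\<close>

lemma subalgebra_join_algebra:
  assumes "subalgebra M F" "subalgebra M G"
  shows "subalgebra M (join_algebra F G)"
proof -
  have sub: "sets F \<union> sets G \<subseteq> sets M" and sp: "space F = space M"
    using assms by (auto simp: subalgebra_def)
  have "sets F \<union> sets G \<subseteq> Pow (space M)"
    using sub sets.space_closed[of M] by (rule subset_trans)
  then have "sets (join_algebra F G) = sigma_sets (space M) (sets F \<union> sets G)"
    by (simp add: join_algebra_def sp)
  then show ?thesis
    using sets.sigma_sets_subset[OF sub] sp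
    by (simp add: subalgebra_def join_algebra_def space_measure_of_conv)
qed

lemma Cauchy_Schwarz_lebesgue_integral:
  fixes f g :: "'a \<Rightarrow> real"
  assumes [measurable]: "f \<in> borel_measurable M" "g \<in> borel_measurable M"
    and [simp]: "integrable M (\<lambda>\<omega>. (f \<omega>)\<^sup>2)" "integrable M (\<lambda>\<omega>. (g \<omega>)\<^sup>2)"
  shows "(\<integral>\<omega>. f \<omega> * g \<omega> \<partial>M)\<^sup>2 \<le> (\<integral>\<omega>. (f \<omega>)\<^sup>2 \<partial>M) * (\<integral>\<omega>. (g \<omega>)\<^sup>2 \<partial>M)"
proof -
  define a b c where "a = (\<integral>\<omega>. (f \<omega>)\<^sup>2 \<partial>M)" and "b = (\<integral>\<omega>. (g \<omega>)\<^sup>2 \<partial>M)"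
    and "c = (\<integral>\<omega>. f \<omega> * g \<omega> \<partial>M)"
  have ab: "a \<ge> 0" "b \<ge> 0" by (simp_all add: a_def b_def)
  have "norm (f \<omega> * g \<omega>) \<le> norm ((f \<omega>)\<^sup>2 + (g \<omega>)\<^sup>2)" for \<omega>
  proof -
    have "2 * (\<bar>f \<omega>\<bar> * \<bar>g \<omega>\<bar>) \<le> (f \<omega>)\<^sup>2 + (g \<omega>)\<^sup>2"
      using sum_squares_bound[of "\<bar>f \<omega>\<bar>" "\<bar>g \<omega>\<bar>"] by simp
    moreover have "0 \<le> \<bar>f \<omega>\<bar> * \<bar>g \<omega>\<bar>" by simp
    ultimately have "\<bar>f \<omega>\<bar> * \<bar>g \<omega>\<bar> \<le> (f \<omega>)\<^sup>2 + (g \<omega>)\<^sup>2" by linarith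
    then show ?thesis by (simp add: abs_mult)
  qed
  then have [simp]: "integrable M (\<lambda>\<omega>. f \<omega> * g \<omega>)"
    by (intro Bochner_Integration.integrable_bound[OF Bochner_Integration.integrable_add[OF assms(3,4)]] AE_I2)
      measurable
  have q: "0 \<le> a - 2 * t * c + t\<^sup>2 * b" for t
  proof -
    have "0 \<le> (\<integral>\<omega>. (f \<omega> - t * g \<omega>)\<^sup>2 \<partial>M)" by simp
    also have "(\<lambda>\<omega>. (f \<omega> - t * g \<omega>)\<^sup>2) =
        (\<lambda>\<omega>. (f \<omega>)\<^sup>2 - 2 * t * (f \<omega> * g \<omega>) + t\<^sup>2 * (g \<omega>)\<^sup>2)"
      by (rule ext, simp only: power2_diff power_mult_distrib mult_ac)
    also have "(\<integral>\<omega>. (f \<omega>)\<^sup>2 - 2 * t * (f \<omega> * g \<omega>) + t\<^sup>2 * (g \<omega>)\<^sup>2 \<partial>M) = a - 2 * t * c + t\<^sup>2 * b"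
      by (simp add: a_def b_def c_def)
    finally show ?thesis .
  qed
  have "c\<^sup>2 \<le> a * b"
  proof (cases "b = 0")
    case True
    have "c = 0"
    proof (rule ccontr)
      assume "c \<noteq> 0"
      then have "2 * ((a + 1) / (2 * c)) * c = a + 1" by simp
      with q[of "(a + 1) / (2 * c)"] True show False by simp
    qed
    then show ?thesis using ab by simp
  next
    case False
    have "a - 2 * (c / b) * c + (c / b)\<^sup>2 * b = a - c\<^sup>2 / b"
      using False by (simp add: power2_eq_square)
    then have "c\<^sup>2 / b \<le> a" using q[of "c / b"] by linarith
    then show ?thesis using False ab by (simp add: pos_divide_le_eq)
  qed
  then show ?thesis by (simp add: a_def b_def c_def)
qed

lemma cond_centered_L2D:
  assumes "prob_space M" "subalgebra M F" "subalgebra M H" "f \<in> cond_centered_L2 M F H"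
  shows "f \<in> borel_measurable M" "integrable M (\<lambda>\<omega>. (f \<omega>)\<^sup>2)" "integrable M f"
    "(\<integral>\<omega>. f \<omega> \<partial>M) = 0"
    "std_dev M f = sqrt (\<integral>\<omega>. (f \<omega>)\<^sup>2 \<partial>M)"
proof -
  interpret prob_space M by fact
  interpret H: finite_measure_subalgebra M H by unfold_locales fact
  show m: "f \<in> borel_measurable M"
    using assms(4) measurable_from_subalg[OF subalgebra_join_algebra[OF assms(2,3)]]
    by (auto simp: cond_centered_L2_def)
  show q: "integrable M (\<lambda>\<omega>. (f \<omega>)\<^sup>2)"
    using assms(4) by (simp add: cond_centered_L2_def)
  show i: "integrable M f"
    using square_integrable_imp_integrable[OF m q] .
  have "(\<integral>\<omega>. f \<omega> \<partial>M) = (\<integral>\<omega>. real_cond_exp M H f \<omega> \<partial>M)"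
    using H.real_cond_exp_int(2)[OF i] by simp
  also have "\<dots> = (\<integral>\<omega>. 0 \<partial>M)"
    using assms(4) by (intro integral_cong_AE) (auto simp: cond_centered_L2_def)
  finally show z: "(\<integral>\<omega>. f \<omega> \<partial>M) = 0" by simp
  then show "std_dev M f = sqrt (\<integral>\<omega>. (f \<omega>)\<^sup>2 \<partial>M)"
    by (simp add: std_dev_def)
qed

lemma subj_corr_bound_1:
  assumes "prob_space M" "subalgebra M F" "subalgebra M G" "subalgebra M H"
  shows "subj_corr_bound M F G H 1"
  unfolding subj_corr_bound_def
proof (intro conjI ballI)
  interpret prob_space M by fact
  fix f g assume "f \<in> cond_centered_L2 M F H" "g \<in> cond_centered_L2 M G H"
  note f = cond_centered_L2D[OF assms(1,2,4) this(1)] and g = cond_centered_L2D[OF assms(1,3,4) this(2)]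
  have "(\<integral>\<omega>. f \<omega> * g \<omega> \<partial>M)\<^sup>2 \<le> (\<integral>\<omega>. (f \<omega>)\<^sup>2 \<partial>M) * (\<integral>\<omega>. (g \<omega>)\<^sup>2 \<partial>M)"
    using Cauchy_Schwarz_lebesgue_integral[OF f(1) g(1) f(2) g(2)] .
  then have "\<bar>\<integral>\<omega>. f \<omega> * g \<omega> \<partial>M\<bar> \<le> sqrt ((\<integral>\<omega>. (f \<omega>)\<^sup>2 \<partial>M) * (\<integral>\<omega>. (g \<omega>)\<^sup>2 \<partial>M))"
    using real_le_rsqrt by fastforce
  then show "\<bar>\<integral>\<omega>. f \<omega> * g \<omega> \<partial>M\<bar> \<le> 1 * std_dev M f * std_dev M g"
    by (simp add: f(5) g(5) real_sqrt_mult)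
qed auto

lemma subj_corr:
  assumes "prob_space M" "subalgebra M F" "subalgebra M G" "subalgebra M H"
  shows "subj_corr_bound M F G H (subj_corr M F G H)"
    and "\<And>\<epsilon>. subj_corr_bound M F G H \<epsilon> \<Longrightarrow> subj_corr M F G H \<le> \<epsilon>"
proof -
  let ?B = "subj_corr_bound M F G H"
  let ?m = "Inf (Collect ?B)"
  have ne: "Collect ?B \<noteq> {}" using subj_corr_bound_1[OF assms] by blast
  have bb: "bdd_below (Collect ?B)" by (rule bdd_belowI[of _ 0]) (auto simp: subj_corr_bound_def)
  have le: "?m \<le> \<epsilon>" if "?B \<epsilon>" for \<epsilon> using that bb by (auto intro: cInf_lower)
  have "closed {\<epsilon>. 0 \<le> \<epsilon> \<and> \<epsilon> \<le> 1 \<and> (\<forall>f. \<forall>g. f \<in> cond_centered_L2 M F H \<longrightarrow> g \<in> cond_centered_L2 M G H \<longrightarrow>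
      \<bar>\<integral>\<omega>. f \<omega> * g \<omega> \<partial>M\<bar> \<le> \<epsilon> * std_dev M f * std_dev M g)}"
    by (intro closed_Collect_conj closed_Collect_all closed_Collect_imp closed_Collect_le
        open_Collect_const continuous_intros)
  moreover have "Collect ?B = {\<epsilon>. 0 \<le> \<epsilon> \<and> \<epsilon> \<le> 1 \<and> (\<forall>f. \<forall>g. f \<in> cond_centered_L2 M F H \<longrightarrow>
      g \<in> cond_centered_L2 M G H \<longrightarrow> \<bar>\<integral>\<omega>. f \<omega> * g \<omega> \<partial>M\<bar> \<le> \<epsilon> * std_dev M f * std_dev M g)}"
    unfolding subj_corr_bound_def by blast
  ultimately have "closed (Collect ?B)" by simp
  then have "?B ?m" using closed_contains_Inf[OF ne bb] by simp
  moreover have "subj_corr M F G H = ?m"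
    unfolding subj_corr_def using \<open>?B ?m\<close> le by (rule Least_equality)
  ultimately show "?B (subj_corr M F G H)" "\<And>\<epsilon>. ?B \<epsilon> \<Longrightarrow> subj_corr M F G H \<le> \<epsilon>"
    using le by auto
qed

lemma subalgebra_family_algebra:
  assumes "\<And>i. X i \<in> measurable M S"
  shows "subalgebra M (vimage_algebra (space M) (X i) S)" "subalgebra M (family_algebra M S X K)"
proof -
  show "subalgebra M (vimage_algebra (space M) (X i) S)"
    unfolding subalgebra_def using sets_image_in_sets[OF refl assms[of i]] by simp
  have "(\<lambda>\<omega>. \<lambda>k\<in>K. X k \<omega>) \<in> measurable M (\<Pi>\<^sub>M k\<in>K. S)"
    by (intro measurable_restrict assms)
  from sets_image_in_sets[OF refl this] show "subalgebra M (family_algebra M S X K)"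
    unfolding subalgebra_def family_algebra_def by simp
qed

lemma bdd_above_subj_corr:
  assumes "prob_space M" "\<And>i. X i \<in> measurable M S"
  shows "bdd_above (range (\<lambda>K. subj_corr M (vimage_algebra (space M) (X i) S)
           (vimage_algebra (space M) (X j) S) (family_algebra M S X K)))"
proof (rule bdd_aboveI[of _ 1], elim imageE)
  fix x K
  assume "x = subj_corr M (vimage_algebra (space M) (X i) S)
           (vimage_algebra (space M) (X j) S) (family_algebra M S X K)"
  moreover have "subj_corr_bound M (vimage_algebra (space M) (X i) S)
      (vimage_algebra (space M) (X j) S) (family_algebra M S X K)
      (subj_corr M (vimage_algebra (space M) (X i) S) (vimage_algebra (space M) (X j) S)
        (family_algebra M S X K))"
    by (intro subj_corr(1) subalgebra_family_algebra assms)
  ultimately show "x \<le> 1" by (simp add: subj_corr_bound_def)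
qed

end

theory Submission
  imports Defs
begin

text \<open>The characteristic function \<open>\<phi>(t) = E exp (i t Z)\<close> of the normalized sum \<open>Z\<close> almost solves
  \<open>\<phi>' = - t v \<phi>\<close> with \<open>v = E Z\<^sup>2\<close>. As in Bolthausen's proof, this needs bounds of order
  \<open>N\<^sup>-\<^sup>1\<^sup>/\<^sup>2\<close> for the covariance of \<open>exp (i t Z)\<close> with functions of one or two sites. Define the influence of a site
  \<open>j\<close> on \<open>g = exp (i t Z)\<close> given a set \<open>K\<close> of revealed sites as the \<open>L\<^sup>2\<close> norm of
  \<open>E[g | K, j] - E[g | K]\<close>. Dropping \<open>j\<close> from the sum and revealing the other sites \<open>k\<close> one at a time, each
  contributes at most \<open>\<epsilon>\<^sub>j\<^sub>k\<close> times its own influence. Because the \<open>\<epsilon>\<^sub>z\<close> are summable, the lattice can be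
  coloured with finitely many colours such that the row sums of \<open>\<epsilon>\<close> within a colour are at most \<open>1/2\<close>;
  revealing the colours in order makes the recursion triangular in the colours and contracting within
  each of them, so that all influences are of order \<open>N\<^sup>-\<^sup>1\<^sup>/\<^sup>2\<close>. Truncation removes the boundedness of
  \<open>f\<close>.\<close>

section \<open>Conditional expectations and subjective correlations in \<open>L\<^sup>2\<close>\<close>

text \<open>Weak dependence is assumed only between two single sites, but conditionally on every set
  of sites. This permits exposing one site after another: the increment of \<open>E[g | L]\<close>
  when \<open>k\<close> joins \<open>L\<close> is centred given \<open>L\<close>, so only the part
  of a test function of \<open>j\<close> that is centred given \<open>L\<close> meets it, and the
  pairing is controlled by \<open>corr j k\<close>. The resulting inequality bounds the influence of
  \<open>j\<close> by \<open>d\<close> plus the sum of the other influences with weights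
  \<open>corr j k\<close>; alone it gives no control when row sums exceed 1. With colours, the
  constant grows by a factor \<open>2 + 2 * E\<close> from each colour to the preceding one: half of
  it absorbs the own colour, the other half absorbs the explicit term and the later colours. No a
  priori bound on influences is required, because dropping \<open>j\<close> shrinks the functional
  and the recursion terminates. Cosines with a phase replace complex exponentials; phases 0 and
  -pi/2 give the real and imaginary parts. The differential equation uses the variance of the finite
  sum itself, so convergence of the variances is a separate matter, and the shape of the boxes
  matters only there.\<close>

definition L2 :: "'a measure \<Rightarrow> ('a \<Rightarrow> real) set" where
  "L2 M = {f \<in> borel_measurable M. integrable M (\<lambda>\<omega>. (f \<omega>)\<^sup>2)}"

definition L2_norm :: "'a measure \<Rightarrow> ('a \<Rightarrow> real) \<Rightarrow> real" where
  "L2_norm M f = sqrt (\<integral>\<omega>. (f \<omega>)\<^sup>2 \<partial>M)"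

lemma L2_norm_nonneg [simp]: "0 \<le> L2_norm M f"
  by (simp add: L2_norm_def)

lemma L2_norm_power2: "(L2_norm M f)\<^sup>2 = (\<integral>\<omega>. (f \<omega>)\<^sup>2 \<partial>M)"
  by (simp add: L2_norm_def)

lemma L2_norm_cmult: "L2_norm M (\<lambda>\<omega>. c * f \<omega>) = \<bar>c\<bar> * L2_norm M f"
  by (simp add: L2_norm_def power_mult_distrib real_sqrt_mult)

lemma L2_measurable: "f \<in> L2 M \<Longrightarrow> f \<in> borel_measurable M"
  by (simp add: L2_def)

lemma L2_integrable_mult:
  assumes "f \<in> L2 M" "g \<in> L2 M"
  shows "integrable M (\<lambda>\<omega>. f \<omega> * g \<omega>)"
proof -
  have "norm (f \<omega> * g \<omega>) \<le> norm ((f \<omega>)\<^sup>2 + (g \<omega>)\<^sup>2)" for \<omega>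
  proof -
    have "2 * (\<bar>f \<omega>\<bar> * \<bar>g \<omega>\<bar>) \<le> (f \<omega>)\<^sup>2 + (g \<omega>)\<^sup>2"
      using sum_squares_bound[of "\<bar>f \<omega>\<bar>" "\<bar>g \<omega>\<bar>"] by simp
    moreover have "0 \<le> \<bar>f \<omega>\<bar> * \<bar>g \<omega>\<bar>" by simp
    ultimately have "\<bar>f \<omega>\<bar> * \<bar>g \<omega>\<bar> \<le> (f \<omega>)\<^sup>2 + (g \<omega>)\<^sup>2" by linarith
    then show ?thesis by (simp add: abs_mult)
  qed
  moreover have "integrable M (\<lambda>\<omega>. (f \<omega>)\<^sup>2 + (g \<omega>)\<^sup>2)" "(\<lambda>\<omega>. f \<omega> * g \<omega>) \<in> borel_measurable M"
    using assms by (auto simp: L2_def)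
  ultimately show ?thesis
    by (blast intro: Bochner_Integration.integrable_bound[OF _ _ AE_I2])
qed

lemma L2_Cauchy_Schwarz:
  assumes "f \<in> L2 M" "g \<in> L2 M"
  shows "\<bar>\<integral>\<omega>. f \<omega> * g \<omega> \<partial>M\<bar> \<le> L2_norm M f * L2_norm M g"
proof -
  have "(\<integral>\<omega>. f \<omega> * g \<omega> \<partial>M)\<^sup>2 \<le> (\<integral>\<omega>. (f \<omega>)\<^sup>2 \<partial>M) * (\<integral>\<omega>. (g \<omega>)\<^sup>2 \<partial>M)"
    using assms by (intro Cauchy_Schwarz_lebesgue_integral) (auto simp: L2_def)
  then have "sqrt ((\<integral>\<omega>. f \<omega> * g \<omega> \<partial>M)\<^sup>2) \<le> sqrt ((\<integral>\<omega>. (f \<omega>)\<^sup>2 \<partial>M) * (\<integral>\<omega>. (g \<omega>)\<^sup>2 \<partial>M))"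
    by (rule real_sqrt_le_mono)
  then show ?thesis by (simp add: L2_norm_def real_sqrt_mult)
qed

lemma L2_cmult: "f \<in> L2 M \<Longrightarrow> (\<lambda>\<omega>. c * f \<omega>) \<in> L2 M"
  by (auto simp: L2_def power_mult_distrib)

lemma L2_add:
  assumes "f \<in> L2 M" "g \<in> L2 M"
  shows "(\<lambda>\<omega>. f \<omega> + g \<omega>) \<in> L2 M"
proof -
  have "integrable M (\<lambda>\<omega>. (f \<omega>)\<^sup>2 + (g \<omega>)\<^sup>2 + 2 * (f \<omega> * g \<omega>))"
    using assms L2_integrable_mult[OF assms] by (auto simp: L2_def)
  moreover have "(\<lambda>\<omega>. (f \<omega>)\<^sup>2 + (g \<omega>)\<^sup>2 + 2 * (f \<omega> * g \<omega>)) = (\<lambda>\<omega>. (f \<omega> + g \<omega>)\<^sup>2)"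
    by (auto simp: power2_sum mult.assoc)
  moreover have "(\<lambda>\<omega>. f \<omega> + g \<omega>) \<in> borel_measurable M"
    using assms by (auto simp: L2_def)
  ultimately show ?thesis
    by (simp add: L2_def)
qed

lemma L2_uminus: "f \<in> L2 M \<Longrightarrow> (\<lambda>\<omega>. - f \<omega>) \<in> L2 M"
  by (auto simp: L2_def)

lemma L2_diff: "f \<in> L2 M \<Longrightarrow> g \<in> L2 M \<Longrightarrow> (\<lambda>\<omega>. f \<omega> - g \<omega>) \<in> L2 M"
  using L2_add[of f M "\<lambda>\<omega>. - g \<omega>"] by (simp add: L2_uminus)

lemma L2_zero: "(\<lambda>\<omega>. 0) \<in> L2 M"
  by (simp add: L2_def)

lemma L2_sum: "(\<And>i. i \<in> I \<Longrightarrow> f i \<in> L2 M) \<Longrightarrow> (\<lambda>\<omega>. \<Sum>i\<in>I. f i \<omega>) \<in> L2 M"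
  by (induction I rule: infinite_finite_induct) (auto intro: L2_zero L2_add)

lemma (in finite_measure) L2_bounded:
  assumes "f \<in> borel_measurable M" "\<And>\<omega>. \<bar>f \<omega>\<bar> \<le> c"
  shows "f \<in> L2 M"
proof -
  have "(f \<omega>)\<^sup>2 \<le> c\<^sup>2" for \<omega>
    using power_mono[OF assms(2)[of \<omega>], of 2] by simp
  then show ?thesis
    using assms by (auto simp: L2_def intro!: integrable_const_bound[where B="c\<^sup>2"])
qed

lemma (in finite_measure) L2_integrable: "f \<in> L2 M \<Longrightarrow> integrable M f"
  by (auto simp: L2_def intro: square_integrable_imp_integrable)

lemma (in prob_space) L2_norm_bounded:
  assumes "f \<in> borel_measurable M" "\<And>\<omega>. \<bar>f \<omega>\<bar> \<le> c"
  shows "L2_norm M f \<le> c"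
proof -
  have c: "0 \<le> c" using assms(2)[of undefined] by linarith
  have le: "(f \<omega>)\<^sup>2 \<le> c\<^sup>2" for \<omega>
    using power_mono[OF assms(2)[of \<omega>], of 2] by simp
  have "(\<integral>\<omega>. (f \<omega>)\<^sup>2 \<partial>M) \<le> (\<integral>\<omega>. c\<^sup>2 \<partial>M)"
    using L2_bounded[OF assms] le by (intro integral_mono) (auto simp: L2_def)
  then show ?thesis
    using c by (simp add: L2_norm_def prob_space real_le_lsqrt)
qed

lemma L2_norm_mono:
  assumes "f \<in> borel_measurable M" "g \<in> L2 M" "\<And>\<omega>. \<bar>f \<omega>\<bar> \<le> \<bar>g \<omega>\<bar>"
  shows "f \<in> L2 M" "L2_norm M f \<le> L2_norm M g"
proof -
  have le: "(f \<omega>)\<^sup>2 \<le> (g \<omega>)\<^sup>2" for \<omega>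
    using power_mono[OF assms(3)[of \<omega>], of 2] by simp
  show f: "f \<in> L2 M"
    using assms le unfolding L2_def
    by (auto intro!: Bochner_Integration.integrable_bound[of M "\<lambda>\<omega>. (g \<omega>)\<^sup>2"])
  show "L2_norm M f \<le> L2_norm M g"
    using assms f le by (auto simp: L2_norm_def L2_def intro!: integral_mono)
qed

lemma (in prob_space) abs_integral_le_L2_norm:
  assumes "f \<in> L2 M"
  shows "\<bar>\<integral>\<omega>. f \<omega> \<partial>M\<bar> \<le> L2_norm M f"
proof -
  have "(\<lambda>\<omega>. 1) \<in> L2 M" "L2_norm M (\<lambda>\<omega>. 1) = 1"
    by (auto simp: L2_def L2_norm_def prob_space)
  then show ?thesis using L2_Cauchy_Schwarz[OF assms, of "\<lambda>\<omega>. 1"] by simp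
qed

context finite_measure_subalgebra
begin

lemma L2_cond_exp:
  assumes "f \<in> L2 M"
  shows "real_cond_exp M F f \<in> L2 M"
proof -
  have f [measurable]: "f \<in> borel_measurable M" "integrable M (\<lambda>\<omega>. (f \<omega>)\<^sup>2)" "integrable M f"
    using assms L2_integrable[OF assms] by (auto simp: L2_def)
  have conv: "convex_on UNIV (\<lambda>x::real. x\<^sup>2)"
    by (rule convex_on_realI[where f' = "\<lambda>x. 2 * x"]) (auto intro!: derivative_eq_intros)
  have "AE \<omega> in M. (real_cond_exp M F f \<omega>)\<^sup>2 \<le> real_cond_exp M F (\<lambda>\<omega>. (f \<omega>)\<^sup>2) \<omega>"
    using f conv by (intro real_cond_exp_jensens_inequality(2)[of f UNIV]) simp_all
  moreover have "integrable M (real_cond_exp M F (\<lambda>\<omega>. (f \<omega>)\<^sup>2))"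
    by (rule real_cond_exp_int(1)) fact
  moreover have "real_cond_exp M F f \<in> borel_measurable M"
    by measurable
  ultimately show ?thesis
    by (auto simp: L2_def intro!: Bochner_Integration.integrable_bound[of M "real_cond_exp M F (\<lambda>\<omega>. (f \<omega>)\<^sup>2)"])
qed

lemma integral_mult_cond_exp:
  assumes "f \<in> L2 M" "h \<in> L2 M" "h \<in> borel_measurable F"
  shows "(\<integral>\<omega>. h \<omega> * real_cond_exp M F f \<omega> \<partial>M) = (\<integral>\<omega>. h \<omega> * f \<omega> \<partial>M)"
  using assms L2_measurable[OF assms(1)] by (intro real_cond_exp_intg(2) L2_integrable_mult) auto

lemma integral_mult_eq_0:
  assumes "f \<in> L2 M" "h \<in> L2 M" "h \<in> borel_measurable F" "AE \<omega> in M. real_cond_exp M F f \<omega> = 0"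
  shows "(\<integral>\<omega>. h \<omega> * f \<omega> \<partial>M) = 0"
proof -
  have "(\<integral>\<omega>. h \<omega> * f \<omega> \<partial>M) = (\<integral>\<omega>. h \<omega> * real_cond_exp M F f \<omega> \<partial>M)"
    using integral_mult_cond_exp[OF assms(1-3)] by simp
  also have "\<dots> = (\<integral>\<omega>. 0 \<partial>M)"
    using assms(4) L2_measurable[OF assms(2)] by (intro integral_cong_AE) (auto elim: eventually_mono)
  finally show ?thesis by simp
qed

text \<open>Conditional expectation is an orthogonal projection in L2; Pythagoras gives both
  contractions at once.\<close>

lemma L2_norm_minus_cond_exp:
  assumes "f \<in> L2 M"
  shows "L2_norm M (\<lambda>\<omega>. f \<omega> - real_cond_exp M F f \<omega>) \<le> L2_norm M f"
    and "L2_norm M (real_cond_exp M F f) \<le> L2_norm M f"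
proof -
  let ?q = "real_cond_exp M F f"
  note q = L2_cond_exp[OF assms]
  have qq: "(\<integral>\<omega>. (?q \<omega>)\<^sup>2 \<partial>M) = (\<integral>\<omega>. ?q \<omega> * f \<omega> \<partial>M)"
    using integral_mult_cond_exp[OF assms q] by (simp add: power2_eq_square)
  have "(\<integral>\<omega>. (f \<omega> - ?q \<omega>)\<^sup>2 \<partial>M) = (\<integral>\<omega>. (f \<omega>)\<^sup>2 - 2 * (?q \<omega> * f \<omega>) + (?q \<omega>)\<^sup>2 \<partial>M)"
    by (intro Bochner_Integration.integral_cong) (auto simp: power2_diff)
  also have "\<dots> = (\<integral>\<omega>. (f \<omega>)\<^sup>2 \<partial>M) - (\<integral>\<omega>. (?q \<omega>)\<^sup>2 \<partial>M)"
    using assms q L2_integrable_mult[OF q assms] qq by (simp add: L2_def)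
  finally have e: "(\<integral>\<omega>. (f \<omega> - ?q \<omega>)\<^sup>2 \<partial>M) = (\<integral>\<omega>. (f \<omega>)\<^sup>2 \<partial>M) - (\<integral>\<omega>. (?q \<omega>)\<^sup>2 \<partial>M)" .
  have "0 \<le> (\<integral>\<omega>. (f \<omega> - ?q \<omega>)\<^sup>2 \<partial>M)" "0 \<le> (\<integral>\<omega>. (?q \<omega>)\<^sup>2 \<partial>M)" by simp_all
  with e show "L2_norm M (\<lambda>\<omega>. f \<omega> - ?q \<omega>) \<le> L2_norm M f" "L2_norm M ?q \<le> L2_norm M f"
    unfolding L2_norm_def by simp_all
qed

lemma cond_exp_centered:
  assumes "f \<in> L2 M"
  shows "AE \<omega> in M. real_cond_exp M F (\<lambda>\<omega>. f \<omega> - real_cond_exp M F f \<omega>) \<omega> = 0"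
proof -
  have i: "integrable M f" "integrable M (real_cond_exp M F f)"
    using L2_integrable[OF assms] L2_integrable[OF L2_cond_exp[OF assms]] by blast+
  have "AE \<omega> in M. real_cond_exp M F (real_cond_exp M F f) \<omega> = real_cond_exp M F f \<omega>"
    using i by (intro real_cond_exp_F_meas) simp_all
  moreover have "AE \<omega> in M. real_cond_exp M F (\<lambda>\<omega>. f \<omega> - real_cond_exp M F f \<omega>) \<omega> =
      real_cond_exp M F f \<omega> - real_cond_exp M F (real_cond_exp M F f) \<omega>"
    by (rule real_cond_exp_diff[OF i])
  ultimately show ?thesis by eventually_elim simp
qed

end

section \<open>Random fields and the exposure of sites one at a time\<close>

locale random_field = prob_space M for M :: "'a measure" +
  fixes S :: "'b measure" and X :: "'i \<Rightarrow> 'a \<Rightarrow> 'b"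
  assumes X_measurable [measurable]: "\<And>i. X i \<in> measurable M S"
begin

abbreviation \<H> :: "'i set \<Rightarrow> 'a measure" where
  "\<H> K \<equiv> family_algebra M S X K"

abbreviation \<Q> :: "'i set \<Rightarrow> ('a \<Rightarrow> real) \<Rightarrow> 'a \<Rightarrow> real" where
  "\<Q> K \<equiv> real_cond_exp M (\<H> K)"

abbreviation corr :: "'i \<Rightarrow> 'i \<Rightarrow> real" where
  "corr i j \<equiv> subj_corr_star M S X i j"

lemma space_\<H> [simp]: "space (\<H> K) = space M"
  by (simp add: family_algebra_def)

lemma subalg: "subalgebra M (\<H> K)"
  by (rule subalgebra_family_algebra) (rule X_measurable)

lemma cond: "finite_measure_subalgebra M (\<H> K)"
  by unfold_locales (rule subalg)

lemma sigma_cond: "sigma_finite_subalgebra M (\<H> K)"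
  by (rule finite_measure_subalgebra_is_sigma_finite[OF cond])

lemma X_measurable_\<H>: "k \<in> K \<Longrightarrow> X k \<in> measurable (\<H> K) S"
proof -
  assume k: "k \<in> K"
  have "(\<lambda>\<omega>. \<lambda>k\<in>K. X k \<omega>) \<in> measurable (\<H> K) (\<Pi>\<^sub>M k\<in>K. S)"
    unfolding family_algebra_def
    using measurable_space[OF X_measurable]
    by (intro measurable_vimage_algebra1) (auto simp: space_PiM)
  from measurable_compose[OF this measurable_component_singleton[OF k]]
  show ?thesis using k by simp
qed

lemma sets_\<H>_subset:
  assumes "space N = space M" "\<And>k. k \<in> K \<Longrightarrow> X k \<in> measurable N S"
  shows "sets (\<H> K) \<subseteq> sets N"
  unfolding family_algebra_def
  by (rule sets_image_in_sets[OF assms(1)]) (rule measurable_restrict, rule assms(2))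

lemma subalg_mono: "K \<subseteq> L \<Longrightarrow> subalgebra (\<H> L) (\<H> K)"
  unfolding subalgebra_def
  by (intro conjI sets_\<H>_subset) (auto intro: X_measurable_\<H>)

lemma \<H>_mono: "f \<in> borel_measurable (\<H> K) \<Longrightarrow> K \<subseteq> L \<Longrightarrow> f \<in> borel_measurable (\<H> L)"
  using measurable_from_subalg[OF subalg_mono] by blast

lemma \<H>_measurable: "f \<in> borel_measurable (\<H> K) \<Longrightarrow> f \<in> borel_measurable M"
  using measurable_from_subalg[OF subalg] by blast

text \<open>Links the algebra of a set of sites, convenient for exposing sites, with the join that
  occurs in the definition of subjective correlation. The converse, \<open>join_\<H>\<close>, is
  needed only to compare two fields.\<close>

lemma \<H>_join:
  assumes "f \<in> borel_measurable (\<H> (insert i K))"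
  shows "f \<in> borel_measurable (join_algebra (vimage_algebra (space M) (X i) S) (\<H> K))" (is "_ \<in> borel_measurable ?J")
proof -
  let ?V = "vimage_algebra (space M) (X i) S"
  have V: "subalgebra M ?V"
    by (rule subalgebra_family_algebra) (rule X_measurable)
  have le: "sets ?V \<union> sets (\<H> K) \<subseteq> Pow (space M)"
    using sets.space_closed[of ?V] sets.space_closed[of "\<H> K"] by auto
  have sJ: "space ?J = space M" "sets ?V \<subseteq> sets ?J" "sets (\<H> K) \<subseteq> sets ?J"
    using le by (auto simp: join_algebra_def space_measure_of_conv)
  have "X k \<in> measurable ?J S" if "k \<in> insert i K" for k
  proof (cases "k = i")
    case True
    have "X i \<in> measurable ?V S"
      using measurable_space[OF X_measurable] by (intro measurable_vimage_algebra1) auto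
    then show ?thesis
      using True sJ by (auto simp: measurable_def)
  next
    case False
    with that have "X k \<in> measurable (\<H> K) S" by (intro X_measurable_\<H>) auto
    then show ?thesis using sJ by (auto simp: measurable_def)
  qed
  then have "sets (\<H> (insert i K)) \<subseteq> sets ?J"
    using sJ by (intro sets_\<H>_subset) auto
  then have "subalgebra ?J (\<H> (insert i K))"
    using sJ by (simp add: subalgebra_def)
  from measurable_from_subalg[OF this assms] show ?thesis .
qed

text \<open>The supremum in \<open>corr\<close> runs over all conditioning sets, so one coefficient
  serves every \<open>K\<close>, finite or not. Standard deviations become L2 norms since centring
  given \<open>K\<close> forces mean zero.\<close>

lemma corr_bound:
  assumes h: "h \<in> L2 M" "h \<in> borel_measurable (\<H> (insert j K))" "AE \<omega> in M. \<Q> K h \<omega> = 0"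
    and g: "g \<in> L2 M" "g \<in> borel_measurable (\<H> (insert k K))" "AE \<omega> in M. \<Q> K g \<omega> = 0"
  shows "\<bar>\<integral>\<omega>. h \<omega> * g \<omega> \<partial>M\<bar> \<le> corr j k * L2_norm M h * L2_norm M g"
proof -
  let ?V = "\<lambda>i. vimage_algebra (space M) (X i) S"
  have V: "subalgebra M (?V i)" for i
    by (rule subalgebra_family_algebra) (rule X_measurable)
  have hc: "h \<in> cond_centered_L2 M (?V j) (\<H> K)" "g \<in> cond_centered_L2 M (?V k) (\<H> K)"
    using h g \<H>_join by (auto simp: cond_centered_L2_def L2_def)
  let ?e = "subj_corr M (?V j) (?V k) (\<H> K)"
  have b: "subj_corr_bound M (?V j) (?V k) (\<H> K) ?e"
    by (rule subj_corr(1)[OF prob_space_axioms V V subalg])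
  have "\<bar>\<integral>\<omega>. h \<omega> * g \<omega> \<partial>M\<bar> \<le> ?e * std_dev M h * std_dev M g"
    using b hc unfolding subj_corr_bound_def by blast
  also have "\<dots> = ?e * L2_norm M h * L2_norm M g"
    using cond_centered_L2D(5)[OF prob_space_axioms V subalg] hc by (auto simp: L2_norm_def)
  also have "?e * L2_norm M h * L2_norm M g \<le> corr j k * L2_norm M h * L2_norm M g"
    unfolding subj_corr_star_def
    by (intro mult_right_mono cSUP_upper bdd_above_subj_corr prob_space_axioms X_measurable) auto
  finally show ?thesis .
qed

lemma corr_nonneg: "0 \<le> corr j k"
proof -
  let ?V = "\<lambda>i. vimage_algebra (space M) (X i) S"
  have V: "subalgebra M (?V i)" for i
    by (rule subalgebra_family_algebra) (rule X_measurable)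
  have "0 \<le> subj_corr M (?V j) (?V k) (\<H> {})"
    using subj_corr(1)[OF prob_space_axioms V V subalg] unfolding subj_corr_bound_def by blast
  also have "\<dots> \<le> corr j k"
    unfolding subj_corr_star_def
    by (intro cSUP_upper bdd_above_subj_corr prob_space_axioms X_measurable) auto
  finally show ?thesis .
qed

lemmas L2_\<Q> = finite_measure_subalgebra.L2_cond_exp[OF cond]
lemmas integral_mult_\<Q> = finite_measure_subalgebra.integral_mult_cond_exp[OF cond]
lemmas integral_mult_\<Q>_eq_0 = finite_measure_subalgebra.integral_mult_eq_0[OF cond]
lemmas L2_norm_\<Q> = finite_measure_subalgebra.L2_norm_minus_cond_exp[OF cond]
lemmas \<Q>_centered = finite_measure_subalgebra.cond_exp_centered[OF cond]

lemma \<Q>_measurable: "\<Q> K h \<in> borel_measurable (\<H> K)"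
  by simp

lemma \<Q>_increment_centered:
  assumes "g \<in> L2 M" "G \<subseteq> L"
  shows "AE \<omega> in M. \<Q> G (\<lambda>\<omega>. \<Q> L g \<omega> - \<Q> G g \<omega>) \<omega> = 0"
proof -
  interpret G: finite_measure_subalgebra M "\<H> G" by (rule cond)
  have i: "integrable M g" "integrable M (\<Q> L g)" "integrable M (\<Q> G g)"
    using assms by (auto intro!: L2_integrable L2_\<Q>)
  have "AE \<omega> in M. \<Q> G (\<Q> G g) \<omega> = \<Q> G g \<omega>"
    using i by (intro G.real_cond_exp_F_meas) auto
  moreover have "AE \<omega> in M. \<Q> G (\<Q> L g) \<omega> = \<Q> G g \<omega>"
    using i assms by (intro G.real_cond_exp_nested_subalg subalg subalg_mono) auto
  moreover have "AE \<omega> in M. \<Q> G (\<lambda>\<omega>. \<Q> L g \<omega> - \<Q> G g \<omega>) \<omega> = \<Q> G (\<Q> L g) \<omega> - \<Q> G (\<Q> G g) \<omega>"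
    by (rule G.real_cond_exp_diff[OF i(2,3)])
  ultimately show ?thesis by eventually_elim simp
qed

text \<open>The increment is orthogonal to every square-integrable function of the sites in
  \<open>G\<close>, so \<open>h\<close> may be replaced by \<open>h - \<Q> G h\<close>. Both factors
  are then centred given \<open>G\<close>, as \<open>corr_bound\<close> demands, and the replacement
  does not increase the norm.\<close>

lemma integral_mult_increment_le:
  assumes h: "h \<in> L2 M" "h \<in> borel_measurable (\<H> (insert j G))" and g: "g \<in> L2 M"
  shows "\<bar>\<integral>\<omega>. h \<omega> * (\<Q> (insert k G) g \<omega> - \<Q> G g \<omega>) \<partial>M\<bar>
    \<le> corr j k * L2_norm M h * L2_norm M (\<lambda>\<omega>. \<Q> (insert k G) g \<omega> - \<Q> G g \<omega>)"
proof -
  define V where "V = (\<lambda>\<omega>. \<Q> (insert k G) g \<omega> - \<Q> G g \<omega>)"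
  define h' where "h' = (\<lambda>\<omega>. h \<omega> - \<Q> G h \<omega>)"
  have V: "V \<in> L2 M" "V \<in> borel_measurable (\<H> (insert k G))" "AE \<omega> in M. \<Q> G V \<omega> = 0"
    unfolding V_def using g \<Q>_increment_centered[OF g, of G "insert k G"]
    by (auto intro!: L2_diff L2_\<Q> borel_measurable_diff \<H>_mono[OF \<Q>_measurable])
  have h': "h' \<in> L2 M" "h' \<in> borel_measurable (\<H> (insert j G))" "AE \<omega> in M. \<Q> G h' \<omega> = 0"
    unfolding h'_def using h \<Q>_centered[OF h(1)]
    by (auto intro!: L2_diff L2_\<Q> borel_measurable_diff \<H>_mono[OF \<Q>_measurable])
  have "(\<integral>\<omega>. \<Q> G h \<omega> * V \<omega> \<partial>M) = 0"
    using h V by (intro integral_mult_\<Q>_eq_0[where K=G] L2_\<Q>) auto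
  moreover have "(\<integral>\<omega>. h' \<omega> * V \<omega> \<partial>M) = (\<integral>\<omega>. h \<omega> * V \<omega> \<partial>M) - (\<integral>\<omega>. \<Q> G h \<omega> * V \<omega> \<partial>M)"
    using h V L2_integrable_mult[OF h(1) V(1)] L2_integrable_mult[OF L2_\<Q>[OF h(1)] V(1)]
    by (simp add: h'_def left_diff_distrib)
  ultimately have "\<bar>\<integral>\<omega>. h \<omega> * V \<omega> \<partial>M\<bar> \<le> corr j k * L2_norm M h' * L2_norm M V"
    using corr_bound[OF h' V] by simp
  also have "\<dots> \<le> corr j k * L2_norm M h * L2_norm M V"
    using L2_norm_\<Q>(1)[OF h(1)] unfolding h'_def
    by (intro mult_right_mono mult_left_mono corr_nonneg) auto
  finally show ?thesis unfolding V_def .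
qed

text \<open>Telescopes over the sites of \<open>U\<close>, exposed in nondecreasing order of colour.
  This order is the reason why \<open>c k\<close> has to bound only those increments for which all
  sites of \<open>U\<close> of smaller colour are already known.\<close>

lemma integral_mult_increments_le:
  fixes col :: "'i \<Rightarrow> nat"
  assumes "finite U" and h: "h \<in> L2 M" "h \<in> borel_measurable (\<H> (insert j K))" and g: "g \<in> L2 M"
    and c: "\<And>k L. k \<in> U \<Longrightarrow> k \<notin> L \<Longrightarrow> K \<subseteq> L \<Longrightarrow> {u\<in>U. col u < col k} \<subseteq> L \<Longrightarrow>
      L2_norm M (\<lambda>\<omega>. \<Q> (insert k L) g \<omega> - \<Q> L g \<omega>) \<le> c k"
    and "K \<inter> U = {}"
  shows "\<bar>\<integral>\<omega>. h \<omega> * (\<Q> (K \<union> U) g \<omega> - \<Q> K g \<omega>) \<partial>M\<bar> \<le> L2_norm M h * (\<Sum>k\<in>U. corr j k * c k)"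
  using assms
proof (induction "card U" arbitrary: U K)
  case 0
  then have "U = {}" by simp
  then show ?case by simp
next
  case (Suc n)
  note fin = Suc.prems(1) and disj = Suc.prems(6)
  have "U \<noteq> {}" using Suc.hyps(2) by auto
  then have "Min (col ` U) \<in> col ` U" using fin by (intro Min_in) auto
  \<comment> \<open>With a site of minimal colour, no site of \<open>U\<close> has smaller colour,
    so the hypothesis on \<open>c\<close> applies already with \<open>L = K\<close>. The induction
    then continues from \<open>insert k K\<close>.\<close>
  then obtain k where k: "k \<in> U" "col k = Min (col ` U)" by auto
  have k': "col k \<le> col u" if "u \<in> U" for u
    unfolding k(2) using fin that by (intro Min_le) auto
  have kK: "k \<notin> K" using k disj by auto
  define U' where "U' = U - {k}"
  have "\<bar>\<integral>\<omega>. h \<omega> * (\<Q> (insert k K \<union> U') g \<omega> - \<Q> (insert k K) g \<omega>) \<partial>M\<bar>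
      \<le> L2_norm M h * (\<Sum>k\<in>U'. corr j k * c k)"
  proof (rule Suc.hyps(1)[OF _ _ Suc.prems(2) _ Suc.prems(4)])
    show "n = card U'" using Suc.hyps(2) k fin by (simp add: U'_def)
    show "finite U'" "insert k K \<inter> U' = {}" using fin disj by (auto simp: U'_def)
    show "h \<in> borel_measurable (\<H> (insert j (insert k K)))"
      using Suc.prems(3) by (rule \<H>_mono) auto
    \<comment> \<open>The hypothesis on \<open>c\<close> carries over to \<open>U'\<close>: the only
      site of \<open>U\<close> missing from \<open>U'\<close> is \<open>k\<close>, and
      \<open>k\<close> lies in \<open>L\<close>.\<close>
    fix k' L assume *: "k' \<in> U'" "k' \<notin> L" "insert k K \<subseteq> L" "{u\<in>U'. col u < col k'} \<subseteq> L"
    show "L2_norm M (\<lambda>\<omega>. \<Q> (insert k' L) g \<omega> - \<Q> L g \<omega>) \<le> c k'"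
      by (rule Suc.prems(5)) (use * in \<open>auto simp: U'_def\<close>)
  qed
  moreover have "insert k K \<union> U' = K \<union> U" using k by (auto simp: U'_def)
  moreover have "\<bar>\<integral>\<omega>. h \<omega> * (\<Q> (insert k K) g \<omega> - \<Q> K g \<omega>) \<partial>M\<bar> \<le> L2_norm M h * (corr j k * c k)"
  proof -
    have "L2_norm M (\<lambda>\<omega>. \<Q> (insert k K) g \<omega> - \<Q> K g \<omega>) \<le> c k"
      by (rule Suc.prems(5)) (use k(1) k' kK in \<open>auto simp: not_less[symmetric]\<close>)
    then have "corr j k * L2_norm M h * L2_norm M (\<lambda>\<omega>. \<Q> (insert k K) g \<omega> - \<Q> K g \<omega>)
        \<le> corr j k * L2_norm M h * c k"
      by (intro mult_left_mono mult_nonneg_nonneg corr_nonneg) auto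
    then show ?thesis
      using integral_mult_increment_le[OF Suc.prems(2,3,4), of k] by (simp add: ac_simps)
  qed
  moreover have "(\<integral>\<omega>. h \<omega> * (\<Q> (K \<union> U) g \<omega> - \<Q> K g \<omega>) \<partial>M) =
      (\<integral>\<omega>. h \<omega> * (\<Q> (K \<union> U) g \<omega> - \<Q> (insert k K) g \<omega>) \<partial>M) +
      (\<integral>\<omega>. h \<omega> * (\<Q> (insert k K) g \<omega> - \<Q> K g \<omega>) \<partial>M)"
  proof -
    have i: "integrable M (\<lambda>\<omega>. h \<omega> * \<Q> L g \<omega>)" for L
      using Suc.prems(2,4) by (intro L2_integrable_mult L2_\<Q>)
    show ?thesis by (simp add: right_diff_distrib i)
  qed
  moreover have "(\<Sum>k\<in>U. corr j k * c k) = corr j k * c k + (\<Sum>k\<in>U'. corr j k * c k)"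
    unfolding U'_def by (rule sum.remove[OF fin k(1)])
  ultimately show ?case by (simp add: distrib_left)
qed

end

section \<open>Decorrelation of a site from a functional of many sites\<close>

context random_field
begin

text \<open>A functional is given for all finite \<open>T\<close> simultaneously, with one
  \<open>d\<close>, because the recursion removes sites from \<open>T\<close> and must stay within
  the same class.\<close>

definition local_family :: "('i set \<Rightarrow> 'a \<Rightarrow> real) \<Rightarrow> real \<Rightarrow> bool" where
  "local_family g d \<longleftrightarrow> (\<forall>T. finite T \<longrightarrow> g T \<in> borel_measurable (\<H> T) \<and> (\<forall>\<omega>. \<bar>g T \<omega>\<bar> \<le> 1) \<and>
     (\<forall>j\<in>T. L2_norm M (\<lambda>\<omega>. g T \<omega> - g (T - {j}) \<omega>) \<le> d))"

lemma local_familyD: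
  assumes "local_family g d" "finite T"
  shows "g T \<in> borel_measurable (\<H> T)" "\<bar>g T \<omega>\<bar> \<le> 1" "g T \<in> L2 M"
    "j \<in> T \<Longrightarrow> L2_norm M (\<lambda>\<omega>. g T \<omega> - g (T - {j}) \<omega>) \<le> d"
proof -
  show g: "g T \<in> borel_measurable (\<H> T)" "\<bar>g T \<omega>\<bar> \<le> 1" for \<omega>
    using assms by (simp_all add: local_family_def)
  show "j \<in> T \<Longrightarrow> L2_norm M (\<lambda>\<omega>. g T \<omega> - g (T - {j}) \<omega>) \<le> d"
    using assms by (simp add: local_family_def)
  show "g T \<in> L2 M"
    using L2_bounded[OF \<H>_measurable[OF g(1)] g(2)] .
qed

text \<open>Dropping the site \<open>j\<close> of the test function \<open>h\<close> from \<open>g T\<close> costs the explicit influence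
  \<open>d\<close>; the remaining sites are revealed one at a time.\<close>

lemma integral_mult_local_family_le:
  fixes col :: "'i \<Rightarrow> nat"
  assumes g: "local_family g d" and T: "finite T"
    and h: "h \<in> L2 M" "h \<in> borel_measurable (\<H> (insert j K))" "AE \<omega> in M. \<Q> K h \<omega> = 0"
    and c: "\<And>k L. k \<in> T - insert j K \<Longrightarrow> k \<notin> L \<Longrightarrow> K \<subseteq> L \<Longrightarrow> {u\<in>T - insert j K. col u < col k} \<subseteq> L \<Longrightarrow>
      L2_norm M (\<lambda>\<omega>. \<Q> (insert k L) (g (T - {j})) \<omega> - \<Q> L (g (T - {j})) \<omega>) \<le> c k"
  shows "\<bar>\<integral>\<omega>. h \<omega> * g T \<omega> \<partial>M\<bar>
    \<le> L2_norm M h * ((if j \<in> T then d else 0) + (\<Sum>k\<in>T - insert j K. corr j k * c k))"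
proof -
  define g' where "g' = g (T - {j})"
  define U where "U = T - insert j K"
  note g1 = local_familyD[OF g T] and g2 = local_familyD[OF g finite_Diff[OF T, of "{j}"], folded g'_def]
  have i: "integrable M (\<lambda>\<omega>. h \<omega> * f \<omega>)" if "f \<in> L2 M" for f
    by (rule L2_integrable_mult[OF h(1) that])
  have "\<bar>\<integral>\<omega>. h \<omega> * (g T \<omega> - g' \<omega>) \<partial>M\<bar> \<le> L2_norm M h * (if j \<in> T then d else 0)"
  proof (cases "j \<in> T")
    case True
    have "\<bar>\<integral>\<omega>. h \<omega> * (g T \<omega> - g' \<omega>) \<partial>M\<bar> \<le> L2_norm M h * L2_norm M (\<lambda>\<omega>. g T \<omega> - g' \<omega>)"
      by (intro L2_Cauchy_Schwarz h L2_diff g1 g2)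
    also have "\<dots> \<le> L2_norm M h * d"
      using g1(4)[OF True] by (intro mult_left_mono) (simp_all add: g'_def)
    finally show ?thesis using True by simp
  next
    case False
    then show ?thesis by (simp add: g'_def)
  qed
  \<comment> \<open>\<open>K \<union> U\<close> contains \<open>T - {j}\<close>, so after all of
    \<open>U\<close> has been exposed \<open>g'\<close> is recovered exactly, while the initial term
    \<open>\<Q> K g'\<close> is orthogonal to \<open>h\<close>. The telescoped difference is
    therefore the whole pairing of \<open>h\<close> with \<open>g'\<close>.\<close>
  moreover have "\<bar>\<integral>\<omega>. h \<omega> * (\<Q> (K \<union> U) g' \<omega> - \<Q> K g' \<omega>) \<partial>M\<bar> \<le> L2_norm M h * (\<Sum>k\<in>U. corr j k * c k)"
    using T c unfolding g'_def U_def
    by (intro integral_mult_increments_le[where col=col] h g2(3)[unfolded g'_def]) blast+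
  moreover have "(\<integral>\<omega>. h \<omega> * \<Q> K g' \<omega> \<partial>M) = 0"
    using integral_mult_\<Q>_eq_0[OF h(1) L2_\<Q>[OF g2(3)] \<Q>_measurable h(3)] by (simp add: mult.commute)
  moreover have "(\<integral>\<omega>. h \<omega> * \<Q> (K \<union> U) g' \<omega> \<partial>M) = (\<integral>\<omega>. h \<omega> * g' \<omega> \<partial>M)"
  proof -
    interpret G: finite_measure_subalgebra M "\<H> (K \<union> U)" by (rule cond)
    have "AE \<omega> in M. \<Q> (K \<union> U) g' \<omega> = g' \<omega>"
      by (intro G.real_cond_exp_F_meas L2_integrable g2(3) \<H>_mono[OF g2(1)]) (auto simp: U_def)
    then show ?thesis
      using L2_measurable[OF h(1)] L2_measurable[OF g2(3)]
      by (intro integral_cong_AE) (auto elim: eventually_mono)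
  qed
  ultimately show ?thesis
    by (simp add: right_diff_distrib i g1 g2 L2_\<Q> U_def distrib_left)
qed

end

text \<open>The colouring is abstract here; on the lattice it will consist of residue classes. The
  site \<open>j\<close> itself is excluded from \<open>col_row_sum\<close> because
  \<open>corr j j\<close> may be as large as 1, whatever the colouring. Finite sums suffice, since
  only finitely many sites are ever exposed.\<close>

locale short_range_field = random_field M S X
  for M :: "'a measure" and S :: "'b measure" and X :: "'i \<Rightarrow> 'a \<Rightarrow> 'b" +
  fixes E :: real and col :: "'i \<Rightarrow> nat" and m :: nat
  assumes row_sum: "\<And>j U. finite U \<Longrightarrow> (\<Sum>k\<in>U. corr j k) \<le> E"
    and col_less: "\<And>j. col j < m"
    and col_row_sum: "\<And>j U. finite U \<Longrightarrow> (\<And>k. k \<in> U \<Longrightarrow> k \<noteq> j \<and> col k = col j) \<Longrightarrow>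
      (\<Sum>k\<in>U. corr j k) \<le> 1 / 2"
begin

lemma E_nonneg: "0 \<le> E"
  using row_sum[of "{}"] by simp

abbreviation infl_const :: real where
  "infl_const \<equiv> (2 + 2 * E) ^ m"

text \<open>The constants \<open>C\<^sub>a = (2 + 2 * E) ^ (m - a)\<close> solve \<open>1 + C\<^sub>a / 2 + E * C\<^sub>b \<le> C\<^sub>a\<close> for \<open>a < b\<close>. The side
  condition on \<open>K\<close>, that the sites of \<open>T\<close> of smaller colour have been revealed, is what makes the
  recursion triangular in the colours.\<close>

lemma influence_le:
  assumes g: "local_family g d" and "finite T" "j \<in> T" "j \<notin> K" "{u\<in>T. col u < col j} \<subseteq> K"
  shows "L2_norm M (\<lambda>\<omega>. \<Q> (insert j K) (g T) \<omega> - \<Q> K (g T) \<omega>) \<le> (2 + 2 * E) ^ (m - col j) * d"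
  using assms(2-)
proof (induction "card T" arbitrary: T j K rule: less_induct)
  case less
  note T = less.prems(1) and jT = less.prems(2) and jK = less.prems(3) and TK = less.prems(4)
  note gT = local_familyD[OF g T]
  define h where "h = (\<lambda>\<omega>. \<Q> (insert j K) (g T) \<omega> - \<Q> K (g T) \<omega>)"
  define C where "C = (\<lambda>a. (2 + 2 * E) ^ (m - a))"
  define U where "U = T - insert j K"
  have d: "0 \<le> d" using gT(4)[OF jT] L2_norm_nonneg order_trans by blast
  have C1: "1 \<le> C a" for a
    unfolding C_def using E_nonneg by (intro one_le_power) auto
  have C_mono: "C b \<le> C a" if "a \<le> b" for a b
    unfolding C_def using E_nonneg that by (intro power_increasing) auto
  have C_Suc: "C (col j) = (2 + 2 * E) * C (Suc (col j))"
    unfolding C_def using col_less[of j] by (simp flip: power_Suc add: Suc_diff_Suc)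
  have h: "h \<in> L2 M" "h \<in> borel_measurable (\<H> (insert j K))" "AE \<omega> in M. \<Q> K h \<omega> = 0"
    unfolding h_def
    using \<Q>_increment_centered[OF gT(3), of K "insert j K"]
    by (auto intro!: L2_diff L2_\<Q> gT(3) borel_measurable_diff \<H>_mono[OF \<Q>_measurable])
  have U: "finite U" "\<And>k. k \<in> U \<Longrightarrow> col j \<le> col k" "j \<notin> U"
    using T TK by (auto simp: U_def not_less[symmetric])
  \<comment> \<open>The influence is its own test function: \<open>h\<close> is the projection of
    \<open>g T\<close> onto the functions of \<open>insert j K\<close> that are orthogonal to those
    of \<open>K\<close>, so its squared norm is its pairing with \<open>g T\<close>.\<close>
  have "(\<integral>\<omega>. h \<omega> * h \<omega> \<partial>M) = (\<integral>\<omega>. h \<omega> * g T \<omega> \<partial>M)"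
  proof -
    have "(\<integral>\<omega>. h \<omega> * \<Q> (insert j K) (g T) \<omega> \<partial>M) = (\<integral>\<omega>. h \<omega> * g T \<omega> \<partial>M)"
      by (rule integral_mult_\<Q>[OF gT(3) h(1,2)])
    moreover have "(\<integral>\<omega>. h \<omega> * \<Q> K (g T) \<omega> \<partial>M) = 0"
      using integral_mult_\<Q>_eq_0[OF h(1) L2_\<Q>[OF gT(3)] \<Q>_measurable h(3)] by (simp add: mult.commute)
    moreover have "(\<integral>\<omega>. h \<omega> * h \<omega> \<partial>M) =
        (\<integral>\<omega>. h \<omega> * \<Q> (insert j K) (g T) \<omega> - h \<omega> * \<Q> K (g T) \<omega> \<partial>M)"
      unfolding h_def right_diff_distrib ..
    ultimately show ?thesis
      using h(1) gT(3) by (simp add: L2_integrable_mult L2_\<Q>)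
  qed
  also have "\<dots> \<le> \<bar>\<integral>\<omega>. h \<omega> * g T \<omega> \<partial>M\<bar>" by simp
  also have "\<dots> \<le> L2_norm M h * ((if j \<in> T then d else 0) + (\<Sum>k\<in>T - insert j K. corr j k * (C (col k) * d)))"
  proof (rule integral_mult_local_family_le[OF g T h, where col=col])
    \<comment> \<open>The side condition for \<open>T - {j}\<close> splits into sites outside
      \<open>K\<close>, covered by the order of exposure, and sites of \<open>K\<close>, covered by
      \<open>K \<subseteq> L\<close>. The induction hypothesis gives the same constants for the
      smaller set.\<close>
    fix k L assume *: "k \<in> T - insert j K" "k \<notin> L" "K \<subseteq> L" "{u\<in>T - insert j K. col u < col k} \<subseteq> L"
    show "L2_norm M (\<lambda>\<omega>. \<Q> (insert k L) (g (T - {j})) \<omega> - \<Q> L (g (T - {j})) \<omega>) \<le> C (col k) * d"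
      unfolding C_def
    proof (rule less.hyps)
      show "card (T - {j}) < card T" using T jT by (rule card_Diff1_less)
    qed (use * T in auto)
  qed
  also have "\<dots> = L2_norm M h * ((1 + (\<Sum>k\<in>U. corr j k * C (col k))) * d)"
    using jT by (simp add: U_def sum_distrib_right distrib_right mult.assoc)
  also have "\<dots> \<le> L2_norm M h * (C (col j) * d)"
  proof (intro mult_left_mono mult_right_mono d L2_norm_nonneg)
    \<comment> \<open>Smaller colours are absent from \<open>U\<close>, as they lie in
      \<open>K\<close>. Sites of the same colour have row sum at most 1/2; all others have colour at
      least \<open>Suc (col j)\<close>, hence a smaller constant.\<close>
    define A where "A = {k\<in>U. col k = col j}"
    have A: "A \<subseteq> U" "finite A" "finite (U - A)" using U by (auto simp: A_def)
    have "(\<Sum>k\<in>U. corr j k * C (col k)) = (\<Sum>k\<in>U - A. corr j k * C (col k)) + (\<Sum>k\<in>A. corr j k * C (col k))"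
      by (rule sum.subset_diff[OF A(1) U(1)])
    also have "\<dots> \<le> (\<Sum>k\<in>U - A. corr j k * C (Suc (col j))) + (\<Sum>k\<in>A. corr j k * C (col j))"
      using U(2) by (intro add_mono sum_mono mult_left_mono corr_nonneg C_mono) (force simp: A_def)+
    also have "\<dots> = (\<Sum>k\<in>U - A. corr j k) * C (Suc (col j)) + (\<Sum>k\<in>A. corr j k) * C (col j)"
      by (simp add: sum_distrib_right)
    also have "\<dots> \<le> E * C (Suc (col j)) + 1 / 2 * C (col j)"
      using U(3) C1 A by (intro add_mono mult_right_mono row_sum col_row_sum order_trans[OF zero_le_one C1])
        (auto simp: A_def)
    \<comment> \<open>By \<open>C_Suc\<close>, half of \<open>C (col j)\<close> equals
      \<open>(1 + E) * C (Suc (col j))\<close>. This pays for \<open>E * C (Suc (col j))\<close> and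
      leaves at least 1 for the explicit term.\<close>
    finally show "1 + (\<Sum>k\<in>U. corr j k * C (col k)) \<le> C (col j)"
      using C_Suc C1[of "Suc (col j)"] by (simp add: algebra_simps)
  qed
  finally have "(L2_norm M h)\<^sup>2 \<le> L2_norm M h * (C (col j) * d)"
    unfolding L2_norm_power2 by (simp add: power2_eq_square)
  then have "L2_norm M h \<le> C (col j) * d \<or> L2_norm M h = 0"
    using L2_norm_nonneg[of M h] by (auto simp: power2_eq_square mult_le_cancel_left less_le)
  moreover have "0 \<le> C (col j) * d" using d C1[of "col j"] by simp
  ultimately have "L2_norm M h \<le> C (col j) * d" by auto
  then show ?case unfolding h_def C_def .
qed

lemma infl_const_ge_1: "1 \<le> infl_const"
  using E_nonneg by (intro one_le_power) auto

text \<open>Here \<open>K\<close> is arbitrary: the sites exposed after \<open>K\<close> come in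
  order of colour, which supplies the side condition of \<open>influence_le\<close>. Taking
  \<open>K = {}\<close> treats functions of one site, and \<open>K = {i}\<close> the part of a
  two-site function that is centred given site \<open>i\<close>.\<close>

lemma decorrelation:
  assumes g: "local_family g d" and T: "finite T" and d: "0 \<le> d"
    and h: "h \<in> L2 M" "h \<in> borel_measurable (\<H> (insert j K))" "AE \<omega> in M. \<Q> K h \<omega> = 0"
  shows "\<bar>\<integral>\<omega>. h \<omega> * g T \<omega> \<partial>M\<bar> \<le>
    L2_norm M h * ((if j \<in> T then d else 0) + infl_const * d * (\<Sum>k\<in>T - insert j K. corr j k))"
proof -
  have "\<bar>\<integral>\<omega>. h \<omega> * g T \<omega> \<partial>M\<bar> \<le>
    L2_norm M h * ((if j \<in> T then d else 0) + (\<Sum>k\<in>T - insert j K. corr j k * (infl_const * d)))"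
  proof (rule integral_mult_local_family_le[OF g T h, where col=col])
    fix k L assume *: "k \<in> T - insert j K" "k \<notin> L" "K \<subseteq> L" "{u\<in>T - insert j K. col u < col k} \<subseteq> L"
    have "L2_norm M (\<lambda>\<omega>. \<Q> (insert k L) (g (T - {j})) \<omega> - \<Q> L (g (T - {j})) \<omega>) \<le> (2 + 2 * E) ^ (m - col k) * d"
      by (rule influence_le[OF g]) (use * T in auto)
    also have "\<dots> \<le> infl_const * d"
      using d E_nonneg by (intro mult_right_mono power_increasing) auto
    finally show "L2_norm M (\<lambda>\<omega>. \<Q> (insert k L) (g (T - {j})) \<omega> - \<Q> L (g (T - {j})) \<omega>) \<le> infl_const * d" .
  qed
  then show ?thesis
    unfolding sum_distrib_right[symmetric] by (simp only: mult.commute[of "infl_const * d"])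
qed

end

section \<open>The Stein equation for bounded observables\<close>

lemma cos_diff_le: "\<bar>cos x - cos y\<bar> \<le> \<bar>x - y\<bar>" for x y :: real
  using field_differentiable_bound[of UNIV cos "\<lambda>x. - sin x" 1 x y]
  by (auto intro!: derivative_eq_intros)

lemma sin_diff_le: "\<bar>sin x - sin y\<bar> \<le> \<bar>x - y\<bar>" for x y :: real
  using field_differentiable_bound[of UNIV sin cos 1 x y]
  by (auto intro!: derivative_eq_intros)

text \<open>The mean value inequality on the interval of radius \<open>\<bar>u\<bar>\<close> gives
  the constant 1 instead of the optimal 1/2, which suffices for the error terms.\<close>

lemma cos_Taylor_le: "\<bar>cos (x - u) - cos x - u * sin x\<bar> \<le> u\<^sup>2" for x u :: real
proof -
  have "\<bar>(cos (x - u) - u * sin x) - (cos (x - 0) - 0 * sin x)\<bar> \<le> \<bar>u\<bar> * \<bar>u - 0\<bar>"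
  proof (rule field_differentiable_bound[of "{-\<bar>u\<bar>..\<bar>u\<bar>}", unfolded real_norm_def])
    fix z assume z: "z \<in> {-\<bar>u\<bar>..\<bar>u\<bar>}"
    show "((\<lambda>u. cos (x - u) - u * sin x) has_field_derivative sin (x - z) - sin x) (at z within {-\<bar>u\<bar>..\<bar>u\<bar>})"
      by (auto intro!: derivative_eq_intros)
    show "\<bar>sin (x - z) - sin x\<bar> \<le> \<bar>u\<bar>"
      using sin_diff_le[of "x - z" x] z by auto
  qed auto
  then show ?thesis by (simp add: power2_eq_square)
qed

text \<open>Multiplication by the integrating factor \<open>exp (v * s\<^sup>2 / 2)\<close> turns
  the defect of the equation into a derivative. On the interval the factor is largest at
  \<open>t\<close>, where dividing by it cancels it exactly; hence the error bound does not contain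
  \<open>v\<close>.\<close>

lemma gaussian_ODE_stability:
  fixes \<psi> \<psi>' :: "real \<Rightarrow> real"
  assumes deriv: "\<And>s. (\<psi> has_field_derivative \<psi>' s) (at s)"
    and v: "0 \<le> v" and e: "\<And>s. \<bar>s\<bar> \<le> \<bar>t\<bar> \<Longrightarrow> \<bar>\<psi>' s + s * v * \<psi> s\<bar> \<le> e"
  shows "\<bar>\<psi> t - \<psi> 0 * exp (- (v * t\<^sup>2 / 2))\<bar> \<le> \<bar>t\<bar> * e"
proof -
  let ?F = "\<lambda>s. \<psi> s * exp (v * s\<^sup>2 / 2)"
  let ?E = "exp (v * t\<^sup>2 / 2)"
  have "\<bar>?F t - ?F 0\<bar> \<le> (e * ?E) * \<bar>t - 0\<bar>"
  proof (rule field_differentiable_bound[of "{-\<bar>t\<bar>..\<bar>t\<bar>}", unfolded real_norm_def])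
    fix s assume "s \<in> {-\<bar>t\<bar>..\<bar>t\<bar>}"
    then have s: "\<bar>s\<bar> \<le> \<bar>t\<bar>" by auto
    show "(?F has_field_derivative (\<psi>' s + s * v * \<psi> s) * exp (v * s\<^sup>2 / 2)) (at s within {-\<bar>t\<bar>..\<bar>t\<bar>})"
      by (rule DERIV_subset[of _ _ _ UNIV], rule derivative_eq_intros deriv refl | simp add: algebra_simps)+
    have "exp (v * s\<^sup>2 / 2) \<le> ?E"
      using mult_left_mono[OF power_mono[OF s, of 2] v] by simp
    then show "\<bar>(\<psi>' s + s * v * \<psi> s) * exp (v * s\<^sup>2 / 2)\<bar> \<le> e * ?E"
      unfolding abs_mult using e[OF s] by (intro mult_mono) auto
  qed auto
  then have "\<bar>?F t - ?F 0\<bar> * exp (- (v * t\<^sup>2 / 2)) \<le> (e * ?E * \<bar>t\<bar>) * exp (- (v * t\<^sup>2 / 2))"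
    by (intro mult_right_mono) auto
  also have "(e * ?E * \<bar>t\<bar>) * exp (- (v * t\<^sup>2 / 2)) = \<bar>t\<bar> * e"
    by (simp add: exp_minus field_simps)
  also have "\<bar>?F t - ?F 0\<bar> * exp (- (v * t\<^sup>2 / 2)) = \<bar>(?F t - ?F 0) * exp (- (v * t\<^sup>2 / 2))\<bar>"
    by (simp add: abs_mult)
  also have "(?F t - ?F 0) * exp (- (v * t\<^sup>2 / 2)) = \<psi> t - \<psi> 0 * exp (- (v * t\<^sup>2 / 2))"
    by (simp add: exp_minus field_simps)
  finally show ?thesis .
qed

text \<open>A second moment is enough: by \<open>cos_Taylor_le\<close> the difference quotient errs
  by at most \<open>\<bar>u\<bar>\<close> times the second moment of \<open>S\<close>, so no
  dominated convergence is invoked.\<close>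

lemma (in prob_space) has_derivative_expectation_cos:
  assumes S: "S \<in> L2 M"
  shows "((\<lambda>t. \<integral>\<omega>. cos (\<theta> + t * S \<omega>) \<partial>M) has_field_derivative
    - (\<integral>\<omega>. S \<omega> * sin (\<theta> + t * S \<omega>) \<partial>M)) (at t)"
proof -
  have [measurable]: "S \<in> borel_measurable M" using S by (rule L2_measurable)
  have ic: "integrable M (\<lambda>\<omega>. cos (\<theta> + t * S \<omega>))" for t
    by (rule integrable_const_bound[where B=1]) auto
  have isn: "integrable M (\<lambda>\<omega>. S \<omega> * sin (\<theta> + t * S \<omega>))" for t
    by (rule L2_integrable_mult[OF S], rule L2_bounded[where c=1]) auto
  have i2: "integrable M (\<lambda>\<omega>. (S \<omega>)\<^sup>2)" using S by (simp add: L2_def)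
  let ?\<psi> = "\<lambda>t. \<integral>\<omega>. cos (\<theta> + t * S \<omega>) \<partial>M" and ?D = "\<integral>\<omega>. S \<omega> * sin (\<theta> + t * S \<omega>) \<partial>M"
  have bound: "\<bar>(?\<psi> (t + u) - ?\<psi> t) / u + ?D\<bar> \<le> \<bar>u\<bar> * (\<integral>\<omega>. (S \<omega>)\<^sup>2 \<partial>M)" if "u \<noteq> 0" for u
  proof -
    have "\<bar>?\<psi> (t + u) - ?\<psi> t + u * ?D\<bar> =
        \<bar>\<integral>\<omega>. cos (\<theta> + (t + u) * S \<omega>) - cos (\<theta> + t * S \<omega>) + u * (S \<omega> * sin (\<theta> + t * S \<omega>)) \<partial>M\<bar>"
      using ic isn by simp
    also have "\<dots> \<le> (\<integral>\<omega>. \<bar>cos (\<theta> + (t + u) * S \<omega>) - cos (\<theta> + t * S \<omega>) + u * (S \<omega> * sin (\<theta> + t * S \<omega>))\<bar> \<partial>M)"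
      by (rule integral_abs_bound)
    also have "\<dots> \<le> (\<integral>\<omega>. u\<^sup>2 * (S \<omega>)\<^sup>2 \<partial>M)"
    proof (rule integral_mono)
      show "\<bar>cos (\<theta> + (t + u) * S \<omega>) - cos (\<theta> + t * S \<omega>) + u * (S \<omega> * sin (\<theta> + t * S \<omega>))\<bar> \<le> u\<^sup>2 * (S \<omega>)\<^sup>2" for \<omega>
        using cos_Taylor_le[of "\<theta> + t * S \<omega>" "- u * S \<omega>"] by (simp add: power_mult_distrib algebra_simps)
    qed (use ic isn i2 in auto)
    also have "\<dots> = u\<^sup>2 * (\<integral>\<omega>. (S \<omega>)\<^sup>2 \<partial>M)" by simp
    finally have *: "\<bar>?\<psi> (t + u) - ?\<psi> t + u * ?D\<bar> \<le> u\<^sup>2 * (\<integral>\<omega>. (S \<omega>)\<^sup>2 \<partial>M)" .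
    have "\<bar>(?\<psi> (t + u) - ?\<psi> t) / u + ?D\<bar> = \<bar>?\<psi> (t + u) - ?\<psi> t + u * ?D\<bar> / \<bar>u\<bar>"
      using that by (simp add: field_simps flip: abs_divide)
    also have "\<dots> \<le> u\<^sup>2 * (\<integral>\<omega>. (S \<omega>)\<^sup>2 \<partial>M) / \<bar>u\<bar>"
      using * by (rule divide_right_mono) simp
    also have "\<dots> = \<bar>u\<bar> * (\<integral>\<omega>. (S \<omega>)\<^sup>2 \<partial>M)"
      using that by (simp add: power2_eq_square abs_if)
    finally show ?thesis .
  qed
  have "((\<lambda>u. (?\<psi> (t + u) - ?\<psi> t) / u + ?D) \<longlongrightarrow> 0) (at 0)"
  proof (rule Lim_null_comparison)
    show "\<forall>\<^sub>F u in at 0. norm ((?\<psi> (t + u) - ?\<psi> t) / u + ?D) \<le> \<bar>u\<bar> * (\<integral>\<omega>. (S \<omega>)\<^sup>2 \<partial>M)"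
      using bound by (auto simp: eventually_at_filter)
    show "((\<lambda>u. \<bar>u\<bar> * (\<integral>\<omega>. (S \<omega>)\<^sup>2 \<partial>M)) \<longlongrightarrow> 0) (at 0)"
      by (auto intro!: tendsto_eq_intros)
  qed
  then have "((\<lambda>u. ((?\<psi> (t + u) - ?\<psi> t) / u + ?D) - ?D) \<longlongrightarrow> 0 - ?D) (at 0)"
    by (intro tendsto_intros)
  then show ?thesis by (simp add: DERIV_def)
qed

context random_field
begin

text \<open>Restriction to no sites is a constant map, so \<open>\<H> {}\<close> is the trivial
  algebra and centring given it is ordinary centring.\<close>

lemma \<Q>_empty:
  assumes "f \<in> L2 M" "(\<integral>\<omega>. f \<omega> \<partial>M) = 0"
  shows "AE \<omega> in M. \<Q> {} f \<omega> = 0"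
proof -
  interpret G: finite_measure_subalgebra M "\<H> {}" by (rule cond)
  have "A = {} \<or> A = space M" if "A \<in> sets (\<H> {})" for A
  proof -
    have "A \<in> {(\<lambda>\<omega>. \<lambda>k\<in>{}. X k \<omega>) -` B \<inter> space M | B. B \<in> sets (\<Pi>\<^sub>M k\<in>{}. S)}"
      using that unfolding family_algebra_def
      by (subst (asm) sets_vimage_algebra2) (auto simp: space_PiM)
    then show ?thesis by (auto simp: restrict_def split: if_splits)
  qed
  then have "(\<integral>\<omega>\<in>A. f \<omega> \<partial>M) = (\<integral>\<omega>\<in>A. 0 \<partial>M)" if "A \<in> sets (\<H> {})" for A
    using that[THEN \<open>\<And>A. A \<in> sets (\<H> {}) \<Longrightarrow> A = {} \<or> A = space M\<close>] assms(2)
      set_integral_space[OF L2_integrable[OF assms(1)]] by (auto simp: set_lebesgue_integral_def)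
  then show ?thesis
    by (rule G.real_cond_exp_charact) (use L2_integrable[OF assms(1)] in auto)
qed

lemma covariance_le:
  assumes "f \<in> L2 M" "f \<in> borel_measurable (\<H> {i})" "(\<integral>\<omega>. f \<omega> \<partial>M) = 0"
    and "g \<in> L2 M" "g \<in> borel_measurable (\<H> {j})" "(\<integral>\<omega>. g \<omega> \<partial>M) = 0"
  shows "\<bar>\<integral>\<omega>. f \<omega> * g \<omega> \<partial>M\<bar> \<le> corr i j * L2_norm M f * L2_norm M g"
  using assms by (intro corr_bound[where K="{}"] \<Q>_empty) auto

text \<open>Dropping a site moves the argument by at most \<open>\<bar>a\<bar> * b\<close>, and
  cosine is 1-Lipschitz. With \<open>a\<close> of order one over the root of the number of sites,
  this is the small explicit influence. The phase covers the sine as well.\<close>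

lemma local_family_cos:
  assumes y: "\<And>i. y i \<in> borel_measurable (\<H> {i})" "\<And>i \<omega>. \<bar>y i \<omega>\<bar> \<le> b"
  shows "local_family (\<lambda>T \<omega>. cos (\<theta> + a * (\<Sum>i\<in>T. y i \<omega>))) (\<bar>a\<bar> * b)"
  unfolding local_family_def
proof (intro allI impI conjI ballI)
  fix T :: "'i set" assume T: "finite T"
  have yT: "y i \<in> borel_measurable (\<H> T)" if "i \<in> T" for i
    using y(1) by (rule \<H>_mono) (use that in auto)
  then show "(\<lambda>\<omega>. cos (\<theta> + a * (\<Sum>i\<in>T. y i \<omega>))) \<in> borel_measurable (\<H> T)"
    by (intro measurable_compose[OF _ borel_measurable_cos] borel_measurable_add borel_measurable_times
        borel_measurable_const borel_measurable_sum) auto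
  show "\<bar>cos (\<theta> + a * (\<Sum>i\<in>T. y i \<omega>))\<bar> \<le> 1" for \<omega> by simp
  fix j assume j: "j \<in> T"
  have [measurable]: "y i \<in> borel_measurable M" for i by (rule \<H>_measurable[OF y(1)])
  show "L2_norm M (\<lambda>\<omega>. cos (\<theta> + a * (\<Sum>i\<in>T. y i \<omega>)) - cos (\<theta> + a * (\<Sum>i\<in>T - {j}. y i \<omega>))) \<le> \<bar>a\<bar> * b"
  proof (rule L2_norm_bounded)
    fix \<omega>
    have "\<bar>cos (\<theta> + a * (\<Sum>i\<in>T. y i \<omega>)) - cos (\<theta> + a * (\<Sum>i\<in>T - {j}. y i \<omega>))\<bar>
        \<le> \<bar>(\<theta> + a * (\<Sum>i\<in>T. y i \<omega>)) - (\<theta> + a * (\<Sum>i\<in>T - {j}. y i \<omega>))\<bar>"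
      by (rule cos_diff_le)
    also have "\<dots> = \<bar>a\<bar> * \<bar>y j \<omega>\<bar>"
      using sum.remove[OF T j, of "\<lambda>i. y i \<omega>"] by (simp add: distrib_left abs_mult)
    also have "\<dots> \<le> \<bar>a\<bar> * b" by (intro mult_left_mono y) simp
    finally show "\<bar>cos (\<theta> + a * (\<Sum>i\<in>T. y i \<omega>)) - cos (\<theta> + a * (\<Sum>i\<in>T - {j}. y i \<omega>))\<bar> \<le> \<bar>a\<bar> * b" .
  qed measurable
qed

end

context short_range_field
begin

text \<open>\<open>decorrelation\<close> tolerates only one site beyond the conditioning set, so the
  centred product is split in two: \<open>h1\<close>, a centred function of site \<open>i\<close>,
  and \<open>h2\<close>, a function of both sites that is centred given \<open>i\<close>. Each has
  norm at most \<open>2 * b\<^sup>2\<close>, whence the factor 4.\<close>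

lemma pair_decorrelation:
  fixes y :: "'i \<Rightarrow> 'a \<Rightarrow> real"
  assumes y: "\<And>i. y i \<in> borel_measurable (\<H> {i})" "\<And>i \<omega>. \<bar>y i \<omega>\<bar> \<le> b"
    and g: "local_family g d" and T: "finite T" and d: "0 \<le> d"
  shows "\<bar>(\<integral>\<omega>. y i \<omega> * y j \<omega> * g T \<omega> \<partial>M) - (\<integral>\<omega>. y i \<omega> * y j \<omega> \<partial>M) * (\<integral>\<omega>. g T \<omega> \<partial>M)\<bar>
    \<le> 4 * b\<^sup>2 * (1 + infl_const * E) * d"
proof -
  have y_M [measurable]: "y i \<in> borel_measurable M" for i by (rule \<H>_measurable[OF y(1)])
  define c where "c = (\<integral>\<omega>. y i \<omega> * y j \<omega> \<partial>M)"
  define h where "h = (\<lambda>\<omega>. y i \<omega> * y j \<omega> - c)"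
  define h1 where "h1 = \<Q> {i} h"
  define h2 where "h2 = (\<lambda>\<omega>. h \<omega> - \<Q> {i} h \<omega>)"
  have yy: "\<bar>y i \<omega> * y j \<omega>\<bar> \<le> b\<^sup>2" for \<omega>
    unfolding abs_mult power2_eq_square using y(2)[of i \<omega>] y(2)[of j \<omega>] by (intro mult_mono) auto
  have yy_L2: "(\<lambda>\<omega>. y i \<omega> * y j \<omega>) \<in> L2 M"
    by (rule L2_bounded[OF _ yy]) measurable
  have "\<bar>c\<bar> \<le> b\<^sup>2"
    unfolding c_def
    using abs_integral_le_L2_norm[OF yy_L2] L2_norm_bounded[OF L2_measurable[OF yy_L2] yy] by linarith
  then have h_le: "\<bar>h \<omega>\<bar> \<le> 2 * b\<^sup>2" for \<omega> using yy[of \<omega>] unfolding h_def by linarith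
  have h_H: "h \<in> borel_measurable (\<H> (insert j {i}))"
    unfolding h_def
    by (intro borel_measurable_diff borel_measurable_times borel_measurable_const \<H>_mono[OF y(1)]) auto
  have h_M: "h \<in> borel_measurable M" by (rule \<H>_measurable[OF h_H])
  have h: "h \<in> L2 M" by (rule L2_bounded[OF h_M h_le])
  have norms: "L2_norm M h1 \<le> 2 * b\<^sup>2" "L2_norm M h2 \<le> 2 * b\<^sup>2"
    using L2_norm_\<Q>[OF h, of "{i}"] L2_norm_bounded[OF h_M h_le] by (simp_all add: h1_def h2_def)
  have h1: "h1 \<in> L2 M" "h1 \<in> borel_measurable (\<H> (insert i {}))"
    unfolding h1_def by (auto intro: L2_\<Q> h)
  have h2: "h2 \<in> L2 M" "h2 \<in> borel_measurable (\<H> (insert j {i}))" "AE \<omega> in M. \<Q> {i} h2 \<omega> = 0"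
    unfolding h2_def using h_H \<Q>_centered[OF h]
    by (auto intro!: L2_diff L2_\<Q> h borel_measurable_diff \<H>_mono[OF \<Q>_measurable])
  have "(\<integral>\<omega>. h1 \<omega> \<partial>M) = (\<integral>\<omega>. h \<omega> \<partial>M)"
    unfolding h1_def by (rule sigma_finite_subalgebra.real_cond_exp_int(2)[OF sigma_cond L2_integrable[OF h]])
  also have "\<dots> = 0"
    using L2_integrable[OF yy_L2] by (simp add: h_def c_def prob_space)
  finally have h1_0: "AE \<omega> in M. \<Q> {} h1 \<omega> = 0" by (rule \<Q>_empty[OF h1(1)])
  have bound: "\<bar>\<integral>\<omega>. f \<omega> * g T \<omega> \<partial>M\<bar> \<le> 2 * b\<^sup>2 * ((1 + infl_const * E) * d)"
    if f: "f \<in> L2 M" "f \<in> borel_measurable (\<H> (insert k K))" "AE \<omega> in M. \<Q> K f \<omega> = 0"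
      and n: "L2_norm M f \<le> 2 * b\<^sup>2" for f k K
  proof -
    have "\<bar>\<integral>\<omega>. f \<omega> * g T \<omega> \<partial>M\<bar> \<le>
      L2_norm M f * ((if k \<in> T then d else 0) + infl_const * d * (\<Sum>u\<in>T - insert k K. corr k u))"
      by (rule decorrelation[OF g T d f])
    also have "\<dots> \<le> 2 * b\<^sup>2 * (d + infl_const * d * E)"
      using d infl_const_ge_1 T
      by (intro mult_mono n add_mono mult_left_mono row_sum add_nonneg_nonneg mult_nonneg_nonneg sum_nonneg corr_nonneg)
        auto
    finally show ?thesis by (simp add: algebra_simps)
  qed
  have gT: "g T \<in> L2 M" by (rule local_familyD(3)[OF g T])
  have "(\<integral>\<omega>. y i \<omega> * y j \<omega> * g T \<omega> \<partial>M) - c * (\<integral>\<omega>. g T \<omega> \<partial>M) = (\<integral>\<omega>. h \<omega> * g T \<omega> \<partial>M)"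
    using L2_integrable_mult[OF yy_L2 gT] L2_integrable[OF gT] by (simp add: h_def left_diff_distrib)
  also have "\<dots> = (\<integral>\<omega>. h1 \<omega> * g T \<omega> \<partial>M) + (\<integral>\<omega>. h2 \<omega> * g T \<omega> \<partial>M)"
    using L2_integrable_mult[OF h1(1) gT] L2_integrable_mult[OF h gT]
    by (simp add: h2_def h1_def left_diff_distrib)
  finally show ?thesis
    using bound[OF h1 h1_0 norms(1)] bound[OF h2 norms(2)] unfolding c_def[symmetric] by (simp add: algebra_simps)
qed

text \<open>The sum \<open>P\<close> is compared with \<open>P'\<close>, which omits the
  neighbourhood \<open>A\<close> of \<open>i\<close>: the cosine at \<open>P'\<close> equals the
  cosine at \<open>P\<close> plus \<open>a * R\<close> times the sine, up to a quadratic remainder.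
  \<open>y i\<close> nearly decouples from \<open>P'\<close>, and \<open>y i * y j\<close> for near
  \<open>j\<close> nearly decouples from the sine. The \<open>\<eta>\<close> terms come from
  \<open>far\<close> and \<open>tail\<close>; the \<open>a\<^sup>2\<close> terms come from
  \<open>near\<close> and the Taylor remainder.\<close>

lemma Stein_identity_site:
  fixes y :: "'i \<Rightarrow> 'a \<Rightarrow> real"
  assumes y: "\<And>i. y i \<in> borel_measurable (\<H> {i})" "\<And>i \<omega>. \<bar>y i \<omega>\<bar> \<le> b" "\<And>i. (\<integral>\<omega>. y i \<omega> \<partial>M) = 0"
    and A: "i \<in> A" "finite A" "card A \<le> r"
    and A_tail: "\<And>U. finite U \<Longrightarrow> U \<inter> A = {} \<Longrightarrow> (\<Sum>k\<in>U. corr i k) \<le> \<eta>"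
    and B: "finite B"
  shows "\<bar>(\<integral>\<omega>. y i \<omega> * cos (\<theta> + a * (\<Sum>j\<in>B. y j \<omega>)) \<partial>M) +
      a * (\<Sum>j\<in>B. \<integral>\<omega>. y i \<omega> * y j \<omega> \<partial>M) * (\<integral>\<omega>. sin (\<theta> + a * (\<Sum>j\<in>B. y j \<omega>)) \<partial>M)\<bar>
    \<le> \<bar>a\<bar> * (b\<^sup>2 * (1 + infl_const) * \<eta>) + a\<^sup>2 * (b ^ 3 * (4 * real r * (1 + infl_const * E) + (real r)\<^sup>2))"
proof -
  have y_M [measurable]: "y i \<in> borel_measurable M" for i by (rule \<H>_measurable[OF y(1)])
  have b: "0 \<le> b" using y(2)[of undefined undefined] by linarith
  have y_L2: "y i \<in> L2 M" for i by (rule L2_bounded[OF y_M y(2)])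
  have y_norm: "L2_norm M (y i) \<le> b" for i by (rule L2_norm_bounded[OF y_M y(2)])
  have y_cent: "AE \<omega> in M. \<Q> {} (y i) \<omega> = 0" for i by (rule \<Q>_empty[OF y_L2 y(3)])
  define c where "c = (\<lambda>j. \<integral>\<omega>. y i \<omega> * y j \<omega> \<partial>M)"
  define P where "P = (\<lambda>\<omega>. \<Sum>j\<in>B. y j \<omega>)"
  define R where "R = (\<lambda>\<omega>. \<Sum>j\<in>B \<inter> A. y j \<omega>)"
  define P' where "P' = (\<lambda>\<omega>. \<Sum>j\<in>B - A. y j \<omega>)"
  have P: "P \<omega> = R \<omega> + P' \<omega>" for \<omega>
    unfolding P_def R_def P'_def using B by (rule sum.Int_Diff)
  have [measurable]: "P \<in> borel_measurable M" "R \<in> borel_measurable M" "P' \<in> borel_measurable M"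
    unfolding P_def R_def P'_def by measurable
  have card_BA: "real (card (B \<inter> A)) \<le> r"
    using card_mono[OF A(2), of "B \<inter> A"] A(3) by simp
  have R_le: "\<bar>R \<omega>\<bar> \<le> r * b" for \<omega>
  proof -
    have "\<bar>R \<omega>\<bar> \<le> (\<Sum>j\<in>B \<inter> A. \<bar>y j \<omega>\<bar>)" unfolding R_def by (rule sum_abs)
    also have "\<dots> \<le> (\<Sum>j\<in>B \<inter> A. b)" by (intro sum_mono y)
    also have "\<dots> \<le> r * b" using card_BA b by (simp add: mult_right_mono)
    finally show ?thesis .
  qed
  define \<rho> where "\<rho> = (\<lambda>\<omega>. cos (\<theta> + a * P' \<omega>) - cos (\<theta> + a * P \<omega>) - a * R \<omega> * sin (\<theta> + a * P \<omega>))"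
  have \<rho>_le: "\<bar>y i \<omega> * \<rho> \<omega>\<bar> \<le> b * (a\<^sup>2 * (r * b)\<^sup>2)" for \<omega>
  proof -
    have "\<bar>\<rho> \<omega>\<bar> \<le> (a * R \<omega>)\<^sup>2"
      using cos_Taylor_le[of "\<theta> + a * P \<omega>" "a * R \<omega>"] by (simp add: \<rho>_def P algebra_simps)
    also have "\<dots> \<le> a\<^sup>2 * (r * b)\<^sup>2"
      unfolding power_mult_distrib[of a] using power_mono[OF R_le[of \<omega>], of 2] by (intro mult_left_mono) auto
    finally show ?thesis unfolding abs_mult using y(2)[of i \<omega>] b by (intro mult_mono) auto
  qed
  have [measurable]: "\<rho> \<in> borel_measurable M" unfolding \<rho>_def by measurable
  have bnd: "integrable M (\<lambda>\<omega>. y i \<omega> * f \<omega>)" if "f \<in> borel_measurable M" "\<And>\<omega>. \<bar>f \<omega>\<bar> \<le> e" for f e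
    by (rule L2_integrable_mult[OF y_L2 L2_bounded[OF that]])
  have I: "integrable M (\<lambda>\<omega>. y i \<omega> * cos (\<theta> + a * P \<omega>))" "integrable M (\<lambda>\<omega>. y i \<omega> * cos (\<theta> + a * P' \<omega>))"
    by (rule bnd[OF _ abs_cos_le_one]; measurable)+
  have I2: "integrable M (\<lambda>\<omega>. y i \<omega> * y j \<omega> * sin (\<theta> + a * P \<omega>))" for j
    unfolding mult.assoc
  proof (rule bnd)
    show "\<bar>y j \<omega> * sin (\<theta> + a * P \<omega>)\<bar> \<le> b * 1" for \<omega>
      unfolding abs_mult using y(2)[of j \<omega>] b by (intro mult_mono) auto
  qed measurable
  have I\<rho>: "integrable M (\<lambda>\<omega>. y i \<omega> * \<rho> \<omega>)"
    by (rule integrable_const_bound[where B="b * (a\<^sup>2 * (r * b)\<^sup>2)"]) (use \<rho>_le in auto)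
  let ?s = "\<integral>\<omega>. sin (\<theta> + a * P \<omega>) \<partial>M"
  have sin_M: "(\<lambda>\<omega>. sin (\<theta> + a * P \<omega>)) \<in> borel_measurable M" by measurable
  have s1: "\<bar>?s\<bar> \<le> 1"
    using abs_integral_le_L2_norm[OF L2_bounded[OF sin_M abs_sin_le_one]]
      L2_norm_bounded[OF sin_M abs_sin_le_one] by linarith
  have "(\<integral>\<omega>. y i \<omega> * cos (\<theta> + a * P \<omega>) \<partial>M) = (\<integral>\<omega>. y i \<omega> * cos (\<theta> + a * P' \<omega>) -
      a * (\<Sum>j\<in>B \<inter> A. y i \<omega> * y j \<omega> * sin (\<theta> + a * P \<omega>)) - y i \<omega> * \<rho> \<omega> \<partial>M)"
    by (intro Bochner_Integration.integral_cong refl)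
      (simp add: \<rho>_def right_diff_distrib R_def sum_distrib_left sum_distrib_right mult_ac)
  also have "\<dots> = (\<integral>\<omega>. y i \<omega> * cos (\<theta> + a * P' \<omega>) \<partial>M) -
      a * (\<Sum>j\<in>B \<inter> A. \<integral>\<omega>. y i \<omega> * y j \<omega> * sin (\<theta> + a * P \<omega>) \<partial>M) - (\<integral>\<omega>. y i \<omega> * \<rho> \<omega> \<partial>M)"
    using I I2 I\<rho> by simp
  finally have eq: "(\<integral>\<omega>. y i \<omega> * cos (\<theta> + a * P \<omega>) \<partial>M) = \<dots>" .
  \<comment> \<open>Since \<open>i\<close> lies in \<open>A\<close>, it does not occur in
    \<open>B - A\<close>: the explicit influence vanishes, and only the tail of row \<open>i\<close>
    outside \<open>A\<close> remains.\<close>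
  have far: "\<bar>\<integral>\<omega>. y i \<omega> * cos (\<theta> + a * P' \<omega>) \<partial>M\<bar> \<le> \<bar>a\<bar> * (b\<^sup>2 * infl_const * \<eta>)"
  proof -
    have "\<bar>\<integral>\<omega>. y i \<omega> * cos (\<theta> + a * P' \<omega>) \<partial>M\<bar> \<le> L2_norm M (y i) *
        ((if i \<in> B - A then \<bar>a\<bar> * b else 0) + infl_const * (\<bar>a\<bar> * b) * (\<Sum>k\<in>B - A - insert i {}. corr i k))"
      unfolding P'_def
      by (rule decorrelation[OF local_family_cos[OF y(1,2)]]) (use B b y y_L2 y_cent in auto)
    also have "\<dots> \<le> b * (0 + infl_const * (\<bar>a\<bar> * b) * \<eta>)"
      using A B b infl_const_ge_1
      by (intro mult_mono y_norm add_mono mult_left_mono A_tail add_nonneg_nonneg mult_nonneg_nonneg sum_nonneg corr_nonneg)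
        auto
    finally show ?thesis by (simp add: power2_eq_square mult_ac)
  qed
  have near: "\<bar>(\<Sum>j\<in>B \<inter> A. \<integral>\<omega>. y i \<omega> * y j \<omega> * sin (\<theta> + a * P \<omega>) \<partial>M) - (\<Sum>j\<in>B \<inter> A. c j) * ?s\<bar>
      \<le> r * (4 * b\<^sup>2 * (1 + infl_const * E) * (\<bar>a\<bar> * b))"
  proof -
    \<comment> \<open>A shift of the phase makes the sine an instance of
      \<open>local_family_cos\<close>.\<close>
    have sin_cos: "sin x = cos (x - pi / 2)" for x :: real by (simp add: cos_diff)
    have p: "\<bar>(\<integral>\<omega>. y i \<omega> * y j \<omega> * sin (\<theta> + a * P \<omega>) \<partial>M) - c j * ?s\<bar> \<le> 4 * b\<^sup>2 * (1 + infl_const * E) * (\<bar>a\<bar> * b)" for j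
      using pair_decorrelation[OF y(1,2) local_family_cos[OF y(1,2), of "\<theta> - pi / 2" a] B, of i j] b
      unfolding sin_cos c_def P_def by (simp add: add_diff_eq algebra_simps)
    have "\<bar>(\<Sum>j\<in>B \<inter> A. \<integral>\<omega>. y i \<omega> * y j \<omega> * sin (\<theta> + a * P \<omega>) \<partial>M) - (\<Sum>j\<in>B \<inter> A. c j) * ?s\<bar> \<le>
       (\<Sum>j\<in>B \<inter> A. \<bar>(\<integral>\<omega>. y i \<omega> * y j \<omega> * sin (\<theta> + a * P \<omega>) \<partial>M) - c j * ?s\<bar>)"
      unfolding sum_distrib_right sum_subtractf[symmetric] by (rule sum_abs)
    also have "\<dots> \<le> (\<Sum>j\<in>B \<inter> A. 4 * b\<^sup>2 * (1 + infl_const * E) * (\<bar>a\<bar> * b))" by (rule sum_mono) (rule p)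
    also have "\<dots> = card (B \<inter> A) * (4 * b\<^sup>2 * (1 + infl_const * E) * (\<bar>a\<bar> * b))" by simp
    also have "\<dots> \<le> r * (4 * b\<^sup>2 * (1 + infl_const * E) * (\<bar>a\<bar> * b))"
      using b infl_const_ge_1 E_nonneg card_BA by (intro mult_right_mono mult_nonneg_nonneg add_nonneg_nonneg) auto
    finally show ?thesis .
  qed
  have rem: "\<bar>\<integral>\<omega>. y i \<omega> * \<rho> \<omega> \<partial>M\<bar> \<le> b * (a\<^sup>2 * (r * b)\<^sup>2)"
  proof -
    have "\<bar>\<integral>\<omega>. y i \<omega> * \<rho> \<omega> \<partial>M\<bar> \<le> (\<integral>\<omega>. \<bar>y i \<omega> * \<rho> \<omega>\<bar> \<partial>M)" by (rule integral_abs_bound)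
    also have "\<dots> \<le> (\<integral>\<omega>. b * (a\<^sup>2 * (r * b)\<^sup>2) \<partial>M)"
      using I\<rho> \<rho>_le by (intro integral_mono) auto
    finally show ?thesis by (simp add: prob_space)
  qed
  \<comment> \<open>The expansion produces only the covariances of near sites. Adding the far ones
    costs \<open>\<eta>\<close> and completes the full row of covariances, so that summing over
    \<open>i\<close> will give the variance.\<close>
  have tail: "\<bar>(\<Sum>j\<in>B - A. c j) * ?s\<bar> \<le> b\<^sup>2 * \<eta>"
  proof -
    have "\<bar>c j\<bar> \<le> corr i j * b\<^sup>2" for j
    proof -
      have "\<bar>c j\<bar> \<le> corr i j * L2_norm M (y i) * L2_norm M (y j)"
        unfolding c_def by (intro covariance_le y_L2 y)
      also have "\<dots> \<le> corr i j * b * b"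
        using y_norm b by (intro mult_mono mult_nonneg_nonneg corr_nonneg) auto
      finally show ?thesis by (simp add: power2_eq_square mult.assoc)
    qed
    then have "\<bar>\<Sum>j\<in>B - A. c j\<bar> \<le> (\<Sum>j\<in>B - A. corr i j * b\<^sup>2)"
      by (intro order_trans[OF sum_abs sum_mono])
    also have "\<dots> = (\<Sum>j\<in>B - A. corr i j) * b\<^sup>2" by (rule sum_distrib_right[symmetric])
    also have "\<dots> \<le> \<eta> * b\<^sup>2" using B by (intro mult_right_mono A_tail) auto
    finally have "\<bar>\<Sum>j\<in>B - A. c j\<bar> * \<bar>?s\<bar> \<le> (\<eta> * b\<^sup>2) * 1"
      using s1 by (intro mult_mono) auto
    then show ?thesis by (simp add: abs_mult mult.commute)
  qed
  have sumB: "(\<Sum>j\<in>B. c j) = (\<Sum>j\<in>B \<inter> A. c j) + (\<Sum>j\<in>B - A. c j)"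
    using B by (rule sum.Int_Diff)
  define near' where "near' = (\<Sum>j\<in>B \<inter> A. \<integral>\<omega>. y i \<omega> * y j \<omega> * sin (\<theta> + a * P \<omega>) \<partial>M) - (\<Sum>j\<in>B \<inter> A. c j) * ?s"
  have near'': "\<bar>a * near'\<bar> \<le> \<bar>a\<bar> * (r * (4 * b\<^sup>2 * (1 + infl_const * E) * (\<bar>a\<bar> * b)))"
    unfolding abs_mult[of a near'] unfolding near'_def by (rule mult_left_mono[OF near abs_ge_zero])
  have tail'': "\<bar>a * ((\<Sum>j\<in>B - A. c j) * ?s)\<bar> \<le> \<bar>a\<bar> * (b\<^sup>2 * \<eta>)"
    unfolding abs_mult[of a "(\<Sum>j\<in>B - A. c j) * ?s"] by (rule mult_left_mono[OF tail abs_ge_zero])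
  have tri: "\<bar>p - q - z + w\<bar> \<le> \<bar>p\<bar> + \<bar>q\<bar> + \<bar>z\<bar> + \<bar>w\<bar>" for p q z w :: real
    by linarith
  have split: "(\<integral>\<omega>. y i \<omega> * cos (\<theta> + a * P \<omega>) \<partial>M) + a * (\<Sum>j\<in>B. c j) * ?s =
      (\<integral>\<omega>. y i \<omega> * cos (\<theta> + a * P' \<omega>) \<partial>M) - a * near' - (\<integral>\<omega>. y i \<omega> * \<rho> \<omega> \<partial>M) + a * ((\<Sum>j\<in>B - A. c j) * ?s)"
    unfolding eq sumB near'_def by (simp add: algebra_simps)
  have "\<bar>(\<integral>\<omega>. y i \<omega> * cos (\<theta> + a * P \<omega>) \<partial>M) + a * (\<Sum>j\<in>B. c j) * ?s\<bar> \<le>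
      \<bar>\<integral>\<omega>. y i \<omega> * cos (\<theta> + a * P' \<omega>) \<partial>M\<bar> + \<bar>a * near'\<bar> +
      \<bar>\<integral>\<omega>. y i \<omega> * \<rho> \<omega> \<partial>M\<bar> + \<bar>a * ((\<Sum>j\<in>B - A. c j) * ?s)\<bar>"
    unfolding split by (rule tri)
  also have "\<dots> \<le> \<bar>a\<bar> * (b\<^sup>2 * infl_const * \<eta>) + \<bar>a\<bar> * (r * (4 * b\<^sup>2 * (1 + infl_const * E) * (\<bar>a\<bar> * b))) +
      b * (a\<^sup>2 * (r * b)\<^sup>2) + \<bar>a\<bar> * (b\<^sup>2 * \<eta>)"
    by (rule add_mono[OF add_mono[OF add_mono[OF far near''] rem] tail''])
  also have "\<dots> = \<bar>a\<bar> * (b\<^sup>2 * (1 + infl_const) * \<eta>) + a\<^sup>2 * (b ^ 3 * (4 * real r * (1 + infl_const * E) + (real r)\<^sup>2))"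
  proof -
    have "\<bar>a\<bar> * (\<bar>a\<bar> * x) = a * (a * x)" for x by (simp flip: mult.assoc)
    note aa = this
    show ?thesis by (simp add: aa power2_eq_square power3_eq_cube algebra_simps)
  qed
  finally show ?thesis unfolding c_def P_def .
qed

text \<open>The derivative in \<open>t\<close> is a normalized sum over sites of the expectations
  treated by \<open>Stein_identity_site\<close>. The rows of covariances add up to the variance of
  \<open>Z\<close>, which gives the approximate Gaussian equation with exactly this variance;
  \<open>gaussian_ODE_stability\<close> integrates it.\<close>

lemma cos_normalized_sum_bounded:
  fixes y :: "'i \<Rightarrow> 'a \<Rightarrow> real"
  assumes y: "\<And>i. y i \<in> borel_measurable (\<H> {i})" "\<And>i \<omega>. \<bar>y i \<omega>\<bar> \<le> b" "\<And>i. (\<integral>\<omega>. y i \<omega> \<partial>M) = 0"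
    and A: "\<And>i. i \<in> A i" "\<And>i. finite (A i)" "\<And>i. card (A i) \<le> r"
    and A_tail: "\<And>i U. finite U \<Longrightarrow> U \<inter> A i = {} \<Longrightarrow> (\<Sum>k\<in>U. corr i k) \<le> \<eta>"
    and B: "finite B" "B \<noteq> {}"
    and Z_def: "Z = (\<lambda>\<omega>. (\<Sum>j\<in>B. y j \<omega>) / sqrt (card B))"
  shows "\<bar>(\<integral>\<omega>. cos (\<theta> + t * Z \<omega>) \<partial>M) - cos \<theta> * exp (- ((\<integral>\<omega>. (Z \<omega>)\<^sup>2 \<partial>M) * t\<^sup>2 / 2))\<bar>
    \<le> \<bar>t\<bar> * (\<bar>t\<bar> * (b\<^sup>2 * (1 + infl_const) * \<eta>) + t\<^sup>2 * (b ^ 3 * (4 * real r * (1 + infl_const * E) + (real r)\<^sup>2)) / sqrt (card B))"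
proof -
  have y_M: "y i \<in> borel_measurable M" for i by (rule \<H>_measurable[OF y(1)])
  have b: "0 \<le> b" using y(2)[of undefined undefined] by linarith
  have y_L2: "y i \<in> L2 M" for i by (rule L2_bounded[OF y_M y(2)])
  have \<eta>: "0 \<le> \<eta>" using A_tail[of "{}"] by simp
  define n where "n = sqrt (card B)"
  have n: "0 < n" "n * n = card B" using B by (auto simp: n_def card_gt_0_iff)
  define P where "P = (\<lambda>\<omega>. \<Sum>j\<in>B. y j \<omega>)"
  define v where "v = (\<integral>\<omega>. (Z \<omega>)\<^sup>2 \<partial>M)"
  define c where "c = (\<lambda>i j. \<integral>\<omega>. y i \<omega> * y j \<omega> \<partial>M)"
  define \<alpha> where "\<alpha> = b\<^sup>2 * (1 + infl_const) * \<eta>"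
  define \<kappa> where "\<kappa> = b ^ 3 * (4 * real r * (1 + infl_const * E) + (real r)\<^sup>2)"
  have \<alpha>: "0 \<le> \<alpha>" using b \<eta> infl_const_ge_1 by (auto simp: \<alpha>_def)
  have \<kappa>: "0 \<le> \<kappa>" using b infl_const_ge_1 E_nonneg by (auto simp: \<kappa>_def)
  have Z: "Z \<omega> = P \<omega> / n" for \<omega> by (simp add: Z_def P_def n_def)
  have P_L2: "P \<in> L2 M" unfolding P_def by (intro L2_sum y_L2)
  have Z_L2: "Z \<in> L2 M"
    using L2_cmult[OF P_L2, of "1 / n"] unfolding Z by simp
  have [measurable]: "P \<in> borel_measurable M" by (rule L2_measurable[OF P_L2])
  have v: "v = (\<Sum>i\<in>B. \<Sum>j\<in>B. c i j) / (n * n)"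
  proof -
    have "(\<integral>\<omega>. P \<omega> * P \<omega> \<partial>M) = (\<integral>\<omega>. (\<Sum>i\<in>B. \<Sum>j\<in>B. y i \<omega> * y j \<omega>) \<partial>M)"
      by (simp add: P_def sum_product)
    also have "\<dots> = (\<Sum>i\<in>B. \<Sum>j\<in>B. c i j)"
      unfolding c_def by (simp add: L2_integrable_mult[OF y_L2 y_L2])
    finally show ?thesis unfolding v_def Z by (simp add: power2_eq_square)
  qed
  have "\<bar>(\<integral>\<omega>. cos (\<theta> + t * Z \<omega>) \<partial>M) - (\<integral>\<omega>. cos (\<theta> + 0 * Z \<omega>) \<partial>M) * exp (- (v * t\<^sup>2 / 2))\<bar>
      \<le> \<bar>t\<bar> * (\<bar>t\<bar> * \<alpha> + t\<^sup>2 * \<kappa> / n)"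
  proof (rule gaussian_ODE_stability)
    show "((\<lambda>s. \<integral>\<omega>. cos (\<theta> + s * Z \<omega>) \<partial>M) has_field_derivative
        - (\<integral>\<omega>. Z \<omega> * sin (\<theta> + s * Z \<omega>) \<partial>M)) (at s)" for s
      by (rule has_derivative_expectation_cos[OF Z_L2])
    show "0 \<le> v" unfolding v_def by simp
    fix s :: real assume s: "\<bar>s\<bar> \<le> \<bar>t\<bar>"
    define a where "a = s / n"
    \<comment> \<open>A quarter turn changes \<open>- sin\<close> into \<open>cos\<close> and
      \<open>cos\<close> into \<open>sin\<close>, the pair occurring in
      \<open>Stein_identity_site\<close>.\<close>
    define \<theta>' where "\<theta>' = \<theta> + pi / 2"
    define s0 where "s0 = (\<integral>\<omega>. sin (\<theta>' + a * P \<omega>) \<partial>M)"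
    have arg: "s * Z \<omega> = a * P \<omega>" for \<omega> by (simp add: Z a_def)
    have tr: "cos (\<theta> + a * P \<omega>) = sin (\<theta>' + a * P \<omega>)" "- sin (\<theta> + a * P \<omega>) = cos (\<theta>' + a * P \<omega>)" for \<omega>
      by (simp_all add: \<theta>'_def sin_add cos_add)
    have cos_L2: "(\<lambda>\<omega>. cos (\<theta>' + a * P \<omega>)) \<in> L2 M"
      by (rule L2_bounded[OF _ abs_cos_le_one]) measurable
    have "- (\<integral>\<omega>. Z \<omega> * sin (\<theta> + s * Z \<omega>) \<partial>M) = (\<integral>\<omega>. (\<Sum>i\<in>B. y i \<omega> * cos (\<theta>' + a * P \<omega>)) / n \<partial>M)"
      unfolding arg tr(2)[symmetric] Bochner_Integration.integral_minus[symmetric]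
      by (intro Bochner_Integration.integral_cong) (simp_all add: Z P_def sum_distrib_right sum_negf)
    also have "\<dots> = (\<Sum>i\<in>B. \<integral>\<omega>. y i \<omega> * cos (\<theta>' + a * P \<omega>) \<partial>M) / n"
      by (simp add: L2_integrable_mult[OF y_L2 cos_L2])
    finally have 1: "- (\<integral>\<omega>. Z \<omega> * sin (\<theta> + s * Z \<omega>) \<partial>M) =
      (\<Sum>i\<in>B. \<integral>\<omega>. y i \<omega> * cos (\<theta>' + a * P \<omega>) \<partial>M) / n" .
    have 2: "s * v * (\<integral>\<omega>. cos (\<theta> + s * Z \<omega>) \<partial>M) = (\<Sum>i\<in>B. a * (\<Sum>j\<in>B. c i j) * s0) / n"
    proof -
      have "(\<integral>\<omega>. cos (\<theta> + s * Z \<omega>) \<partial>M) = s0"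
        unfolding arg tr(1) s0_def ..
      then have "s * v * (\<integral>\<omega>. cos (\<theta> + s * Z \<omega>) \<partial>M) = a * (\<Sum>i\<in>B. \<Sum>j\<in>B. c i j) * s0 / n"
        using n(1) by (simp add: v a_def)
      then show ?thesis by (simp add: sum_distrib_left sum_distrib_right)
    qed
    have "\<bar>- (\<integral>\<omega>. Z \<omega> * sin (\<theta> + s * Z \<omega>) \<partial>M) + s * v * (\<integral>\<omega>. cos (\<theta> + s * Z \<omega>) \<partial>M)\<bar> =
      \<bar>\<Sum>i\<in>B. (\<integral>\<omega>. y i \<omega> * cos (\<theta>' + a * P \<omega>) \<partial>M) + a * (\<Sum>j\<in>B. c i j) * s0\<bar> / n"
      unfolding 1 2 using n(1) by (simp add: sum.distrib add_divide_distrib[symmetric])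
    also have "\<dots> \<le> (\<Sum>i\<in>B. \<bar>(\<integral>\<omega>. y i \<omega> * cos (\<theta>' + a * P \<omega>) \<partial>M) + a * (\<Sum>j\<in>B. c i j) * s0\<bar>) / n"
      using n(1) by (intro divide_right_mono sum_abs) auto
    also have "\<dots> \<le> (\<Sum>i\<in>B. \<bar>a\<bar> * \<alpha> + a\<^sup>2 * \<kappa>) / n"
    proof (intro divide_right_mono sum_mono)
      fix i assume "i \<in> B"
      show "\<bar>(\<integral>\<omega>. y i \<omega> * cos (\<theta>' + a * P \<omega>) \<partial>M) + a * (\<Sum>j\<in>B. c i j) * s0\<bar> \<le> \<bar>a\<bar> * \<alpha> + a\<^sup>2 * \<kappa>"
        unfolding P_def c_def s0_def \<alpha>_def \<kappa>_def
        by (rule Stein_identity_site[OF y A A_tail B(1)])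
    qed (use n in auto)
    \<comment> \<open>There are \<open>n * n\<close> equal terms and one division by
      \<open>n\<close>. With \<open>a = s / n\<close>, the \<open>\<eta>\<close> error stays of
      order 1, to be made small by enlarging the neighbourhoods, whereas the quadratic error decays
      like \<open>1 / n\<close>.\<close>
    also have "\<dots> = n * (\<bar>a\<bar> * \<alpha> + a\<^sup>2 * \<kappa>)"
      using n by (simp flip: n(2))
    also have "\<dots> = \<bar>s\<bar> * \<alpha> + s\<^sup>2 * \<kappa> / n"
      using n(1) by (simp add: a_def field_simps power2_eq_square)
    also have "\<dots> \<le> \<bar>t\<bar> * \<alpha> + t\<^sup>2 * \<kappa> / n"
      using s \<alpha> \<kappa> n(1) abs_le_square_iff[of s t]
      by (intro add_mono mult_right_mono divide_right_mono) auto
    finally show "\<bar>- (\<integral>\<omega>. Z \<omega> * sin (\<theta> + s * Z \<omega>) \<partial>M) + s * v * (\<integral>\<omega>. cos (\<theta> + s * Z \<omega>) \<partial>M)\<bar>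
      \<le> \<bar>t\<bar> * \<alpha> + t\<^sup>2 * \<kappa> / n" .
  qed
  then show ?thesis by (simp add: v_def \<alpha>_def \<kappa>_def n_def prob_space)
qed

end

section \<open>Translation invariance of the subjective correlations\<close>

text \<open>The Doob-Dynkin factorization. It lets a random variable built from one field be rebuilt
  from another field with the same law.\<close>

lemma borel_measurable_vimage_algebra_factor:
  fixes f :: "'a \<Rightarrow> real"
  assumes f: "f \<in> borel_measurable (vimage_algebra \<Omega> T N)" and T: "T \<in> \<Omega> \<rightarrow> space N"
  obtains F where "F \<in> borel_measurable N" "\<And>\<omega>. \<omega> \<in> \<Omega> \<Longrightarrow> f \<omega> = F (T \<omega>)"
proof -
  have "\<exists>B\<in>sets N. {\<omega>\<in>\<Omega>. f \<omega> < real_of_rat q} = T -` B \<inter> \<Omega>" for q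
  proof -
    have "{\<omega>\<in>space (vimage_algebra \<Omega> T N). f \<omega> < real_of_rat q} \<in> sets (vimage_algebra \<Omega> T N)"
      using f by measurable
    then show ?thesis using T by (auto simp: sets_vimage_algebra2)
  qed
  then obtain B where B: "\<And>q. B q \<in> sets N" "\<And>q. {\<omega>\<in>\<Omega>. f \<omega> < real_of_rat q} = T -` B q \<inter> \<Omega>"
    by metis
  \<comment> \<open>On the range of \<open>T\<close> this is the infimum of the rationals above
    \<open>f \<omega>\<close>. Off the range the sets \<open>B q\<close> are uncontrolled and the
    infimum may be infinite, so it is formed in the extended reals.\<close>
  define G where "G = (\<lambda>x. INF q. if x \<in> B q then ereal (real_of_rat q) else \<infinity>)"
  have G: "G \<in> borel_measurable N"
    unfolding G_def using B(1) by (intro borel_measurable_INF measurable_If) auto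
  have "G (T \<omega>) = ereal (f \<omega>)" if \<omega>: "\<omega> \<in> \<Omega>" for \<omega>
  proof (rule antisym)
    have iff: "T \<omega> \<in> B q \<longleftrightarrow> f \<omega> < real_of_rat q" for q
      using B(2)[of q] \<omega> by blast
    show "ereal (f \<omega>) \<le> G (T \<omega>)"
      unfolding G_def by (rule INF_greatest) (auto simp: iff)
    show "G (T \<omega>) \<le> ereal (f \<omega>)"
    proof (rule dense_ge)
      fix x assume x: "ereal (f \<omega>) < x"
      obtain y where y: "f \<omega> < y" "ereal y \<le> x"
        using x by (cases x) (auto intro: that[of "f \<omega> + 1"])
      then obtain q where q: "f \<omega> < real_of_rat q" "real_of_rat q < y"
        using of_rat_dense[of "f \<omega>" y] by auto
      have "G (T \<omega>) \<le> (if T \<omega> \<in> B q then ereal (real_of_rat q) else \<infinity>)"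
        unfolding G_def by (rule INF_lower) simp
      also have "\<dots> = ereal (real_of_rat q)" using q by (simp add: iff)
      also have "\<dots> \<le> ereal y" using q by simp
      finally show "G (T \<omega>) \<le> x" using y(2) by simp
    qed
  qed
  then show thesis
    using G by (intro that[of "\<lambda>x. real_of_ereal (G x)"]) auto
qed

context random_field
begin

text \<open>Together with \<open>\<H>_join\<close> this identifies the two algebras, so that a
  function admissible in the definition of subjective correlation factors through the sites
  \<open>insert i K\<close>.\<close>

lemma join_\<H>:
  assumes "f \<in> borel_measurable (join_algebra (vimage_algebra (space M) (X i) S) (\<H> K))"
  shows "f \<in> borel_measurable (\<H> (insert i K))"
proof -
  let ?V = "vimage_algebra (space M) (X i) S" and ?J = "join_algebra (vimage_algebra (space M) (X i) S) (\<H> K)"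
  have le: "sets ?V \<union> sets (\<H> K) \<subseteq> Pow (space M)"
    using sets.space_closed[of ?V] sets.space_closed[of "\<H> K"] by auto
  have "sets ?V \<subseteq> sets (\<H> (insert i K))"
    by (rule sets_image_in_sets) (auto intro: X_measurable_\<H>)
  moreover have "sets (\<H> K) \<subseteq> sets (\<H> (insert i K))"
    using subalg_mono[of K "insert i K"] by (auto simp: subalgebra_def)
  ultimately have "sigma_sets (space M) (sets ?V \<union> sets (\<H> K)) \<subseteq> sets (\<H> (insert i K))"
    using sets.sigma_sets_subset[of "sets ?V \<union> sets (\<H> K)" "\<H> (insert i K)"] by simp
  then have "subalgebra (\<H> (insert i K)) ?J"
    using le by (simp add: subalgebra_def join_algebra_def space_measure_of_conv)
  from measurable_from_subalg[OF this assms] show ?thesis .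
qed

lemma X_PiM: "(\<lambda>\<omega>. \<lambda>k\<in>K. X k \<omega>) \<in> measurable M (\<Pi>\<^sub>M k\<in>K. S)"
  by (intro measurable_restrict X_measurable)

lemma X_PiM_UNIV: "(\<lambda>\<omega> i. X i \<omega>) \<in> measurable M (\<Pi>\<^sub>M i\<in>UNIV. S)"
  using X_PiM[of UNIV] by (simp add: restrict_def)

lemma \<H>_factor:
  fixes f :: "'a \<Rightarrow> real"
  assumes "f \<in> borel_measurable (\<H> K)"
  obtains F where "F \<in> borel_measurable (\<Pi>\<^sub>M k\<in>K. S)" "\<And>\<omega>. \<omega> \<in> space M \<Longrightarrow> f \<omega> = F (\<lambda>k\<in>K. X k \<omega>)"
  using borel_measurable_vimage_algebra_factor[OF assms[unfolded family_algebra_def]]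
    measurable_space[OF X_PiM] by blast

lemma sets_\<H>: "sets (\<H> K) = {(\<lambda>\<omega>. \<lambda>k\<in>K. X k \<omega>) -` B \<inter> space M | B. B \<in> sets (\<Pi>\<^sub>M k\<in>K. S)}"
  unfolding family_algebra_def
  by (rule sets_vimage_algebra2) (use measurable_space[OF X_PiM] in blast)

end

text \<open>Both fields live on one probability space and only their laws agree, which is the
  relation of a stationary field to its translates. One inequality is proved under this asymmetric
  naming; exchanging the roles yields the other.\<close>

locale same_law_fields = X: random_field M S X + Y: random_field M S Y
  for M :: "'a measure" and S :: "'b measure" and X Y :: "'i \<Rightarrow> 'a \<Rightarrow> 'b" +
  assumes same_law: "distr M (\<Pi>\<^sub>M i\<in>UNIV. S) (\<lambda>\<omega> i. X i \<omega>) = distr M (\<Pi>\<^sub>M i\<in>UNIV. S) (\<lambda>\<omega> i. Y i \<omega>)"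
begin

lemma same_law_integral:
  fixes \<Phi> :: "('i \<Rightarrow> 'b) \<Rightarrow> real"
  assumes [measurable]: "\<Phi> \<in> borel_measurable (\<Pi>\<^sub>M i\<in>UNIV. S)"
  shows "(\<integral>\<omega>. \<Phi> (\<lambda>i. X i \<omega>) \<partial>M) = (\<integral>\<omega>. \<Phi> (\<lambda>i. Y i \<omega>) \<partial>M)"
    and "integrable M (\<lambda>\<omega>. \<Phi> (\<lambda>i. X i \<omega>)) \<longleftrightarrow> integrable M (\<lambda>\<omega>. \<Phi> (\<lambda>i. Y i \<omega>))"
  using integral_distr[OF X.X_PiM_UNIV assms] integral_distr[OF Y.X_PiM_UNIV assms]
    integrable_distr_eq[OF X.X_PiM_UNIV assms] integrable_distr_eq[OF Y.X_PiM_UNIV assms]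
  by (simp_all add: same_law)

text \<open>Every condition on \<open>f\<close> can be expressed through the law of the field:
  \<open>f\<close> is \<open>\<Phi>\<close> of \<open>X\<close>, and conditional centring says that
  integrals over events of the sites in \<open>K\<close> vanish. Hence \<open>\<Phi>\<close> of
  \<open>Y\<close> satisfies the same conditions.\<close>

lemma cond_centered_transfer:
  assumes f: "f \<in> cond_centered_L2 M (vimage_algebra (space M) (X i) S) (family_algebra M S X K)"
  obtains \<Phi> where "\<Phi> \<in> borel_measurable (\<Pi>\<^sub>M i\<in>UNIV. S)" "\<And>\<omega>. \<omega> \<in> space M \<Longrightarrow> f \<omega> = \<Phi> (\<lambda>i. X i \<omega>)"
    "(\<lambda>\<omega>. \<Phi> (\<lambda>i. Y i \<omega>)) \<in> cond_centered_L2 M (vimage_algebra (space M) (Y i) S) (family_algebra M S Y K)"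
proof -
  let ?I = "insert i K"
  have f1: "f \<in> borel_measurable (X.\<H> ?I)"
    using f by (intro X.join_\<H>) (simp add: cond_centered_L2_def)
  have f2: "f \<in> L2 M" "AE \<omega> in M. X.\<Q> K f \<omega> = 0"
    using f X.\<H>_measurable[OF f1] by (auto simp: cond_centered_L2_def L2_def)
  from X.\<H>_factor[OF f1] obtain F where F: "F \<in> borel_measurable (\<Pi>\<^sub>M k\<in>?I. S)"
    "\<And>\<omega>. \<omega> \<in> space M \<Longrightarrow> f \<omega> = F (\<lambda>k\<in>?I. X k \<omega>)" by blast
  have R: "(\<lambda>x. restrict x J) \<in> measurable (\<Pi>\<^sub>M i\<in>UNIV. S) (\<Pi>\<^sub>M k\<in>J. S)" for J :: "'i set"
    by (rule measurable_restrict_subset) simp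
  define \<Phi> where "\<Phi> = (\<lambda>x. F (restrict x ?I))"
  have \<Phi>: "\<Phi> \<in> borel_measurable (\<Pi>\<^sub>M i\<in>UNIV. S)"
    unfolding \<Phi>_def by (rule measurable_compose[OF R F(1)])
  have f\<Phi>: "f \<omega> = \<Phi> (\<lambda>i. X i \<omega>)" if "\<omega> \<in> space M" for \<omega>
    using F(2)[OF that] by (simp add: \<Phi>_def restrict_def)
  define f' where "f' = (\<lambda>\<omega>. \<Phi> (\<lambda>i. Y i \<omega>))"
  have f'H: "f' \<in> borel_measurable (Y.\<H> ?I)"
  proof -
    have "(\<lambda>\<omega>. \<lambda>k\<in>?I. Y k \<omega>) \<in> measurable (Y.\<H> ?I) (\<Pi>\<^sub>M k\<in>?I. S)"
      by (intro measurable_restrict Y.X_measurable_\<H>)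
    from measurable_compose[OF this F(1)] show ?thesis
      by (simp add: f'_def \<Phi>_def restrict_def)
  qed
  have "integrable M (\<lambda>\<omega>. (\<Phi> (\<lambda>i. X i \<omega>))\<^sup>2)"
    using f2(1) f\<Phi> by (simp add: L2_def cong: Bochner_Integration.integrable_cong)
  then have f'2: "integrable M (\<lambda>\<omega>. (f' \<omega>)\<^sup>2)"
    using same_law_integral(2)[of "\<lambda>x. (\<Phi> x)\<^sup>2"] \<Phi> by (simp add: f'_def)
  have f'L: "f' \<in> L2 M"
    using f'2 Y.\<H>_measurable[OF f'H] by (simp add: L2_def)
  interpret HX: finite_measure_subalgebra M "X.\<H> K" by (rule X.cond)
  interpret HY: finite_measure_subalgebra M "Y.\<H> K" by (rule Y.cond)
  have "AE \<omega> in M. Y.\<Q> K f' \<omega> = 0"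
  proof (rule HY.real_cond_exp_charact)
    fix A assume "A \<in> sets (Y.\<H> K)"
    then obtain B where B: "B \<in> sets (\<Pi>\<^sub>M k\<in>K. S)" "A = (\<lambda>\<omega>. \<lambda>k\<in>K. Y k \<omega>) -` B \<inter> space M"
      by (auto simp: Y.sets_\<H>)
    define A' where "A' = (\<lambda>\<omega>. \<lambda>k\<in>K. X k \<omega>) -` B \<inter> space M"
    have A': "A' \<in> sets (X.\<H> K)" using B(1) by (auto simp: X.sets_\<H> A'_def)
    \<comment> \<open>\<open>A\<close> and \<open>A'\<close> are the pullbacks of the same
      \<open>B\<close> by the two fields, so both set integrals are expectations of this one
      function of the field.\<close>
    define \<Psi> where "\<Psi> = (\<lambda>x. indicator B (restrict x K) * \<Phi> x)"
    have \<Psi>: "\<Psi> \<in> borel_measurable (\<Pi>\<^sub>M i\<in>UNIV. S)"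
      unfolding \<Psi>_def
      by (intro borel_measurable_times \<Phi> measurable_compose[OF R borel_measurable_indicator[OF B(1)]])
    have "(\<integral>\<omega>\<in>A. f' \<omega> \<partial>M) = (\<integral>\<omega>. \<Psi> (\<lambda>i. Y i \<omega>) \<partial>M)"
      unfolding set_lebesgue_integral_def \<Psi>_def f'_def B(2)
      by (intro Bochner_Integration.integral_cong) (auto simp: indicator_def restrict_def)
    also have "\<dots> = (\<integral>\<omega>. \<Psi> (\<lambda>i. X i \<omega>) \<partial>M)"
      by (rule same_law_integral(1)[OF \<Psi>, symmetric])
    also have "\<dots> = (\<integral>\<omega>\<in>A'. f \<omega> \<partial>M)"
      unfolding set_lebesgue_integral_def \<Psi>_def A'_def
      by (intro Bochner_Integration.integral_cong) (auto simp: indicator_def restrict_def f\<Phi>)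
    also have "\<dots> = (\<integral>\<omega>\<in>A'. X.\<Q> K f \<omega> \<partial>M)"
      by (rule HX.real_cond_exp_intA[OF X.L2_integrable[OF f2(1)] A'])
    also have "\<dots> = (\<integral>\<omega>. 0 \<partial>M)"
      unfolding set_lebesgue_integral_def using f2(2) A' X.subalg[of K]
      by (intro integral_cong_AE) (auto elim: eventually_mono simp: subalgebra_def)
    finally show "(\<integral>\<omega>\<in>A. f' \<omega> \<partial>M) = (\<integral>\<omega>\<in>A. 0 \<partial>M)" by (simp add: set_lebesgue_integral_def)
  qed (use X.L2_integrable[OF f'L] in auto)
  then have "f' \<in> cond_centered_L2 M (vimage_algebra (space M) (Y i) S) (family_algebra M S Y K)"
    using f'2 Y.\<H>_join[OF f'H] by (simp add: cond_centered_L2_def)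
  then show thesis using that[OF \<Phi> f\<Phi>] unfolding f'_def by blast
qed

text \<open>An admissible pair for \<open>X\<close> transfers to one for \<open>Y\<close> with the
  same pairing and the same standard deviations. So for each \<open>K\<close> the least bound for
  \<open>Y\<close> is a bound for \<open>X\<close>.\<close>

lemma subj_corr_star_le: "X.corr i j \<le> Y.corr i j"
proof -
  let ?X = "\<lambda>i. vimage_algebra (space M) (X i) S" and ?Y = "\<lambda>i. vimage_algebra (space M) (Y i) S"
  note M = X.prob_space_axioms
  have sX: "subalgebra M (?X i)" for i by (rule subalgebra_family_algebra) (rule X.X_measurable)
  have sY: "subalgebra M (?Y i)" for i by (rule subalgebra_family_algebra) (rule Y.X_measurable)
  have "subj_corr M (?X i) (?X j) (X.\<H> K) \<le> subj_corr M (?Y i) (?Y j) (Y.\<H> K)" for K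
  proof (rule subj_corr(2)[OF M sX sX X.subalg])
    let ?e = "subj_corr M (?Y i) (?Y j) (Y.\<H> K)"
    have e: "subj_corr_bound M (?Y i) (?Y j) (Y.\<H> K) ?e"
      by (rule subj_corr(1)[OF M sY sY Y.subalg])
    have e_bound: "\<bar>\<integral>\<omega>. p \<omega> * q \<omega> \<partial>M\<bar> \<le> ?e * std_dev M p * std_dev M q"
      if "p \<in> cond_centered_L2 M (?Y i) (Y.\<H> K)" "q \<in> cond_centered_L2 M (?Y j) (Y.\<H> K)" for p q
      using e that by (simp add: subj_corr_bound_def)
    show "subj_corr_bound M (?X i) (?X j) (X.\<H> K) ?e"
      unfolding subj_corr_bound_def
    proof (intro conjI ballI)
      show "0 \<le> ?e" "?e \<le> 1" using e by (auto simp: subj_corr_bound_def)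
      fix f g assume fg: "f \<in> cond_centered_L2 M (?X i) (X.\<H> K)" "g \<in> cond_centered_L2 M (?X j) (X.\<H> K)"
      from cond_centered_transfer[OF fg(1)] obtain \<Phi> where \<Phi>: "\<Phi> \<in> borel_measurable (\<Pi>\<^sub>M i\<in>UNIV. S)"
        "\<And>\<omega>. \<omega> \<in> space M \<Longrightarrow> f \<omega> = \<Phi> (\<lambda>i. X i \<omega>)"
        "(\<lambda>\<omega>. \<Phi> (\<lambda>i. Y i \<omega>)) \<in> cond_centered_L2 M (?Y i) (Y.\<H> K)" by blast
      from cond_centered_transfer[OF fg(2)] obtain \<Gamma> where \<Gamma>: "\<Gamma> \<in> borel_measurable (\<Pi>\<^sub>M i\<in>UNIV. S)"
        "\<And>\<omega>. \<omega> \<in> space M \<Longrightarrow> g \<omega> = \<Gamma> (\<lambda>i. X i \<omega>)"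
        "(\<lambda>\<omega>. \<Gamma> (\<lambda>i. Y i \<omega>)) \<in> cond_centered_L2 M (?Y j) (Y.\<H> K)" by blast
      have sd: "std_dev M f = std_dev M (\<lambda>\<omega>. \<Phi> (\<lambda>i. Y i \<omega>))"
        if "f \<in> cond_centered_L2 M (?X i) (X.\<H> K)" "\<Phi> \<in> borel_measurable (\<Pi>\<^sub>M i\<in>UNIV. S)"
          "\<And>\<omega>. \<omega> \<in> space M \<Longrightarrow> f \<omega> = \<Phi> (\<lambda>i. X i \<omega>)"
          "(\<lambda>\<omega>. \<Phi> (\<lambda>i. Y i \<omega>)) \<in> cond_centered_L2 M (?Y i) (Y.\<H> K)" for f \<Phi> i
      proof -
        have "(\<integral>\<omega>. (f \<omega>)\<^sup>2 \<partial>M) = (\<integral>\<omega>. (\<Phi> (\<lambda>i. X i \<omega>))\<^sup>2 \<partial>M)"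
          using that(3) by (intro Bochner_Integration.integral_cong) auto
        also have "\<dots> = (\<integral>\<omega>. (\<Phi> (\<lambda>i. Y i \<omega>))\<^sup>2 \<partial>M)"
          using that(2) by (intro same_law_integral(1)) auto
        finally show ?thesis
          unfolding cond_centered_L2D(5)[OF M sX X.subalg that(1)] cond_centered_L2D(5)[OF M sY Y.subalg that(4)]
          by simp
      qed
      have "(\<integral>\<omega>. f \<omega> * g \<omega> \<partial>M) = (\<integral>\<omega>. \<Phi> (\<lambda>i. X i \<omega>) * \<Gamma> (\<lambda>i. X i \<omega>) \<partial>M)"
        using \<Phi>(2) \<Gamma>(2) by (intro Bochner_Integration.integral_cong) auto
      also have "\<dots> = (\<integral>\<omega>. \<Phi> (\<lambda>i. Y i \<omega>) * \<Gamma> (\<lambda>i. Y i \<omega>) \<partial>M)"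
        using \<Phi>(1) \<Gamma>(1) by (intro same_law_integral(1)[of "\<lambda>x. \<Phi> x * \<Gamma> x"]) auto
      finally have "(\<integral>\<omega>. f \<omega> * g \<omega> \<partial>M) = (\<integral>\<omega>. \<Phi> (\<lambda>i. Y i \<omega>) * \<Gamma> (\<lambda>i. Y i \<omega>) \<partial>M)" .
      moreover have "\<bar>\<integral>\<omega>. \<Phi> (\<lambda>i. Y i \<omega>) * \<Gamma> (\<lambda>i. Y i \<omega>) \<partial>M\<bar> \<le>
          ?e * std_dev M (\<lambda>\<omega>. \<Phi> (\<lambda>i. Y i \<omega>)) * std_dev M (\<lambda>\<omega>. \<Gamma> (\<lambda>i. Y i \<omega>))"
        by (rule e_bound[OF \<Phi>(3) \<Gamma>(3)])
      ultimately show "\<bar>\<integral>\<omega>. f \<omega> * g \<omega> \<partial>M\<bar> \<le> ?e * std_dev M f * std_dev M g"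
        using sd[OF fg(1) \<Phi>] sd[OF fg(2) \<Gamma>] by simp
    qed
  qed
  also have "subj_corr M (?Y i) (?Y j) (Y.\<H> K) \<le> Y.corr i j" for K
    unfolding subj_corr_star_def
    by (intro cSUP_upper bdd_above_subj_corr M Y.X_measurable) auto
  finally show ?thesis
    unfolding subj_corr_star_def[of M S X] by (intro cSUP_least) auto
qed

end

context random_field
begin

lemma subj_corr_star_reindex:
  assumes "surj \<tau>"
  shows "subj_corr_star M S (\<lambda>i. X (\<tau> i)) i j = corr (\<tau> i) (\<tau> j)"
proof -
  interpret Y: random_field M S "\<lambda>i. X (\<tau> i)" by unfold_locales (rule X_measurable)
  \<comment> \<open>Both sides carry the zero measure, so equality of the measurable sets gives
    equality as measures.\<close>
  have "Y.\<H> K = \<H> (\<tau> ` K)" for K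
  proof (rule measure_eqI)
    show "sets (Y.\<H> K) = sets (\<H> (\<tau> ` K))"
    proof
      show "sets (Y.\<H> K) \<subseteq> sets (\<H> (\<tau> ` K))"
        by (rule Y.sets_\<H>_subset) (auto intro: X_measurable_\<H>)
      show "sets (\<H> (\<tau> ` K)) \<subseteq> sets (Y.\<H> K)"
        by (rule sets_\<H>_subset) (auto intro: Y.X_measurable_\<H>)
    qed
  qed (simp add: family_algebra_def vimage_algebra_def emeasure_sigma)
  note alg = this
  have "range (\<lambda>K. f (\<tau> ` K)) = range f" for f :: "'i set \<Rightarrow> real"
  proof -
    have "f K \<in> range (\<lambda>K. f (\<tau> ` K))" for K
      by (rule image_eqI[of _ _ "\<tau> -` K"]) (simp_all add: assms)
    then show ?thesis by blast
  qed
  from this[of "\<lambda>K. subj_corr M (vimage_algebra (space M) (X (\<tau> i)) S)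
    (vimage_algebra (space M) (X (\<tau> j)) S) (\<H> K)"]
  show ?thesis unfolding subj_corr_star_def alg by simp
qed

end

text \<open>The coefficients depend only on the law, which a translation preserves; the coefficients
  of the translated field are those of \<open>X\<close> at the shifted sites.\<close>

lemma subj_corr_star_translation:
  fixes X :: "'i::ab_group_add \<Rightarrow> 'a \<Rightarrow> 'b"
  assumes M: "prob_space M" and X: "\<And>i. X i \<in> measurable M S" and inv: "translation_invariant M S X"
  shows "subj_corr_star M S X (i + z) (j + z) = subj_corr_star M S X i j"
proof -
  interpret X: random_field M S X
    using M X by (simp add: random_field_def random_field_axioms_def)
  interpret Y: random_field M S "\<lambda>i. X (i + z)" by unfold_locales (rule X)
  have law: "distr M (\<Pi>\<^sub>M i\<in>UNIV. S) (\<lambda>\<omega> i. X (i + z) \<omega>) = distr M (\<Pi>\<^sub>M i\<in>UNIV. S) (\<lambda>\<omega> i. X i \<omega>)"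
    using inv by (simp add: translation_invariant_def)
  interpret XY: same_law_fields M S X "\<lambda>i. X (i + z)" by unfold_locales (simp add: law)
  interpret YX: same_law_fields M S "\<lambda>i. X (i + z)" X by unfold_locales (simp add: law)
  have "surj (\<lambda>i. i + z)" by (rule surjI[of _ "\<lambda>i. i - z"]) simp
  from X.subj_corr_star_reindex[OF this, of i j] show ?thesis
    using XY.subj_corr_star_le[of i j] YX.subj_corr_star_le[of i j] by simp
qed

section \<open>Stationary fields\<close>

locale stationary_field = random_field M S X
  for M :: "'a measure" and S :: "'b measure" and X :: "'i::ab_group_add \<Rightarrow> 'a \<Rightarrow> 'b" +
  assumes translation_invariant: "translation_invariant M S X"
    and summable_corr: "(\<lambda>z. corr 0 z) summable_on UNIV"
begin

abbreviation total_corr :: real where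
  "total_corr \<equiv> (\<Sum>\<^sub>\<infinity>z. corr 0 z)"

lemma corr_translate: "corr j k = corr 0 (k - j)"
  using subj_corr_star_translation[OF prob_space_axioms X_measurable translation_invariant, of 0 j "k - j"] by simp

lemma sum_corr_translate: "(\<Sum>k\<in>U. corr j k) = (\<Sum>z\<in>(\<lambda>k. k - j) ` U. corr 0 z)"
proof -
  have "(\<Sum>z\<in>(\<lambda>k. k - j) ` U. corr 0 z) = (\<Sum>k\<in>U. corr 0 (k - j))"
    by (subst sum.reindex) (auto simp: inj_on_def)
  moreover have "(\<Sum>k\<in>U. corr j k) = (\<Sum>k\<in>U. corr 0 (k - j))"
    by (rule sum.cong[OF refl corr_translate])
  ultimately show ?thesis by simp
qed

lemma sum_corr_le: "finite U \<Longrightarrow> (\<Sum>k\<in>U. corr j k) \<le> total_corr"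
  unfolding sum_corr_translate[of j U] by (intro finite_sum_le_infsum summable_corr corr_nonneg) auto

lemma total_corr_nonneg: "0 \<le> total_corr"
  by (rule infsum_nonneg) (rule corr_nonneg)

text \<open>A finite partial sum within \<open>\<eta>\<close> of the total leaves at most
  \<open>\<eta>\<close> for displacements outside it, and by translation the same \<open>R\<close>
  serves every \<open>j\<close>. It contains 0 so that a site belongs to its own neighbourhood, as
  \<open>Stein_identity_site\<close> demands.\<close>

lemma corr_tail:
  assumes "0 < \<eta>"
  obtains R where "finite R" "0 \<in> R"
    "\<And>j U. finite U \<Longrightarrow> (\<And>k. k \<in> U \<Longrightarrow> k - j \<notin> R) \<Longrightarrow> (\<Sum>k\<in>U. corr j k) \<le> \<eta>"
proof -
  obtain R where R: "finite R" "dist (\<Sum>z\<in>R. corr 0 z) total_corr \<le> \<eta>"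
    using infsum_finite_approximation[OF summable_corr assms] by blast
  have "(\<Sum>k\<in>U. corr j k) \<le> \<eta>" if U: "finite U" "\<And>k. k \<in> U \<Longrightarrow> k - j \<notin> insert 0 R" for j U
  proof -
    have "(\<Sum>z\<in>R. corr 0 z) + (\<Sum>k\<in>U. corr j k) = (\<Sum>z\<in>R \<union> (\<lambda>k. k - j) ` U. corr 0 z)"
      unfolding sum_corr_translate[of j U] using R U by (intro sum.union_disjoint[symmetric]) auto
    also have "\<dots> \<le> total_corr"
      using R U by (intro finite_sum_le_infsum summable_corr corr_nonneg) auto
    finally show ?thesis using R(2) by (simp add: dist_real_def)
  qed
  then show thesis using that[of "insert 0 R"] R(1) by blast
qed

lemma same_law: "same_law_fields M S (\<lambda>i. X (i + z)) X"
  using translation_invariant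
  by unfold_locales (auto simp: translation_invariant_def)

lemma component_measurable: "(\<lambda>x. x k) \<in> measurable (\<Pi>\<^sub>M i\<in>(UNIV :: 'i set). S) S"
  by (rule measurable_component_singleton) simp

lemma distr_site:
  fixes \<phi> :: "'b \<Rightarrow> real"
  assumes \<phi>: "\<phi> \<in> borel_measurable S"
  shows "(\<integral>\<omega>. \<phi> (X i \<omega>) \<partial>M) = (\<integral>\<omega>. \<phi> (X 0 \<omega>) \<partial>M)"
    and "integrable M (\<lambda>\<omega>. \<phi> (X i \<omega>)) \<longleftrightarrow> integrable M (\<lambda>\<omega>. \<phi> (X 0 \<omega>))"
proof -
  have m: "(\<lambda>x. \<phi> (x 0)) \<in> borel_measurable (\<Pi>\<^sub>M i\<in>(UNIV :: 'i set). S)"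
    by (rule measurable_compose[OF component_measurable \<phi>])
  show "(\<integral>\<omega>. \<phi> (X i \<omega>) \<partial>M) = (\<integral>\<omega>. \<phi> (X 0 \<omega>) \<partial>M)"
    "integrable M (\<lambda>\<omega>. \<phi> (X i \<omega>)) \<longleftrightarrow> integrable M (\<lambda>\<omega>. \<phi> (X 0 \<omega>))"
    using same_law_fields.same_law_integral[OF same_law m, of i] by simp_all
qed

lemma distr_two_sites:
  fixes \<phi> :: "'b \<Rightarrow> real"
  assumes \<phi>: "\<phi> \<in> borel_measurable S"
  shows "(\<integral>\<omega>. \<phi> (X i \<omega>) * \<phi> (X j \<omega>) \<partial>M) = (\<integral>\<omega>. \<phi> (X 0 \<omega>) * \<phi> (X (j - i) \<omega>) \<partial>M)"
proof -
  have "(\<lambda>x. \<phi> (x k)) \<in> borel_measurable (\<Pi>\<^sub>M i\<in>(UNIV :: 'i set). S)" for k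
    by (rule measurable_compose[OF component_measurable \<phi>])
  then have "(\<lambda>x. \<phi> (x 0) * \<phi> (x (j - i))) \<in> borel_measurable (\<Pi>\<^sub>M i\<in>(UNIV :: 'i set). S)"
    by (intro borel_measurable_times)
  from same_law_fields.same_law_integral(1)[OF same_law this, of i] show ?thesis by simp
qed

section \<open>Centred square-integrable observables, their normalized sums and truncation\<close>

definition observables :: "('b \<Rightarrow> real) set" where
  "observables = {f \<in> borel_measurable S. integrable M (\<lambda>\<omega>. (f (X 0 \<omega>))\<^sup>2) \<and> (\<integral>\<omega>. f (X 0 \<omega>) \<partial>M) = 0}"

abbreviation norm0 :: "('b \<Rightarrow> real) \<Rightarrow> real" where
  "norm0 f \<equiv> L2_norm M (\<lambda>\<omega>. f (X 0 \<omega>))"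

definition normalized_sum :: "'i set \<Rightarrow> ('b \<Rightarrow> real) \<Rightarrow> 'a \<Rightarrow> real" where
  "normalized_sum B f = (\<lambda>\<omega>. (\<Sum>i\<in>B. f (X i \<omega>)) / sqrt (card B))"

abbreviation var_sum :: "'i set \<Rightarrow> ('b \<Rightarrow> real) \<Rightarrow> real" where
  "var_sum B f \<equiv> \<integral>\<omega>. (normalized_sum B f \<omega>)\<^sup>2 \<partial>M"

lemma observable_site:
  assumes "f \<in> borel_measurable S"
  shows "(\<lambda>\<omega>. f (X i \<omega>)) \<in> borel_measurable M" "(\<lambda>\<omega>. f (X i \<omega>)) \<in> borel_measurable (\<H> {i})"
    "L2_norm M (\<lambda>\<omega>. f (X i \<omega>)) = norm0 f"
proof -
  show "(\<lambda>\<omega>. f (X i \<omega>)) \<in> borel_measurable M"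
    by (rule measurable_compose[OF X_measurable assms])
  show "(\<lambda>\<omega>. f (X i \<omega>)) \<in> borel_measurable (\<H> {i})"
    by (rule measurable_compose[OF X_measurable_\<H> assms]) simp
  show "L2_norm M (\<lambda>\<omega>. f (X i \<omega>)) = norm0 f"
    using distr_site(1)[of "\<lambda>x. (f x)\<^sup>2" i] assms by (simp add: L2_norm_def)
qed

lemma observables_site:
  assumes "f \<in> observables"
  shows "(\<lambda>\<omega>. f (X i \<omega>)) \<in> L2 M" "(\<integral>\<omega>. f (X i \<omega>) \<partial>M) = 0"
  using distr_site(2)[of "\<lambda>x. (f x)\<^sup>2" i] distr_site(1)[of f i] observable_site(1)[of f i] assms
  by (auto simp: observables_def L2_def)

lemma observables_add: "f \<in> observables \<Longrightarrow> g \<in> observables \<Longrightarrow> (\<lambda>x. f x + g x) \<in> observables"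
  and observables_diff: "f \<in> observables \<Longrightarrow> g \<in> observables \<Longrightarrow> (\<lambda>x. f x - g x) \<in> observables"
proof -
  assume fg: "f \<in> observables" "g \<in> observables"
  note s = observables_site[OF fg(1), of 0] observables_site[OF fg(2), of 0]
  show "(\<lambda>x. f x + g x) \<in> observables" "(\<lambda>x. f x - g x) \<in> observables"
    using fg s L2_add[OF s(1,3)] L2_diff[OF s(1,3)] L2_integrable[OF s(1)] L2_integrable[OF s(3)]
    by (auto simp: observables_def L2_def)
qed

lemma normalized_sum_L2:
  assumes "f \<in> observables"
  shows "normalized_sum B f \<in> L2 M"
proof -
  have "(\<lambda>\<omega>. (1 / sqrt (card B)) * (\<Sum>i\<in>B. f (X i \<omega>))) \<in> L2 M"
    by (intro L2_cmult L2_sum observables_site assms)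
  then show ?thesis by (simp add: normalized_sum_def)
qed

lemma normalized_sum_diff:
  "normalized_sum B f \<omega> - normalized_sum B g \<omega> = normalized_sum B (\<lambda>x. f x - g x) \<omega>"
  by (simp add: normalized_sum_def sum_subtractf diff_divide_distrib)

lemma normalized_sum_add:
  "normalized_sum B f \<omega> + normalized_sum B g \<omega> = normalized_sum B (\<lambda>x. f x + g x) \<omega>"
  by (simp add: normalized_sum_def sum.distrib add_divide_distrib)

lemma covariance_site_le:
  assumes "f \<in> observables"
  shows "\<bar>\<integral>\<omega>. f (X i \<omega>) * f (X j \<omega>) \<partial>M\<bar> \<le> corr i j * (norm0 f)\<^sup>2"
proof -
  have f: "f \<in> borel_measurable S" using assms by (simp add: observables_def)
  have "\<bar>\<integral>\<omega>. f (X i \<omega>) * f (X j \<omega>) \<partial>M\<bar> \<le>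
      corr i j * L2_norm M (\<lambda>\<omega>. f (X i \<omega>)) * L2_norm M (\<lambda>\<omega>. f (X j \<omega>))"
    by (intro covariance_le observables_site[OF assms] observable_site[OF f])
  then show ?thesis
    unfolding observable_site(3)[OF f, of i] observable_site(3)[OF f, of j]
    by (simp add: power2_eq_square mult.assoc)
qed

lemma var_sum_eq:
  assumes "f \<in> observables"
  shows "var_sum B f = (\<Sum>i\<in>B. \<Sum>j\<in>B. \<integral>\<omega>. f (X i \<omega>) * f (X j \<omega>) \<partial>M) / card B"
proof -
  have "(\<integral>\<omega>. (normalized_sum B f \<omega>)\<^sup>2 \<partial>M) = (\<integral>\<omega>. (\<Sum>i\<in>B. \<Sum>j\<in>B. f (X i \<omega>) * f (X j \<omega>)) / card B \<partial>M)"
    by (simp add: normalized_sum_def power_divide power2_eq_square sum_product)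
  also have "\<dots> = (\<Sum>i\<in>B. \<Sum>j\<in>B. \<integral>\<omega>. f (X i \<omega>) * f (X j \<omega>) \<partial>M) / card B"
    using L2_integrable_mult[OF observables_site(1)[OF assms] observables_site(1)[OF assms]] by simp
  finally show ?thesis .
qed

text \<open>Each row of covariances sums to at most \<open>total_corr\<close> times the squared
  norm. Uniformity in \<open>B\<close> is the point: an L2-small change of the observable is an
  L2-small change of all normalized sums.\<close>

lemma normalized_sum_norm_le:
  assumes "f \<in> observables" "finite B"
  shows "L2_norm M (normalized_sum B f) \<le> sqrt total_corr * norm0 f"
proof -
  have "var_sum B f \<le> (\<Sum>i\<in>B. total_corr * (norm0 f)\<^sup>2) / card B"
    unfolding var_sum_eq[OF assms(1)]
  proof (intro divide_right_mono sum_mono)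
    fix i
    have "(\<Sum>j\<in>B. \<integral>\<omega>. f (X i \<omega>) * f (X j \<omega>) \<partial>M) \<le> (\<Sum>j\<in>B. corr i j * (norm0 f)\<^sup>2)"
      using covariance_site_le[OF assms(1)] by (intro sum_mono) (meson abs_le_D1)
    also have "\<dots> = (\<Sum>j\<in>B. corr i j) * (norm0 f)\<^sup>2" by (simp add: sum_distrib_right)
    also have "\<dots> \<le> total_corr * (norm0 f)\<^sup>2"
      by (intro mult_right_mono sum_corr_le assms) auto
    finally show "(\<Sum>j\<in>B. \<integral>\<omega>. f (X i \<omega>) * f (X j \<omega>) \<partial>M) \<le> total_corr * (norm0 f)\<^sup>2" .
  qed auto
  also have "\<dots> \<le> total_corr * (norm0 f)\<^sup>2"
    using total_corr_nonneg by (cases "card B = 0") auto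
  finally have "sqrt (var_sum B f) \<le> sqrt (total_corr * (norm0 f)\<^sup>2)" by (rule real_sqrt_le_mono)
  then show ?thesis by (simp add: L2_norm_def[of M "normalized_sum B f"] real_sqrt_mult)
qed

lemma centering:
  assumes "g \<in> borel_measurable S" "(\<lambda>\<omega>. g (X 0 \<omega>)) \<in> L2 M"
  defines "h \<equiv> \<lambda>x. g x - (\<integral>\<omega>. g (X 0 \<omega>) \<partial>M)"
  shows "h \<in> observables" "norm0 h \<le> norm0 g"
proof -
  let ?g = "\<lambda>\<omega>. g (X 0 \<omega>)" and ?m = "\<integral>\<omega>. g (X 0 \<omega>) \<partial>M"
  note i = L2_integrable[OF assms(2)]
  have i2: "integrable M (\<lambda>\<omega>. (?g \<omega>)\<^sup>2)" using assms(2) by (simp add: L2_def)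
  have "(\<lambda>\<omega>. ?g \<omega> - ?m) \<in> L2 M"
    using assms(2) by (intro L2_diff) (simp_all add: L2_def)
  then show "h \<in> observables"
    using assms(1) i by (simp add: observables_def L2_def h_def prob_space)
  have "(\<integral>\<omega>. (h (X 0 \<omega>))\<^sup>2 \<partial>M) = (\<integral>\<omega>. (?g \<omega>)\<^sup>2 \<partial>M) - ?m\<^sup>2"
    unfolding h_def by (rule variance_eq[OF i i2])
  then show "norm0 h \<le> norm0 g"
    unfolding L2_norm_def by (intro real_sqrt_le_mono) simp
qed

text \<open>Clipping converges in L2 by dominated convergence but destroys centring; subtracting the
  mean restores it without enlarging the norm of \<open>h\<close> or of the error.\<close>

lemma truncation:
  assumes f: "f \<in> observables" and "0 < \<delta>"
  obtains h b where "h \<in> observables" "\<And>x. \<bar>h x\<bar> \<le> b" "norm0 (\<lambda>x. f x - h x) \<le> \<delta>" "norm0 h \<le> norm0 f"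
proof -
  have [measurable]: "f \<in> borel_measurable S" "X 0 \<in> measurable M S"
    and f2: "integrable M (\<lambda>\<omega>. (f (X 0 \<omega>))\<^sup>2)"
    using f by (auto simp: observables_def)
  define g where "g = (\<lambda>n x. max (- real n) (min (real n) (f x)))"
  have [measurable]: "g n \<in> borel_measurable S" for n unfolding g_def by measurable
  have le: "\<bar>g n x\<bar> \<le> \<bar>f x\<bar>" "\<bar>f x - g n x\<bar> \<le> \<bar>f x\<bar>" "\<bar>g n x\<bar> \<le> real n" for n x
    by (auto simp: g_def max_def min_def)
  have fL: "(\<lambda>\<omega>. f (X 0 \<omega>)) \<in> L2 M" by (rule observables_site[OF f])
  have gL: "(\<lambda>\<omega>. g n (X 0 \<omega>)) \<in> L2 M" "norm0 (g n) \<le> norm0 f" for n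
    by (intro L2_norm_mono[OF _ fL] le; measurable)+
  have dL: "(\<lambda>\<omega>. f (X 0 \<omega>) - g n (X 0 \<omega>)) \<in> L2 M" for n by (intro L2_diff fL gL)
  have "(\<lambda>n. \<integral>\<omega>. (f (X 0 \<omega>) - g n (X 0 \<omega>))\<^sup>2 \<partial>M) \<longlonglongrightarrow> (\<integral>\<omega>. 0 \<partial>M)"
  proof (rule integral_dominated_convergence)
    show "AE \<omega> in M. (\<lambda>n. (f (X 0 \<omega>) - g n (X 0 \<omega>))\<^sup>2) \<longlonglongrightarrow> 0"
    proof (rule AE_I2)
      fix \<omega>
      obtain N where "\<bar>f (X 0 \<omega>)\<bar> \<le> real N" using real_arch_simple by blast
      then have "eventually (\<lambda>n. (f (X 0 \<omega>) - g n (X 0 \<omega>))\<^sup>2 = 0) sequentially"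
        by (intro eventually_sequentiallyI[of N]) (auto simp: g_def max_def min_def)
      then show "(\<lambda>n. (f (X 0 \<omega>) - g n (X 0 \<omega>))\<^sup>2) \<longlonglongrightarrow> 0" by (rule tendsto_eventually)
    qed
    show "AE \<omega> in M. norm ((f (X 0 \<omega>) - g n (X 0 \<omega>))\<^sup>2) \<le> (f (X 0 \<omega>))\<^sup>2" for n
    proof (rule AE_I2)
      fix \<omega>
      show "norm ((f (X 0 \<omega>) - g n (X 0 \<omega>))\<^sup>2) \<le> (f (X 0 \<omega>))\<^sup>2"
        using power_mono[OF le(2)[of "X 0 \<omega>" n], of 2] by simp
    qed
  qed (use f2 in measurable)
  then have "(\<lambda>n. norm0 (\<lambda>x. f x - g n x)) \<longlonglongrightarrow> sqrt 0"
    unfolding L2_norm_def by (intro tendsto_real_sqrt) simp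
  then have "eventually (\<lambda>n. norm0 (\<lambda>x. f x - g n x) < \<delta>) sequentially"
    using \<open>0 < \<delta>\<close> by (intro order_tendstoD(2)) auto
  then obtain n where n: "norm0 (\<lambda>x. f x - g n x) < \<delta>"
    unfolding eventually_sequentially by blast
  define m where "m = (\<integral>\<omega>. g n (X 0 \<omega>) \<partial>M)"
  define h where "h = (\<lambda>x. g n x - m)"
  have h: "h \<in> observables" "norm0 h \<le> norm0 f"
    using centering[OF _ gL(1), of n] gL(2)[of n] by (auto simp: h_def m_def)
  \<comment> \<open>Since \<open>f\<close> is centred, \<open>f - g n\<close> has mean
    \<open>- m\<close>, and \<open>f - h\<close> is exactly its centring.\<close>
  have "(\<integral>\<omega>. f (X 0 \<omega>) - g n (X 0 \<omega>) \<partial>M) = - m"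
    using f L2_integrable[OF fL] L2_integrable[OF gL(1)[of n]] by (simp add: observables_def m_def)
  then have "norm0 (\<lambda>x. f x - h x) \<le> norm0 (\<lambda>x. f x - g n x)"
    using centering(2)[of "\<lambda>x. f x - g n x"] dL[of n] by (simp add: h_def diff_diff_eq2 diff_add_eq)
  moreover have "\<bar>h x\<bar> \<le> real n + \<bar>m\<bar>" for x
    using le(3)[of n x] unfolding h_def by linarith
  ultimately show thesis using that h n by force
qed

end

section \<open>Convergence in law of normalized sums\<close>

text \<open>For \<open>v > 0\<close> the law is the image of the standard normal law under scaling
  by \<open>sqrt v\<close>; the Dirac mass is treated separately.\<close>

lemma char_gaussian_law:
  assumes "0 \<le> v"
  shows "real_distribution (gaussian_law v)" "char (gaussian_law v) t = complex_of_real (exp (- (v * t\<^sup>2 / 2)))"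
proof -
  have "real_distribution (gaussian_law v) \<and> char (gaussian_law v) t = complex_of_real (exp (- (v * t\<^sup>2 / 2)))"
  proof (cases "v = 0")
    case True
    interpret prob_space "return borel (0::real)" by (rule prob_space_return) simp
    show ?thesis
      using True by (simp add: gaussian_law_def char_def real_distribution_def real_distribution_axioms_def
          prob_space_axioms integral_return)
  next
    case False
    define s where "s = sqrt v"
    have s: "0 < s" "s\<^sup>2 = v" using assms False by (auto simp: s_def)
    interpret N: prob_space std_normal_distribution by (rule prob_space_normal_density) simp
    have "distributed std_normal_distribution lborel (\<lambda>x. x) std_normal_density"
      by (simp add: distributed_def distr_id2)
    from N.normal_density_affine[OF this, of s 0] s
    have d: "distributed std_normal_distribution lborel (\<lambda>x. s * x) (normal_density 0 s)" by simp
    have eq: "gaussian_law v = distr std_normal_distribution lborel (\<lambda>x. s * x)"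
      using distributed_distr_eq_density[OF d] False by (simp add: gaussian_law_def s_def)
    have "real_distribution (gaussian_law v)"
      unfolding eq real_distribution_def real_distribution_axioms_def
      by (auto intro!: N.prob_space_distr)
    moreover have "char (gaussian_law v) t = char std_normal_distribution (t * s)"
      unfolding eq char_def by (subst integral_distr) (auto simp: mult_ac)
    ultimately show ?thesis
      using s by (simp add: char_std_normal_distribution power_mult_distrib mult.commute)
  qed
  then show "real_distribution (gaussian_law v)" "char (gaussian_law v) t = complex_of_real (exp (- (v * t\<^sup>2 / 2)))"
    by auto
qed

lemma exp_minus_diff_le: "\<bar>exp (- x) - exp (- y)\<bar> \<le> \<bar>x - y\<bar>" if "0 \<le> x" "0 \<le> y" for x y :: real
proof -
  have "norm (exp (- x) - exp (- y)) \<le> 1 * norm (x - y)"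
    by (rule field_differentiable_bound[of "{0..}" _ "\<lambda>x. - exp (- x)"])
      (use that in \<open>auto intro!: derivative_eq_intros\<close>)
  then show ?thesis by simp
qed

section \<open>Boxes in the lattice and their translates\<close>

lemma card_vec_set:
  fixes A :: "'n::finite \<Rightarrow> 'a set"
  assumes "\<And>k. finite (A k)"
  shows "finite {v :: 'a ^ 'n. \<forall>k. v $ k \<in> A k}" "card {v :: 'a ^ 'n. \<forall>k. v $ k \<in> A k} = (\<Prod>k\<in>UNIV. card (A k))"
proof -
  have bij: "bij_betw vec_lambda (PiE UNIV A) {v :: 'a ^ 'n. \<forall>k. v $ k \<in> A k}"
    by (rule bij_betw_byWitness[of _ vec_nth]) (auto simp: vec_lambda_inverse)
  show "finite {v :: 'a ^ 'n. \<forall>k. v $ k \<in> A k}"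
    using bij_betw_finite[OF bij] finite_PiE[of UNIV A] assms by simp
  show "card {v :: 'a ^ 'n. \<forall>k. v $ k \<in> A k} = (\<Prod>k\<in>UNIV. card (A k))"
    using bij_betw_same_card[OF bij] card_PiE[of UNIV A] by simp
qed

definition int_box :: "nat \<Rightarrow> (int ^ 'n::finite) set" where
  "int_box l = {i. \<forall>k. 0 \<le> i $ k \<and> i $ k < int l}"

lemma int_box: "finite (int_box l :: (int ^ 'n::finite) set)" "card (int_box l :: (int ^ 'n) set) = l ^ CARD('n)"
  using card_vec_set[of "\<lambda>k::'n. {0..<int l}"] by (auto simp: int_box_def)

text \<open>The overlap is a product of intervals of lengths \<open>l - \<bar>z $ k\<bar>\<close>,
  truncated at 0 by \<open>nat\<close>. Each length divided by \<open>l\<close> tends to 1: the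
  boundary of a box is negligible.\<close>

lemma int_box_overlap:
  fixes z :: "int ^ 'n::finite"
  shows "(\<lambda>l. real (card {i \<in> int_box l. i + z \<in> int_box l}) / card (int_box l :: (int ^ 'n) set)) \<longlonglongrightarrow> 1"
proof -
  have card: "card {i \<in> int_box l. i + z \<in> int_box l} = (\<Prod>k\<in>UNIV. nat (int l - \<bar>z $ k\<bar>))" for l
  proof -
    have "{i \<in> int_box l. i + z \<in> int_box l} = {i. \<forall>k. i $ k \<in> {max 0 (- z $ k)..<min (int l) (int l - z $ k)}}"
    proof -
      have "x \<in> {max 0 (- a)..<min (int l) (int l - a)} \<longleftrightarrow> (0 \<le> x \<and> x < int l) \<and> 0 \<le> x + a \<and> x + a < int l" for x a
        by auto
      then show ?thesis by (auto simp: int_box_def)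
    qed
    then show ?thesis
      using card_vec_set(2)[of "\<lambda>k. {max 0 (- z $ k)..<min (int l) (int l - z $ k)}"]
      by (auto intro!: prod.cong)
  qed
  have "(\<lambda>l. \<Prod>k\<in>(UNIV :: 'n set). real (nat (int l - \<bar>z $ k\<bar>)) / real l) \<longlonglongrightarrow> (\<Prod>k\<in>(UNIV :: 'n set). 1)"
  proof (rule tendsto_prod)
    fix k :: 'n
    have "(\<lambda>l. 1 - real_of_int \<bar>z $ k\<bar> / real l) \<longlonglongrightarrow> 1 - 0"
      by (intro tendsto_intros lim_const_over_n)
    moreover have "eventually (\<lambda>l. 1 - real_of_int \<bar>z $ k\<bar> / real l = real (nat (int l - \<bar>z $ k\<bar>)) / real l) sequentially"
    proof (rule eventually_sequentiallyI)
      \<comment> \<open>This threshold removes the truncation of \<open>nat\<close> and also ensures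
        \<open>l \<noteq> 0\<close> for the division.\<close>
      fix l assume l: "nat \<bar>z $ k\<bar> + 1 \<le> l"
      then have "real (nat (int l - \<bar>z $ k\<bar>)) = real l - real_of_int \<bar>z $ k\<bar>" by (simp add: of_nat_nat)
      then show "1 - real_of_int \<bar>z $ k\<bar> / real l = real (nat (int l - \<bar>z $ k\<bar>)) / real l"
        using l by (simp add: diff_divide_distrib)
    qed
    ultimately show "(\<lambda>l. real (nat (int l - \<bar>z $ k\<bar>)) / real l) \<longlonglongrightarrow> 1"
      by (simp add: Lim_transform_eventually)
  qed
  then show ?thesis
    by (simp add: card int_box prod_dividef flip: of_nat_prod)
qed

context stationary_field
begin

text \<open>The order of choices matters: \<open>e\<close> fixes \<open>\<eta>\<close>,
  \<open>\<eta>\<close> fixes the neighbourhood \<open>R\<close>, and \<open>R\<close> fixes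
  \<open>\<kappa>\<close>. None of them depends on \<open>B\<close>, so
  \<open>\<kappa> / sqrt (card B)\<close> vanishes for growing sets.\<close>

lemma cos_normalized_sum_bounded_observable:
  assumes sr: "short_range_field M S X total_corr col m"
    and h: "h \<in> observables" "\<And>x. \<bar>h x\<bar> \<le> b" and e: "0 < e"
  obtains \<kappa> where "\<And>B. finite B \<Longrightarrow> B \<noteq> {} \<Longrightarrow>
    \<bar>(\<integral>\<omega>. cos (\<theta> + t * normalized_sum B h \<omega>) \<partial>M) - cos \<theta> * exp (- (var_sum B h * t\<^sup>2 / 2))\<bar>
    \<le> e + \<kappa> / sqrt (card B)"
proof -
  interpret sr: short_range_field M S X total_corr col m by fact
  define C where "C = \<bar>t\<bar> * (\<bar>t\<bar> * (b\<^sup>2 * (1 + sr.infl_const)))"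
  have C: "0 \<le> C"
    unfolding C_def using sr.infl_const_ge_1 by (intro mult_nonneg_nonneg) auto
  \<comment> \<open>The summand 1 in the denominator keeps \<open>\<eta>\<close> defined and
    positive when \<open>C = 0\<close>, for instance at \<open>t = 0\<close>.\<close>
  define \<eta> where "\<eta> = e / (C + 1)"
  have \<eta>: "0 < \<eta>" "C * \<eta> \<le> e"
    using C e by (auto simp: \<eta>_def field_simps)
  obtain R where R: "finite R" "0 \<in> R"
    "\<And>j U. finite U \<Longrightarrow> (\<And>k. k \<in> U \<Longrightarrow> k - j \<notin> R) \<Longrightarrow> (\<Sum>k\<in>U. corr j k) \<le> \<eta>"
    using corr_tail[OF \<eta>(1)] by blast
  define \<kappa> where "\<kappa> = \<bar>t\<bar> * (t\<^sup>2 * (b ^ 3 * (4 * real (card R) * (1 + sr.infl_const * total_corr) + (real (card R))\<^sup>2)))"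
  have alg: "p * (p * (x * \<eta>) + y / s) = (p * (p * x)) * \<eta> + (p * y) / s" for p x y s :: real
    by (simp add: distrib_left mult.assoc)
  have hS: "h \<in> borel_measurable S" using h(1) by (simp add: observables_def)
  show thesis
  proof (rule that)
    fix B :: "'i set" assume B: "finite B" "B \<noteq> {}"
    have "\<bar>(\<integral>\<omega>. cos (\<theta> + t * normalized_sum B h \<omega>) \<partial>M) - cos \<theta> * exp (- (var_sum B h * t\<^sup>2 / 2))\<bar> \<le>
      \<bar>t\<bar> * (\<bar>t\<bar> * (b\<^sup>2 * (1 + sr.infl_const) * \<eta>) +
        t\<^sup>2 * (b ^ 3 * (4 * real (card R) * (1 + sr.infl_const * total_corr) + (real (card R))\<^sup>2)) / sqrt (card B))"
    proof (rule sr.cos_normalized_sum_bounded[where A = "\<lambda>i. (\<lambda>z. i + z) ` R"])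
      show "(\<lambda>\<omega>. h (X i \<omega>)) \<in> borel_measurable (\<H> {i})" for i by (rule observable_site(2)[OF hS])
      show "\<bar>h (X i \<omega>)\<bar> \<le> b" for i \<omega> by (rule h(2))
      show "(\<integral>\<omega>. h (X i \<omega>) \<partial>M) = 0" for i by (rule observables_site(2)[OF h(1)])
      show "i \<in> (\<lambda>z. i + z) ` R" for i using R(2) by (intro image_eqI[of _ _ 0]) auto
      show "card ((\<lambda>z. i + z) ` R) \<le> card R" for i by (rule card_image_le[OF R(1)])
      show "(\<Sum>k\<in>U. corr i k) \<le> \<eta>" if "finite U" "U \<inter> (\<lambda>z. i + z) ` R = {}" for i U
      proof (rule R(3)[OF that(1)])
        show "k - i \<notin> R" if "k \<in> U" for k
          using that \<open>U \<inter> (\<lambda>z. i + z) ` R = {}\<close> image_eqI[of k "\<lambda>z. i + z" "k - i" R] by auto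
      qed
    qed (use R B in \<open>auto simp: normalized_sum_def\<close>)
    also have "\<dots> = C * \<eta> + \<kappa> / sqrt (card B)"
      unfolding C_def \<kappa>_def by (rule alg)
    also have "\<dots> \<le> e + \<kappa> / sqrt (card B)" using \<eta> by simp
    finally show "\<bar>(\<integral>\<omega>. cos (\<theta> + t * normalized_sum B h \<omega>) \<partial>M) - cos \<theta> * exp (- (var_sum B h * t\<^sup>2 / 2))\<bar>
      \<le> e + \<kappa> / sqrt (card B)" .
  qed
qed

text \<open>Both the expectation of the cosine and the Gaussian term depend continuously on the
  observable in L2, uniformly in \<open>B\<close>. So the bounded case passes to \<open>f\<close>,
  with \<open>\<delta>\<close> chosen before \<open>B\<close>.\<close>

lemma cos_normalized_sum_observable:
  assumes sr: "short_range_field M S X total_corr col m" and f: "f \<in> observables" and e: "0 < e"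
  obtains \<kappa> where "\<And>B. finite B \<Longrightarrow> B \<noteq> {} \<Longrightarrow>
    \<bar>(\<integral>\<omega>. cos (\<theta> + t * normalized_sum B f \<omega>) \<partial>M) - cos \<theta> * exp (- (var_sum B f * t\<^sup>2 / 2))\<bar>
    \<le> e + \<kappa> / sqrt (card B)"
proof -
  \<comment> \<open>The two summands are the costs, per unit of \<open>\<delta>\<close>, of
    replacing \<open>f\<close> by \<open>h\<close> in the cosine and in the variance. As
    \<open>norm0 h\<close> is bounded by \<open>norm0 f\<close>, \<open>C\<close> is independent of
    the truncation and \<open>\<delta>\<close> can be defined from it.\<close>
  define C where "C = \<bar>t\<bar> * sqrt total_corr + t\<^sup>2 * total_corr * norm0 f"
  have C: "0 \<le> C" unfolding C_def using total_corr_nonneg by simp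
  define \<delta> where "\<delta> = e / (2 * (C + 1))"
  have \<delta>: "0 < \<delta>" "C * \<delta> \<le> e / 2" using C e by (auto simp: \<delta>_def field_simps)
  obtain h b where h: "h \<in> observables" "\<And>x. \<bar>h x\<bar> \<le> b" "norm0 (\<lambda>x. f x - h x) \<le> \<delta>" "norm0 h \<le> norm0 f"
    using truncation[OF f \<delta>(1)] by blast
  have "0 < e / 2" using e by simp
  from cos_normalized_sum_bounded_observable[OF sr h(1,2) this, of \<theta> t] obtain \<kappa> where \<kappa>:
    "\<And>B. finite B \<Longrightarrow> B \<noteq> {} \<Longrightarrow>
      \<bar>(\<integral>\<omega>. cos (\<theta> + t * normalized_sum B h \<omega>) \<partial>M) - cos \<theta> * exp (- (var_sum B h * t\<^sup>2 / 2))\<bar>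
      \<le> e / 2 + \<kappa> / sqrt (card B)" by blast
  show thesis
  proof (rule that)
    fix B :: "'i set" assume B: "finite B" "B \<noteq> {}"
    let ?F = "normalized_sum B f" and ?H = "normalized_sum B h"
    let ?D = "\<lambda>\<omega>. ?F \<omega> - ?H \<omega>"
    note FL = normalized_sum_L2[OF f, of B] and HL = normalized_sum_L2[OF h(1), of B]
    have [measurable]: "?F \<in> borel_measurable M" "?H \<in> borel_measurable M"
      using FL HL by (auto dest: L2_measurable)
    have DL: "?D \<in> L2 M" by (rule L2_diff[OF FL HL])
    have D: "L2_norm M ?D \<le> sqrt total_corr * \<delta>"
    proof -
      have "L2_norm M ?D \<le> sqrt total_corr * norm0 (\<lambda>x. f x - h x)"
        unfolding normalized_sum_diff by (rule normalized_sum_norm_le[OF observables_diff[OF f h(1)] B(1)])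
      also have "\<dots> \<le> sqrt total_corr * \<delta>" using h(3) total_corr_nonneg by (intro mult_left_mono) auto
      finally show ?thesis .
    qed
    have "norm0 (\<lambda>x. f x + h x) \<le> 2 * norm0 f"
    proof -
      note s = observables_site(1)[OF f, of 0] observables_site(1)[OF h(1), of 0]
      have "(\<integral>\<omega>. (f (X 0 \<omega>) + h (X 0 \<omega>))\<^sup>2 \<partial>M) \<le> (\<integral>\<omega>. 2 * (f (X 0 \<omega>))\<^sup>2 + 2 * (h (X 0 \<omega>))\<^sup>2 \<partial>M)"
      proof (rule integral_mono)
        show "integrable M (\<lambda>\<omega>. (f (X 0 \<omega>) + h (X 0 \<omega>))\<^sup>2)"
          using L2_add[OF s] by (simp add: L2_def)
        show "integrable M (\<lambda>\<omega>. 2 * (f (X 0 \<omega>))\<^sup>2 + 2 * (h (X 0 \<omega>))\<^sup>2)"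
          using s by (simp add: L2_def)
        show "(f (X 0 \<omega>) + h (X 0 \<omega>))\<^sup>2 \<le> 2 * (f (X 0 \<omega>))\<^sup>2 + 2 * (h (X 0 \<omega>))\<^sup>2" for \<omega>
          using sum_squares_bound[of "f (X 0 \<omega>)" "h (X 0 \<omega>)"] by (simp add: power2_sum)
      qed
      also have "\<dots> = 2 * (norm0 f)\<^sup>2 + 2 * (norm0 h)\<^sup>2"
        using s by (simp add: L2_norm_power2 L2_def)
      also have "\<dots> \<le> (2 * norm0 f)\<^sup>2"
        using power_mono[OF h(4), of 2] by simp
      finally show ?thesis
        unfolding L2_norm_power2[symmetric, of M "\<lambda>\<omega>. f (X 0 \<omega>) + h (X 0 \<omega>)"]
        by (rule power2_le_imp_le) simp
    qed
    then have S: "L2_norm M (\<lambda>\<omega>. ?F \<omega> + ?H \<omega>) \<le> sqrt total_corr * (2 * norm0 f)"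
      unfolding normalized_sum_add
      using normalized_sum_norm_le[OF observables_add[OF f h(1)] B(1)] total_corr_nonneg
      by (meson mult_left_mono order_trans real_sqrt_ge_zero)
    have var: "\<bar>var_sum B f - var_sum B h\<bar> \<le> 2 * total_corr * norm0 f * \<delta>"
    proof -
      \<comment> \<open>Difference of squares: one factor is small by truncation, the other merely
        bounded.\<close>
      have "var_sum B f - var_sum B h = (\<integral>\<omega>. ?D \<omega> * (?F \<omega> + ?H \<omega>) \<partial>M)"
        using FL HL by (subst Bochner_Integration.integral_diff[symmetric])
          (auto simp: L2_def power2_eq_square algebra_simps)
      also have "\<bar>\<dots>\<bar> \<le> L2_norm M ?D * L2_norm M (\<lambda>\<omega>. ?F \<omega> + ?H \<omega>)"
        by (rule L2_Cauchy_Schwarz[OF DL L2_add[OF FL HL]])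
      also have "\<dots> \<le> (sqrt total_corr * \<delta>) * (sqrt total_corr * (2 * norm0 f))"
        using \<delta>(1) total_corr_nonneg by (intro mult_mono D S) auto
      also have "\<dots> = (sqrt total_corr * sqrt total_corr) * (2 * norm0 f * \<delta>)"
        by (simp only: mult_ac)
      also have "\<dots> = 2 * total_corr * norm0 f * \<delta>"
        using total_corr_nonneg by simp
      finally show ?thesis .
    qed
    have cos: "\<bar>(\<integral>\<omega>. cos (\<theta> + t * ?F \<omega>) \<partial>M) - (\<integral>\<omega>. cos (\<theta> + t * ?H \<omega>) \<partial>M)\<bar> \<le> \<bar>t\<bar> * (sqrt total_corr * \<delta>)"
    proof -
      have i: "integrable M (\<lambda>\<omega>. cos (\<theta> + t * ?F \<omega>))" "integrable M (\<lambda>\<omega>. cos (\<theta> + t * ?H \<omega>))"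
        by (rule integrable_const_bound[of _ 1]; simp)+
      have dm: "(\<lambda>\<omega>. cos (\<theta> + t * ?F \<omega>) - cos (\<theta> + t * ?H \<omega>)) \<in> borel_measurable M" by measurable
      have le: "\<bar>cos (\<theta> + t * ?F \<omega>) - cos (\<theta> + t * ?H \<omega>)\<bar> \<le> \<bar>t * ?D \<omega>\<bar>" for \<omega>
        using cos_diff_le[of "\<theta> + t * ?F \<omega>" "\<theta> + t * ?H \<omega>"] by (simp add: right_diff_distrib)
      note dL = L2_norm_mono[OF dm L2_cmult[OF DL, of t] le]
      have "\<bar>(\<integral>\<omega>. cos (\<theta> + t * ?F \<omega>) \<partial>M) - (\<integral>\<omega>. cos (\<theta> + t * ?H \<omega>) \<partial>M)\<bar> \<le> \<bar>t\<bar> * L2_norm M ?D"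
        using abs_integral_le_L2_norm[OF dL(1)] dL(2) i by (simp add: L2_norm_cmult)
      also have "\<dots> \<le> \<bar>t\<bar> * (sqrt total_corr * \<delta>)" by (intro mult_left_mono D) simp
      finally show ?thesis .
    qed
    have exp: "\<bar>cos \<theta> * exp (- (var_sum B f * t\<^sup>2 / 2)) - cos \<theta> * exp (- (var_sum B h * t\<^sup>2 / 2))\<bar>
      \<le> t\<^sup>2 * total_corr * norm0 f * \<delta>"
    proof -
      have "\<bar>exp (- (var_sum B f * t\<^sup>2 / 2)) - exp (- (var_sum B h * t\<^sup>2 / 2))\<bar>
          \<le> \<bar>var_sum B f * t\<^sup>2 / 2 - var_sum B h * t\<^sup>2 / 2\<bar>"
        by (rule exp_minus_diff_le) auto
      also have "\<dots> = t\<^sup>2 / 2 * \<bar>var_sum B f - var_sum B h\<bar>"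
        by (simp add: abs_mult flip: diff_divide_distrib left_diff_distrib)
      also have "\<dots> \<le> t\<^sup>2 / 2 * (2 * total_corr * norm0 f * \<delta>)"
        by (intro mult_left_mono var) simp
      finally have "\<bar>cos \<theta>\<bar> * \<bar>exp (- (var_sum B f * t\<^sup>2 / 2)) - exp (- (var_sum B h * t\<^sup>2 / 2))\<bar>
          \<le> 1 * (t\<^sup>2 / 2 * (2 * total_corr * norm0 f * \<delta>))"
        by (intro mult_mono) auto
      then show ?thesis by (simp add: abs_mult flip: right_diff_distrib)
    qed
    have "\<bar>t\<bar> * (sqrt total_corr * \<delta>) + t\<^sup>2 * total_corr * norm0 f * \<delta> \<le> e / 2"
      using \<delta>(2) by (simp add: C_def algebra_simps)
    then show "\<bar>(\<integral>\<omega>. cos (\<theta> + t * ?F \<omega>) \<partial>M) - cos \<theta> * exp (- (var_sum B f * t\<^sup>2 / 2))\<bar> \<le> e + \<kappa> / sqrt (card B)"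
      using \<kappa>[OF B] cos exp by linarith
  qed
qed

lemma real_distribution_normalized_sum:
  "f \<in> observables \<Longrightarrow> real_distribution (distr M borel (normalized_sum B f))"
  by (rule real_distribution_distr) (rule L2_measurable[OF normalized_sum_L2])

text \<open>Convergence of the variances turns the approximation by Gaussians of varying variance
  into pointwise convergence of characteristic functions; Levy's continuity theorem
  concludes.\<close>

lemma normalized_sum_weak_conv:
  assumes sr: "short_range_field M S X total_corr col m" and f: "f \<in> observables"
    and B: "\<And>n. finite (B n)" "filterlim (\<lambda>n. real (card (B n))) at_top sequentially"
    and v: "(\<lambda>n. var_sum (B n) f) \<longlonglongrightarrow> v"
  shows "weak_conv_m (\<lambda>n. distr M borel (normalized_sum (B n) f)) (gaussian_law v)"
proof -
  have v0: "0 \<le> v" by (rule LIMSEQ_le_const[OF v]) simp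
  have conv: "(\<lambda>n. \<integral>\<omega>. cos (\<theta> + t * normalized_sum (B n) f \<omega>) \<partial>M) \<longlonglongrightarrow> cos \<theta> * exp (- (v * t\<^sup>2 / 2))" for \<theta> t
  proof (rule LIMSEQ_I)
    fix e :: real assume e: "0 < e"
    then have "0 < e / 3" by simp
    from cos_normalized_sum_observable[OF sr f this, of \<theta> t] obtain \<kappa> where \<kappa>: "\<And>B. finite B \<Longrightarrow> B \<noteq> {} \<Longrightarrow>
      \<bar>(\<integral>\<omega>. cos (\<theta> + t * normalized_sum B f \<omega>) \<partial>M) - cos \<theta> * exp (- (var_sum B f * t\<^sup>2 / 2))\<bar>
      \<le> e / 3 + \<kappa> / sqrt (card B)" by blast
    have "((\<lambda>n. \<kappa> / sqrt (card (B n))) \<longlongrightarrow> 0) sequentially"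
      by (intro tendsto_divide_0[OF tendsto_const] filterlim_at_top_imp_at_infinity
          filterlim_compose[OF sqrt_at_top B(2)])
    then have 1: "eventually (\<lambda>n. \<kappa> / sqrt (card (B n)) < e / 3) sequentially"
      using e by (intro order_tendstoD(2)) auto
    have "(\<lambda>n. cos \<theta> * exp (- (var_sum (B n) f * t\<^sup>2 / 2))) \<longlonglongrightarrow> cos \<theta> * exp (- (v * t\<^sup>2 / 2))"
      by (intro tendsto_intros v) auto
    then have 2: "eventually (\<lambda>n. dist (cos \<theta> * exp (- (var_sum (B n) f * t\<^sup>2 / 2))) (cos \<theta> * exp (- (v * t\<^sup>2 / 2))) < e / 3) sequentially"
      using e by (intro tendstoD) auto
    have 3: "eventually (\<lambda>n. 1 \<le> real (card (B n))) sequentially"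
      by (rule B(2)[unfolded filterlim_at_top, rule_format])
    have "eventually (\<lambda>n. norm ((\<integral>\<omega>. cos (\<theta> + t * normalized_sum (B n) f \<omega>) \<partial>M) - cos \<theta> * exp (- (v * t\<^sup>2 / 2))) < e) sequentially"
      using 1 2 3
    proof eventually_elim
      case (elim n)
      then have "B n \<noteq> {}" by auto
      from \<kappa>[OF B(1) this] elim show ?case unfolding dist_real_def real_norm_def by linarith
    qed
    then show "\<exists>N. \<forall>n\<ge>N. norm ((\<integral>\<omega>. cos (\<theta> + t * normalized_sum (B n) f \<omega>) \<partial>M) - cos \<theta> * exp (- (v * t\<^sup>2 / 2))) < e"
      by (simp add: eventually_sequentially)
  qed
  show ?thesis
  proof (rule levy_continuity)
    show "real_distribution (distr M borel (normalized_sum (B n) f))" for n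
      by (rule real_distribution_normalized_sum[OF f])
    show "real_distribution (gaussian_law v)" by (rule char_gaussian_law[OF v0])
    fix t
    \<comment> \<open>Phase 0 gives the real part and phase -pi/2 the imaginary part. The latter
      tends to 0 because the limit carries the factor \<open>cos (- (pi / 2))\<close>.\<close>
    have char: "char (distr M borel (normalized_sum (B n) f)) t = Complex (\<integral>\<omega>. cos (0 + t * normalized_sum (B n) f \<omega>) \<partial>M)
        (\<integral>\<omega>. cos (- (pi / 2) + t * normalized_sum (B n) f \<omega>) \<partial>M)" for n
    proof -
      have [measurable]: "normalized_sum (B n) f \<in> borel_measurable M"
        by (rule L2_measurable[OF normalized_sum_L2[OF f]])
      have i: "integrable M (\<lambda>\<omega>. iexp (t * normalized_sum (B n) f \<omega>))"
        by (rule integrable_const_bound[of _ 1]) auto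
      have "char (distr M borel (normalized_sum (B n) f)) t = (\<integral>\<omega>. iexp (t * normalized_sum (B n) f \<omega>) \<partial>M)"
        unfolding char_def by (rule integral_distr) auto
      moreover have "cos (x - pi / 2) = sin x" for x :: real
        by (simp add: cos_diff)
      ultimately show ?thesis
        using i by (simp add: complex_eq_iff Re_exp Im_exp flip: integral_Re integral_Im)
    qed
    show "(\<lambda>n. char (distr M borel (normalized_sum (B n) f)) t) \<longlonglongrightarrow> char (gaussian_law v) t"
      unfolding char char_gaussian_law(2)[OF v0]
      using tendsto_Complex[OF conv[of 0 t] conv[of "- (pi / 2)" t]] by (simp add: complex_of_real_def)
  qed
qed

end

section \<open>Fields on the lattice\<close>

locale lattice_field = stationary_field M S X
  for M :: "'a measure" and S :: "'b measure" and X :: "int ^ 'n::finite \<Rightarrow> 'a \<Rightarrow> 'b"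
begin

text \<open>Sites are coloured by their coordinates modulo \<open>p\<close>. Distinct sites of equal
  colour differ by a nonzero multiple of \<open>p\<close> in some coordinate, too far for their
  displacement to lie in \<open>R\<close>; so the sum over a colour class is a tail.\<close>

lemma colouring:
  obtains col m where "short_range_field M S X total_corr col m"
proof -
  have "(0::real) < 1 / 2" by simp
  from corr_tail[OF this] obtain R where R: "finite R" "0 \<in> R"
    "\<And>j U. finite U \<Longrightarrow> (\<And>k. k \<in> U \<Longrightarrow> k - j \<notin> R) \<Longrightarrow> (\<Sum>k\<in>U. corr j k) \<le> 1 / 2" by blast
  \<comment> \<open>A crude bound exceeding the absolute value of every coordinate of every element
    of \<open>R\<close>; the summand 1 makes it strict and keeps the modulus positive.\<close>
  define p where "p = 1 + (\<Sum>z\<in>R. \<Sum>a\<in>UNIV. \<bar>z $ a\<bar>)"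
  have p: "0 < p" unfolding p_def by (intro add_pos_nonneg sum_nonneg) auto
  have p_R: "\<bar>z $ a\<bar> < p" if "z \<in> R" for z a
  proof -
    have "\<bar>z $ a\<bar> \<le> (\<Sum>a\<in>UNIV. \<bar>z $ a\<bar>)" by (rule member_le_sum) auto
    also have "\<dots> \<le> (\<Sum>z\<in>R. \<Sum>a\<in>UNIV. \<bar>z $ a\<bar>)"
      using that R(1) by (intro member_le_sum[of z R "\<lambda>z. \<Sum>a\<in>UNIV. \<bar>z $ a\<bar>"] sum_nonneg) auto
    finally show ?thesis by (simp add: p_def)
  qed
  define V where "V = {v :: int ^ 'n. \<forall>a. v $ a \<in> {0..<p}}"
  have "finite V" unfolding V_def by (rule card_vec_set(1)) simp
  then obtain m and enc :: "int ^ 'n \<Rightarrow> nat" where enc: "enc ` V = {i. i < m}" "inj_on enc V"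
    using finite_imp_inj_to_nat_seg by blast
  define red where "red = (\<lambda>j :: int ^ 'n. \<chi> a. j $ a mod p)"
  have red: "red j \<in> V" for j using p by (simp add: red_def V_def)
  have "short_range_field M S X total_corr (\<lambda>j. enc (red j)) m"
  proof unfold_locales
    show "(\<Sum>k\<in>U. corr j k) \<le> total_corr" if "finite U" for j U by (rule sum_corr_le[OF that])
    show "enc (red j) < m" for j using red[of j] enc(1) by blast
    show "(\<Sum>k\<in>U. corr j k) \<le> 1 / 2" if U: "finite U" "\<And>k. k \<in> U \<Longrightarrow> k \<noteq> j \<and> enc (red k) = enc (red j)" for j U
    proof (rule R(3)[OF U(1)])
      fix k assume "k \<in> U"
      then have k: "k \<noteq> j" "red k = red j"
        using U(2) inj_onD[OF enc(2) _ red red] by auto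
      obtain a where a: "k $ a \<noteq> j $ a" using k(1) by (auto simp: vec_eq_iff)
      have "k $ a mod p = j $ a mod p" using k(2) by (simp add: red_def vec_eq_iff)
      then have "p dvd (k - j) $ a" by (simp add: mod_eq_dvd_iff)
      moreover have "(k - j) $ a \<noteq> 0" using a by simp
      ultimately have "p \<le> \<bar>(k - j) $ a\<bar>" using p by (metis dvd_imp_le_int abs_of_pos)
      then show "k - j \<notin> R" using p_R[of "k - j" a] by auto
    qed
  qed
  then show thesis by (rule that)
qed

text \<open>Grouping pairs of sites by displacement \<open>z\<close> gives the covariance
  \<open>c z\<close> weighted by the overlap ratio of the box with its translate, which tends to 1.
  Distant displacements are uniformly negligible, and the limit is the sum of all
  \<open>c z\<close>.\<close>

lemma var_sum_int_box:
  assumes f: "f \<in> observables"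
  shows "\<exists>v. (\<lambda>l. var_sum (int_box l) f) \<longlonglongrightarrow> v"
proof -
  define c where "c = (\<lambda>z. \<integral>\<omega>. f (X 0 \<omega>) * f (X z \<omega>) \<partial>M)"
  define s where "s = (norm0 f)\<^sup>2"
  have s: "0 \<le> s" by (simp add: s_def)
  have fS: "f \<in> borel_measurable S" using f by (simp add: observables_def)
  have c_le: "\<bar>c z\<bar> \<le> corr 0 z * s" for z
    unfolding c_def s_def by (rule covariance_site_le[OF f])
  have cij: "(\<integral>\<omega>. f (X i \<omega>) * f (X j \<omega>) \<partial>M) = c (j - i)" for i j
    unfolding c_def by (rule distr_two_sites[OF fS])
  have "(\<lambda>z. corr 0 z * s) summable_on UNIV"
    by (rule summable_on_cmult_left[OF summable_corr])
  then have "(\<lambda>z. norm (c z)) summable_on UNIV"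
    by (rule summable_on_comparison_test) (use c_le in auto)
  then have c_sum: "(c has_sum infsum c UNIV) UNIV"
    by (rule has_sum_infsum[OF abs_summable_summable])
  have "(\<lambda>l. var_sum (int_box l) f) \<longlonglongrightarrow> infsum c UNIV"
  proof (rule LIMSEQ_I)
    fix e :: real assume e: "0 < e"
    define \<eta> where "\<eta> = e / (3 * (s + 1))"
    have \<eta>: "0 < \<eta>" "\<eta> * s \<le> e / 3" using e s by (auto simp: \<eta>_def field_simps)
    obtain R0 where R0: "finite R0" "0 \<in> R0"
      "\<And>j U. finite U \<Longrightarrow> (\<And>k. k \<in> U \<Longrightarrow> k - j \<notin> R0) \<Longrightarrow> (\<Sum>k\<in>U. corr j k) \<le> \<eta>"
      using corr_tail[OF \<eta>(1)] by blast
    have "(sum c \<longlongrightarrow> infsum c UNIV) (finite_subsets_at_top UNIV)"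
      using c_sum by (simp add: has_sum_def)
    then have "eventually (\<lambda>F. dist (sum c F) (infsum c UNIV) < e / 3) (finite_subsets_at_top UNIV)"
      using e by (intro tendstoD) auto
    then obtain F0 where F0: "finite F0" "\<And>F. finite F \<Longrightarrow> F0 \<subseteq> F \<Longrightarrow> dist (sum c F) (infsum c UNIV) < e / 3"
      unfolding eventually_finite_subsets_at_top by auto
    \<comment> \<open>One finite set serves two purposes: containing \<open>R0\<close> makes the
      neglected covariances small, and containing \<open>F0\<close> makes the retained ones sum
      nearly to the limit.\<close>
    define R where "R = R0 \<union> F0"
    have R: "finite R" "dist (sum c R) (infsum c UNIV) < e / 3"
      using R0(1) F0(1) F0(2)[of R] by (auto simp: R_def)
    define w where "w = (\<lambda>l. \<Sum>z\<in>R. c z * (real (card {i \<in> int_box l. i + z \<in> int_box l}) / card (int_box l :: (int ^ 'n) set)))"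
    have "w \<longlonglongrightarrow> (\<Sum>z\<in>R. c z * 1)"
      unfolding w_def by (intro tendsto_sum tendsto_mult tendsto_const int_box_overlap)
    then have "eventually (\<lambda>l. dist (w l) (sum c R) < e / 3) sequentially"
      using e by (intro tendstoD) auto
    \<comment> \<open>This holds for every \<open>l\<close>, including \<open>l = 0\<close>, where
      the box is empty and division by zero makes both terms 0.\<close>
    moreover have "\<bar>var_sum (int_box l) f - w l\<bar> \<le> e / 3" for l
    proof -
      let ?B = "int_box l :: (int ^ 'n) set"
      note B = int_box(1)[where 'n='n, of l]
      have near: "(\<Sum>i\<in>?B. \<Sum>j\<in>{j\<in>?B. j - i \<in> R}. c (j - i)) = (\<Sum>z\<in>R. c z * card {i \<in> ?B. i + z \<in> ?B})"
      proof -
        have "(\<Sum>j\<in>{j\<in>?B. j - i \<in> R}. c (j - i)) = (\<Sum>z\<in>R. if i + z \<in> ?B then c z else 0)" for i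
        proof -
          have "(\<Sum>j\<in>{j\<in>?B. j - i \<in> R}. c (j - i)) = (\<Sum>z\<in>{z\<in>R. i + z \<in> ?B}. c z)"
            by (rule sum.reindex_bij_witness[of _ "\<lambda>z. i + z" "\<lambda>j. j - i"]) auto
          then show ?thesis by (simp add: sum.inter_filter[OF R(1)])
        qed
        then have "(\<Sum>i\<in>?B. \<Sum>j\<in>{j\<in>?B. j - i \<in> R}. c (j - i)) = (\<Sum>i\<in>?B. \<Sum>z\<in>R. if i + z \<in> ?B then c z else 0)"
          by simp
        also have "\<dots> = (\<Sum>z\<in>R. \<Sum>i\<in>?B. if i + z \<in> ?B then c z else 0)" by (rule sum.swap)
        also have "\<dots> = (\<Sum>z\<in>R. \<Sum>i\<in>{i\<in>?B. i + z \<in> ?B}. c z)"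
          by (simp only: sum.inter_filter[OF B])
        finally show ?thesis by (simp add: mult.commute)
      qed
      have far: "\<bar>\<Sum>j\<in>{j\<in>?B. j - i \<notin> R}. c (j - i)\<bar> \<le> e / 3" for i
      proof -
        have "\<bar>\<Sum>j\<in>{j\<in>?B. j - i \<notin> R}. c (j - i)\<bar> \<le> (\<Sum>j\<in>{j\<in>?B. j - i \<notin> R}. corr i j * s)"
          using c_le corr_translate by (intro order_trans[OF sum_abs sum_mono]) metis
        also have "\<dots> = (\<Sum>j\<in>{j\<in>?B. j - i \<notin> R}. corr i j) * s" by (simp add: sum_distrib_right)
        also have "\<dots> \<le> \<eta> * s" using B by (intro mult_right_mono R0(3) s) (auto simp: R_def)
        finally show ?thesis using \<eta>(2) by simp
      qed
      have split: "(\<Sum>j\<in>?B. c (j - i)) = (\<Sum>j\<in>{j\<in>?B. j - i \<in> R}. c (j - i)) + (\<Sum>j\<in>{j\<in>?B. j - i \<notin> R}. c (j - i))" for i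
        using sum.Int_Diff[OF B, of "\<lambda>j. c (j - i)" "{j. j - i \<in> R}"] by (simp add: Int_def set_diff_eq)
      have "var_sum ?B f - w l = (\<Sum>i\<in>?B. \<Sum>j\<in>{j\<in>?B. j - i \<notin> R}. c (j - i)) / card ?B"
        unfolding var_sum_eq[OF f] cij split sum.distrib near w_def
        by (simp add: add_divide_distrib sum_divide_distrib)
      also have "\<bar>\<dots>\<bar> \<le> (\<Sum>i\<in>?B. e / 3) / card ?B"
        unfolding abs_divide abs_of_nat
        by (intro divide_right_mono order_trans[OF sum_abs sum_mono[OF far]]) simp
      also have "\<dots> \<le> e / 3" using e by (cases "card ?B = 0") auto
      finally show ?thesis .
    qed
    ultimately have "eventually (\<lambda>l. norm (var_sum (int_box l) f - infsum c UNIV) < e) sequentially"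
    proof (elim eventually_mono)
      fix l assume "dist (w l) (sum c R) < e / 3" and v: "\<And>l. \<bar>var_sum (int_box l) f - w l\<bar> \<le> e / 3"
      with R(2) v[of l] show "norm (var_sum (int_box l) f - infsum c UNIV) < e"
        unfolding dist_real_def real_norm_def by linarith
    qed
    then show "\<exists>N. \<forall>l\<ge>N. norm (var_sum (int_box l) f - infsum c UNIV) < e"
      by (simp add: eventually_sequentially)
  qed
  then show ?thesis by blast
qed

lemma central_limit:
  assumes f: "f \<in> observables"
  shows "\<exists>v\<ge>0. weak_conv_m (\<lambda>l. distr M borel (normalized_sum (int_box l) f)) (gaussian_law v)"
proof -
  obtain col m where sr: "short_range_field M S X total_corr col m" by (rule colouring)
  obtain v where v: "(\<lambda>l. var_sum (int_box l) f) \<longlonglongrightarrow> v" using var_sum_int_box[OF f] by blast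
  have "filterlim (\<lambda>l. real (card (int_box l :: (int ^ 'n) set))) at_top sequentially"
  proof (rule filterlim_at_top_mono[OF filterlim_real_sequentially])
    \<comment> \<open>The index type of the coordinates is nonempty, so the exponent
      \<open>CARD('n)\<close> is at least 1.\<close>
    have "real l \<le> real (card (int_box l :: (int ^ 'n) set))" for l
      using self_le_power[of l "CARD('n)"] unfolding int_box(2)
      by (cases "l = 0") (auto simp flip: of_nat_power)
    then show "eventually (\<lambda>l. real l \<le> real (card (int_box l :: (int ^ 'n) set))) sequentially"
      by simp
  qed
  from normalized_sum_weak_conv[OF sr f int_box(1) this v]
  have "weak_conv_m (\<lambda>l. distr M borel (normalized_sum (int_box l) f)) (gaussian_law v)" .
  moreover have "0 \<le> v" by (rule LIMSEQ_le_const[OF v]) simp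
  ultimately show ?thesis by blast
qed

end

theorem theorem4p1p4:
  fixes M :: "'a measure" and S :: "'b measure"
    and X :: "(int ^ 'n::finite) \<Rightarrow> 'a \<Rightarrow> 'b" and f :: "'b \<Rightarrow> real" and i0 :: "int ^ 'n"
  assumes "prob_space M"
    and "\<And>i. X i \<in> measurable M S"
    and "translation_invariant M S X"
    and "(\<lambda>z. subj_corr_star M S X i0 (i0 + z)) summable_on UNIV"
    and "f \<in> borel_measurable S"
    and "integrable M (\<lambda>\<omega>. (f (X 0 \<omega>))\<^sup>2)"
    and "(\<integral>\<omega>. f (X 0 \<omega>) \<partial>M) = 0"
  shows "(\<forall>i z. subj_corr_star M S X i (i + z) = subj_corr_star M S X i0 (i0 + z)) \<and>
    (\<exists>\<sigma>\<ge>0. weak_conv_m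
      (\<lambda>l. distr M borel (\<lambda>\<omega>. 1 / sqrt (real l ^ CARD('n)) *
         (\<Sum>i | \<forall>k. 0 \<le> i $ k \<and> i $ k < int l. f (X i \<omega>))))
      (gaussian_law (\<sigma>\<^sup>2)))"
proof -
  interpret prob_space M by fact
  \<comment> \<open>Yields the independence of the base point claimed in the conclusion, and moves
    the summability hypothesis from \<open>i0\<close> to the origin used in
    \<open>stationary_field\<close>.\<close>
  have translate: "subj_corr_star M S X i (i + z) = subj_corr_star M S X 0 z" for i z
    using subj_corr_star_translation[OF assms(1-3), of 0 i z] by (simp add: add.commute)
  interpret lattice_field M S X
    using assms(2-4) by unfold_locales (auto simp: translate)
  have "f \<in> observables" using assms(5-7) by (simp add: observables_def)
  then obtain v where v: "0 \<le> v" "weak_conv_m (\<lambda>l. distr M borel (normalized_sum (int_box l) f)) (gaussian_law v)"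
    using central_limit by blast
  have "normalized_sum (int_box l) f = (\<lambda>\<omega>. 1 / sqrt (real l ^ CARD('n)) *
         (\<Sum>i | \<forall>k. 0 \<le> i $ k \<and> i $ k < int l. f (X i \<omega>)))" for l
    by (simp add: normalized_sum_def int_box(2)) (simp add: int_box_def)
  then have "\<exists>\<sigma>\<ge>0. weak_conv_m
      (\<lambda>l. distr M borel (\<lambda>\<omega>. 1 / sqrt (real l ^ CARD('n)) *
         (\<Sum>i | \<forall>k. 0 \<le> i $ k \<and> i $ k < int l. f (X i \<omega>))))
      (gaussian_law (\<sigma>\<^sup>2))"
    using v by (intro exI[of _ "sqrt v"]) simp
  then show ?thesis by (simp add: translate)
qed

end
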